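(* Let $V=L(c,0)$ be the simple Virasoro vertex operator algebra with central charge $c=c_{p,q}=1-\frac{6(p-q)^2}{pq}$ for some coprime integers $p,q\ge 2$. Then for every $L(0)$-graded $V$-module $W$ whose lowest weight is greater than or equal to $-3$, $H^1(V,W)=Z^1(V,W)$, i.e. every grading-preserving derivation $V\to W$ is a zero-mode derivation.
   Context: $V=(V,Y,\mathbf 1,\omega)$ is a vertex operator algebra over $\mathbb C$ with $Y(\omega,x)=\sum_nL(n)x^{-n-2}$. $L(c,0)$ is the irreducible highest-weight module for the Virasoro algebra of central charge $c$ and lowest weight $0$, with its standard simple VOA structure. A $V$-module $(W,Y_W)$ is a direct sum of generalized $L(0)$-eigenspaces such that, for every $m\in\mathbb C$, the generalized eigenspace of eigenvalue $m-n$ vanishes for all sufficiently large $n\in\mathbb Z_+$. (For the given $c$ every weak $V$-module is a direct sum of irreducible modules, and the irreducible modules are the highest-weight modules $L(c,h)$ with $h=\frac{(np-mq)^2-(p-q)^2}{4pq}$, $0<m<p$, $0<n<q$ integers.) $L(0)$-graded means that the grading operator $\mathbf d_W$ of $W$ is $L(0)$; $W_{[m]}=\{w\in W:\mathbf d_Ww=mw\}$. Put $Y_{WV}^W(w,x)v=e^{xL(-1)}Y_W(v,-x)w=\sum_{n\in\mathbb Z}w_nv\,x^{-n-1}$ for $w\in W,v\in V$. A (grading-preserving) derivation is a linear map $F:V\to W$ with $F\circ L(0)=\mathbf d_W\circ F$ and $F(Y(u,x)v)=Y_W(u,x)F(v)+Y_{WV}^W(F(u),x)v$ for all $u,v\in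 V$. $H^1(V,W)$ is (identified with) the space of all such derivations. A zero-mode derivation is one of the form $v\mapsto w_0v$ with $w\in W_{[1]}$; $Z^1(V,W)$ is the space of these. *)

theory Defs
  imports Complex_Main "HOL-Library.Groups_Big_Fun"
begin

text \<open>
  Complex vector spaces are types with an explicit scalar multiplication satisfying
  \<^locale>\<open>vector_space\<close>. A vertex operator map is given by its modes:
  \<open>Y u n v\<close> stands for \<open>u\<^sub>n v\<close>, where \<open>Y(u,x)v = \<Sum>n. u\<^sub>n v x\<^bsup>-n-1\<^esup>\<close>.
  \<^const>\<open>Sum_any\<close> is the sum over the finite support of its argument; the lower truncation
  condition makes the support finite wherever it is used below.
\<close>

type_synonym ('v, 'w) modes = "'v \<Rightarrow> int \<Rightarrow> 'w \<Rightarrow> 'w"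
type_synonym 'v scaling = "complex \<Rightarrow> 'v \<Rightarrow> 'v"


section \<open>Eigenspaces\<close>

definition eigenspace :: "'v::ab_group_add scaling \<Rightarrow> ('v \<Rightarrow> 'v) \<Rightarrow> complex \<Rightarrow> 'v set" where
  "eigenspace s T m = {v. T v = s m v}"

definition gen_eigenspace :: "'v::ab_group_add scaling \<Rightarrow> ('v \<Rightarrow> 'v) \<Rightarrow> complex \<Rightarrow> 'v set" where
  "gen_eigenspace s T m = {v. \<exists>k::nat. ((\<lambda>u. T u - s m u) ^^ k) v = 0}"


section \<open>Vertex algebras and weak modules\<close>

text \<open>
  The coefficient of \<open>x\<^sub>0\<^bsup>-l-1\<^esup> x\<^sub>1\<^bsup>-m-1\<^esup> x\<^sub>2\<^bsup>-n-1\<^esup>\<close> in the Jacobi identity, applied to a vector \<open>w\<close>.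
\<close>

definition jacobi_identity ::
  "('v, 'v) modes \<Rightarrow> 'w::ab_group_add scaling \<Rightarrow> ('v, 'w) modes \<Rightarrow> bool" where
  "jacobi_identity Y sW YW \<longleftrightarrow> (\<forall>u v w. \<forall>l m n :: int.
     Sum_any (\<lambda>i::nat. sW ((of_int m :: complex) gchoose i)
        (YW (Y u (l + int i) v) (m + n - int i) w))
   = Sum_any (\<lambda>i::nat. sW ((-1) ^ i * ((of_int l :: complex) gchoose i))
        (YW u (m + l - int i) (YW v (n + int i) w)))
   - Sum_any (\<lambda>i::nat. sW ((-1) powi l * (-1) ^ i * ((of_int l :: complex) gchoose i))
        (YW v (n + l - int i) (YW u (m + int i) w))))"

text \<open>With \<open>sW = sV\<close> and \<open>YW = Y\<close> this is the part of the vertex algebra axioms shared with modules.\<close>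

definition weak_module ::
  "'v::ab_group_add scaling \<Rightarrow> ('v, 'v) modes \<Rightarrow> 'v \<Rightarrow>
   'w::ab_group_add scaling \<Rightarrow> ('v, 'w) modes \<Rightarrow> bool" where
  "weak_module sV Y vac sW YW \<longleftrightarrow>
     vector_space sW \<and>
     (\<forall>u n. Vector_Spaces.linear sW sW (YW u n)) \<and>
     (\<forall>n w. Vector_Spaces.linear sV sW (\<lambda>u. YW u n w)) \<and>
     (\<forall>u w. \<exists>N. \<forall>n\<ge>N. YW u n w = 0) \<and>
     (\<forall>n w. YW vac n w = (if n = -1 then w else 0)) \<and>
     jacobi_identity Y sW YW"

definition vertex_algebra ::
  "'v::ab_group_add scaling \<Rightarrow> ('v, 'v) modes \<Rightarrow> 'v \<Rightarrow> bool" where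
  "vertex_algebra s Y vac \<longleftrightarrow>
     weak_module s Y vac s Y \<and>
     (\<forall>v. \<forall>n\<ge>0. Y v n vac = 0) \<and> (\<forall>v. Y v (-1) vac = v)"


section \<open>Representations of the Virasoro algebra\<close>

definition virasoro_rep ::
  "'v::ab_group_add scaling \<Rightarrow> (int \<Rightarrow> 'v \<Rightarrow> 'v) \<Rightarrow> complex \<Rightarrow> bool" where
  "virasoro_rep s L c \<longleftrightarrow>
     vector_space s \<and> (\<forall>n. Vector_Spaces.linear s s (L n)) \<and>
     (\<forall>m n v. L m (L n v) - L n (L m v) =
        s (of_int (m - n)) (L (m + n) v)
        + (if m + n = 0 then s (of_int (m ^ 3 - m) / 12 * c) v else 0))"

definition virasoro_submodule ::
  "'v::ab_group_add scaling \<Rightarrow> (int \<Rightarrow> 'v \<Rightarrow> 'v) \<Rightarrow> 'v set \<Rightarrow> bool" where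
  "virasoro_submodule s L S \<longleftrightarrow> module.subspace s S \<and> (\<forall>n. \<forall>v\<in>S. L n v \<in> S)"

definition virasoro_irreducible ::
  "'v::ab_group_add scaling \<Rightarrow> (int \<Rightarrow> 'v \<Rightarrow> 'v) \<Rightarrow> bool" where
  "virasoro_irreducible s L \<longleftrightarrow>
     (\<exists>v::'v. v \<noteq> 0) \<and> (\<forall>S. virasoro_submodule s L S \<longrightarrow> S = {0} \<or> S = UNIV)"

definition virasoro_highest_weight ::
  "'v::ab_group_add scaling \<Rightarrow> (int \<Rightarrow> 'v \<Rightarrow> 'v) \<Rightarrow> complex \<Rightarrow> complex \<Rightarrow> 'v \<Rightarrow> bool" where
  "virasoro_highest_weight s L c h v \<longleftrightarrow>
     virasoro_rep s L c \<and> v \<noteq> 0 \<and> L 0 v = s h v \<and> (\<forall>n>0. L n v = 0) \<and>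
     (\<forall>S. virasoro_submodule s L S \<and> v \<in> S \<longrightarrow> S = UNIV)"


section \<open>Vertex operator algebras and their modules\<close>

text \<open>\<open>L(n) = \<omega>\<^bsub>n+1\<^esub>\<close>, from \<open>Y(\<omega>,x) = \<Sum>n. L(n) x\<^bsup>-n-2\<^esup>\<close>.\<close>

definition Lmode :: "('v, 'w) modes \<Rightarrow> 'v \<Rightarrow> int \<Rightarrow> 'w \<Rightarrow> 'w" where
  "Lmode YW \<omega> n = YW \<omega> (n + 1)"

text \<open>
  Sums of (generalized) eigenspaces for distinct eigenvalues are automatically direct, so
  in the next two definitions it suffices that these spaces span.
\<close>

definition vertex_operator_algebra ::
  "'v::ab_group_add scaling \<Rightarrow> ('v, 'v) modes \<Rightarrow> 'v \<Rightarrow> 'v \<Rightarrow> complex \<Rightarrow> bool" where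
  "vertex_operator_algebra s Y vac \<omega> c \<longleftrightarrow>
     vertex_algebra s Y vac \<and>
     virasoro_rep s (Lmode Y \<omega>) c \<and>
     (\<forall>v n w. Y (Lmode Y \<omega> (-1) v) n w = s (- of_int n) (Y v (n - 1) w)) \<and>
     module.span s (\<Union>n::int. eigenspace s (Lmode Y \<omega> 0) (of_int n)) = UNIV \<and>
     (\<forall>n::int. \<exists>B. finite B \<and>
        eigenspace s (Lmode Y \<omega> 0) (of_int n) \<subseteq> module.span s B) \<and>
     (\<exists>N::int. \<forall>n<N. eigenspace s (Lmode Y \<omega> 0) (of_int n) = {0})"

definition voa_module ::
  "'v::ab_group_add scaling \<Rightarrow> ('v, 'v) modes \<Rightarrow> 'v \<Rightarrow> 'v \<Rightarrow>
   'w::ab_group_add scaling \<Rightarrow> ('v, 'w) modes \<Rightarrow> bool" where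
  "voa_module sV Y vac \<omega> sW YW \<longleftrightarrow>
     weak_module sV Y vac sW YW \<and>
     module.span sW (\<Union>m. gen_eigenspace sW (Lmode YW \<omega> 0) m) = UNIV \<and>
     (\<forall>m. \<exists>N::nat. \<forall>n\<ge>N. gen_eigenspace sW (Lmode YW \<omega> 0) (m - of_nat n) = {0})"

text \<open>
  \<open>L(c,0)\<close> as a vertex operator algebra, up to isomorphism: its vacuum vector is a highest weight
  vector of weight \<open>0\<close> for an irreducible highest weight Virasoro module of central charge \<open>c\<close>.
  This determines the structure, since \<open>\<omega> = L(-2)\<one>\<close> by the creation property, \<open>Y(\<omega>,x)\<close> is given by
  the Virasoro action, and \<open>\<omega>\<close> generates.
\<close>

definition is_simple_virasoro_voa ::
  "'v::ab_group_add scaling \<Rightarrow> ('v, 'v) modes \<Rightarrow> 'v \<Rightarrow> 'v \<Rightarrow> complex \<Rightarrow> bool" where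
  "is_simple_virasoro_voa s Y vac \<omega> c \<longleftrightarrow>
     vertex_operator_algebra s Y vac \<omega> c \<and>
     virasoro_irreducible s (Lmode Y \<omega>) \<and>
     virasoro_highest_weight s (Lmode Y \<omega>) c 0 vac"

text \<open>
  The operator multiplying by \<open>m\<close> on the homogeneous subspace of weight \<open>m\<close>, i.e. on the
  generalized eigenspace of \<open>L(0)\<close> for \<open>m\<close>.
\<close>

definition grading_operator ::
  "'w::ab_group_add scaling \<Rightarrow> ('w \<Rightarrow> 'w) \<Rightarrow> ('w \<Rightarrow> 'w) \<Rightarrow> bool" where
  "grading_operator s L0 d \<longleftrightarrow>
     Vector_Spaces.linear s s d \<and> (\<forall>m. \<forall>w\<in>gen_eigenspace s L0 m. d w = s m w)"

abbreviation weight_space ::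
  "'w::ab_group_add scaling \<Rightarrow> ('w \<Rightarrow> 'w) \<Rightarrow> complex \<Rightarrow> 'w set" where
  "weight_space s d m \<equiv> eigenspace s d m"

text \<open>Weights are complex numbers and are compared by their real parts.\<close>

definition lowest_weight_ge ::
  "'w::ab_group_add scaling \<Rightarrow> ('w \<Rightarrow> 'w) \<Rightarrow> real \<Rightarrow> bool" where
  "lowest_weight_ge s d r \<longleftrightarrow> (\<forall>m. weight_space s d m \<noteq> {0} \<longrightarrow> r \<le> Re m)"


section \<open>Derivations\<close>

text \<open>
  \<open>skew_mode YW \<omega> sW w n v\<close> is \<open>w\<^sub>n v\<close>, the coefficient of \<open>x\<^bsup>-n-1\<^esup>\<close> in
  \<open>e\<^bsup>xL(-1)\<^esup> Y\<^sub>W(v,-x)w = \<Sum>j k. (-1)\<^bsup>-k-1\<^esup> / j! L(-1)\<^bsup>j\<^esup> v\<^sub>k w x\<^bsup>j-k-1\<^esup>\<close>, to which \<open>k = n + j\<close> contributes.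
\<close>

definition skew_mode ::
  "('v, 'w) modes \<Rightarrow> 'v \<Rightarrow> 'w::ab_group_add scaling \<Rightarrow> 'w \<Rightarrow> int \<Rightarrow> 'v \<Rightarrow> 'w" where
  "skew_mode YW \<omega> sW w n v =
     Sum_any (\<lambda>j::nat. sW ((-1) powi (- (n + int j) - 1) / fact j)
       ((Lmode YW \<omega> (-1) ^^ j) (YW v (n + int j) w)))"

definition H1 ::
  "'v::ab_group_add scaling \<Rightarrow> ('v, 'v) modes \<Rightarrow> 'v \<Rightarrow>
   'w::ab_group_add scaling \<Rightarrow> ('v, 'w) modes \<Rightarrow> ('w \<Rightarrow> 'w) \<Rightarrow> ('v \<Rightarrow> 'w) set" where
  "H1 sV Y \<omega> sW YW dW =
     {F. Vector_Spaces.linear sV sW F \<and>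
         F \<circ> Lmode Y \<omega> 0 = dW \<circ> F \<and>
         (\<forall>u n v. F (Y u n v) = YW u n (F v) + skew_mode YW \<omega> sW (F u) n v)}"

definition Z1 ::
  "'v \<Rightarrow> 'w::ab_group_add scaling \<Rightarrow> ('v, 'w) modes \<Rightarrow> ('w \<Rightarrow> 'w) \<Rightarrow> ('v \<Rightarrow> 'w) set" where
  "Z1 \<omega> sW YW dW = {\<lambda>v. skew_mode YW \<omega> sW w 0 v | w. w \<in> weight_space sW dW 1}"

end

theory Submission
  imports Defs "HOL-Computational_Algebra.Polynomial" "HOL-Library.Function_Algebras"
begin

text \<open>
  A derivation \<open>F\<close> is determined by \<open>f = F \<omega>\<close>. Evaluating \<open>F\<close> on \<open>\<omega>\<^sub>n \<omega>\<close> for \<open>n = 1, 3, 5\<close> gives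
  \<open>f = L(-1) g\<close> with \<open>g\<close> of weight \<open>1\<close> such that \<open>L(1) g\<close> and \<open>L(3) g\<close> are expressed through \<open>L(2) g\<close> and
  \<open>L(4) g\<close>. Subtracting a zero-mode derivation, found by solving a linear system that is regular for
  \<open>c \<noteq> 25, 26, 28, 152/5\<close>, we reach \<open>L(2) g = L(4) g = 0\<close>, so that \<open>g\<close> is primary of weight \<open>1\<close>.

  It remains to see that no module over the minimal model contains a primary vector \<open>g \<noteq> 0\<close> of weight
  \<open>1\<close>. Let \<open>t = p / q\<close> and let \<open>h\<^sub>m = (m - 1) ((m + 1) t - 2) / 4\<close> be the weight \<open>h\<^sub>m\<^sub>,\<^sub>1\<close> of the Kac table. The
  coefficient of \<open>g\<close> in \<open>v\<^sub>n g\<close>, \<open>n = wt v - 1\<close>, is a three-point functional of the Verma module of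
  weight \<open>h\<^sub>1 = 0\<close> that vanishes on its maximal submodule. Fusion with the degenerate field of weight
  \<open>h\<^sub>2\<close> carries such a functional from \<open>h\<^sub>m\<close> to \<open>h\<^sub>m\<^sub>+\<^sub>1\<close>, as long as \<open>(m + 1) t\<close> is not an integer. For
  \<open>m = q - 1\<close> the two exponents of the Belavin-Polyakov-Zamolodchikov (BPZ) equation differ by the
  integer \<open>p - 1\<close>, and the recursion for its power series solution is inconsistent at this order.
\<close>

section \<open>Functions on words\<close>

text \<open>The three-point functional of \<open>g\<close> has ket weight 0 and bra weight 1, and
  the formula for h_m covers both: h_1 = 0 and h_(-1) = 1. Each fusion raises both indices by one,
  so after m steps bra and ket have the weights h_(m-1) and h_(m+1), with difference 1 - m t. These
  are the exponents in the chain of transfers. The chain stops at h_(q-1), the last h_m in the Kac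
  table. There the inconsistency could be avoided only if p - 1 = 1 - (q - 2) t, that is, (p - 1)(q
  - 1) = 1, which coprimality forbids. The bound -3 on the weights shapes the other half. Since
  \<open>g\<close> has weight 1, L(n) g = 0 for n \<ge> 5, so every exponential of L(-1) breaks off
  after a few terms. Moreover L(4) g has the lowest possible weight and L(2) g lies just above it,
  so the zero mode to be subtracted can be sought in a small explicit space of descendants.\<close>

text \<open>
  Verma modules are avoided: a function on words \<open>k\<^sub>1 \<dots> k\<^sub>r\<close> is a functional on the free algebra
  generated by \<open>L(-1), L(-2), \<dots>\<close>. On such functions \<open>L(m)\<close> acts by \<open>shift m\<close>, and \<open>L(-k)\<close> by \<open>creation\<close>,
  which is defined by commuting \<open>L(-k)\<close> to the left of all \<open>L(m)\<close>; \<open>h\<close> is the weight of the empty word.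
  Words with a letter \<open>0\<close> carry no meaning.
\<close>

abbreviation shift :: "nat \<Rightarrow> (nat list \<Rightarrow> complex) \<Rightarrow> nat list \<Rightarrow> complex" where
  "shift m \<xi> \<equiv> (\<lambda>w. \<xi> (m # w))"

fun creation :: "complex \<Rightarrow> complex \<Rightarrow> nat \<Rightarrow> (nat list \<Rightarrow> complex) \<Rightarrow> nat list \<Rightarrow> complex" where
  "creation c h k \<xi> [] = 0"
| "creation c h k \<xi> (m # w) = creation c h k (shift m \<xi>) w +
     (if m < k then of_nat (m + k) * creation c h (k - m) \<xi> w
      else if m = k then (2 * of_nat k * (h + of_nat (sum_list w)) + c / 12 * (of_nat k ^ 3 - of_nat k)) * \<xi> w
      else of_nat (m + k) * \<xi> ((m - k) # w))"

definition compositions :: "nat \<Rightarrow> nat list set" where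
  "compositions n = {w. 0 \<notin> set w \<and> sum_list w = n}"

lemma Cons_compositions: "k # w \<in> compositions n \<longleftrightarrow> 0 < k \<and> k \<le> n \<and> w \<in> compositions (n - k)"
  by (auto simp: compositions_def)

lemma Nil_compositions [simp]: "[] \<in> compositions n \<longleftrightarrow> n = 0"
  by (auto simp: compositions_def)

lemma finite_compositions: "finite (compositions n)"
proof -
  have "compositions n \<subseteq> {w. set w \<subseteq> {..n} \<and> length w \<le> n}"
  proof
    fix w assume w: "w \<in> compositions n"
    have "length w \<le> sum_list w" if "0 \<notin> set w" for w :: "nat list"
      using that by (induction w) auto
    then show "w \<in> {w. set w \<subseteq> {..n} \<and> length w \<le> n}"
      using w member_le_sum_list by (fastforce simp: compositions_def)
  qed
  moreover have "finite {w. set w \<subseteq> {..n} \<and> length w \<le> n}"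
    by (rule finite_lists_length_le) simp
  ultimately show ?thesis by (rule finite_subset)
qed

lemma creation_linear:
  "creation c h k (\<lambda>w. a * \<xi> w + b * \<eta> w) w = a * creation c h k \<xi> w + b * creation c h k \<eta> w"
proof (induction w arbitrary: k \<xi> \<eta>)
  case (Cons m w)
  show ?case by (simp add: Cons.IH field_simps)
qed simp

lemma creation_weight:
  "creation c h k (\<lambda>w. (a + of_nat (sum_list w)) * \<xi> w) w = (a + of_nat (sum_list w) - of_nat k) * creation c h k \<xi> w"
proof (induction w arbitrary: k \<xi> a)
  case (Cons m w)
  have "shift m (\<lambda>w. (a + of_nat (sum_list w)) * \<xi> w)
      = (\<lambda>w. (a + of_nat m + of_nat (sum_list w)) * shift m \<xi> w)"
    by (simp add: add.assoc)
  then show ?case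
    by (simp only: creation.simps Cons.IH) (auto simp: algebra_simps of_nat_diff)
qed simp

lemma creation_cong:
  assumes "w \<in> compositions N" "k > 0" "\<And>u. k \<le> N \<Longrightarrow> u \<in> compositions (N - k) \<Longrightarrow> \<xi> u = \<eta> u"
  shows "creation c h k \<xi> w = creation c h k \<eta> w"
  using assms
proof (induction w arbitrary: k \<xi> \<eta> N)
  case (Cons m w)
  have m: "0 < m" "m \<le> N" "w \<in> compositions (N - m)" using Cons.prems(1) by (auto simp: Cons_compositions)
  have 1: "creation c h k (shift m \<xi>) w = creation c h k (shift m \<eta>) w"
    by (rule Cons.IH[OF m(3) Cons.prems(2)]) (use m in \<open>auto intro!: Cons.prems(3) simp: Cons_compositions add.commute\<close>)
  have 2: "creation c h (k - m) \<xi> w = creation c h (k - m) \<eta> w" if "m < k"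
    by (rule Cons.IH[OF m(3)]) (use m that in \<open>auto intro!: Cons.prems(3)\<close>)
  have 3: "\<xi> w = \<eta> w" if "m = k" using m that by (auto intro!: Cons.prems(3))
  have 4: "\<xi> ((m - k) # w) = \<eta> ((m - k) # w)" if "m > k"
    using m that by (auto intro!: Cons.prems(3) simp: Cons_compositions)
  show ?case using 1 2 3 4 by auto
qed simp

lemma creation_zero [simp]: "creation c h k (\<lambda>w. 0) w = 0"
  using creation_linear[of c h k 0 "\<lambda>w. 0" 0 "\<lambda>w. 0"] by simp

lemma creation_trunc: "w \<in> compositions N \<Longrightarrow> N < k \<Longrightarrow> creation c h k \<xi> w = 0"
  using creation_cong[of w N k \<xi> "\<lambda>w. 0" c h] by simp

text \<open>
  The matrix coefficient \<open>\<langle>h'| \<phi>(1) \<xi>\<rangle>\<close> of the degenerate field for \<open>\<xi>\<close> of level \<open>n\<close>, computed from the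
  null vector of \<open>\<phi>\<close>: \<open>n (n - \<delta>) \<langle>h'| \<phi>(1) \<xi>\<rangle> = t (\<Sum>k. \<langle>h'| \<phi>(1) L(k) \<xi>\<rangle>)\<close>. If \<open>n = \<delta>\<close>, its value is
  the junk value \<open>0\<close>.
\<close>

function degen_functional :: "complex \<Rightarrow> complex \<Rightarrow> nat \<Rightarrow> (nat list \<Rightarrow> complex) \<Rightarrow> complex" where
  "degen_functional t \<delta> n \<xi> = (if n = 0 then \<xi> [] else
     t / (of_nat n * (of_nat n - \<delta>)) * (\<Sum>k\<in>{1..n}. degen_functional t \<delta> (n - k) (shift k \<xi>)))"
  by auto
termination by (relation "measure (\<lambda>(t, d, n, x). n)") auto
declare degen_functional.simps [simp del]

lemma degen_functional_0 [simp]: "degen_functional t \<delta> 0 \<xi> = \<xi> []"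
  by (simp add: degen_functional.simps)

lemma degen_functional_rec:
  assumes "of_nat n \<noteq> \<delta> \<or> n = 0"
  shows "of_nat n * (of_nat n - \<delta>) * degen_functional t \<delta> n \<xi> = t * (\<Sum>k\<in>{1..n}. degen_functional t \<delta> (n - k) (shift k \<xi>))"
  using assms by (subst degen_functional.simps) (auto simp: field_simps)

lemma degen_functional_linear: "degen_functional t \<delta> n (\<lambda>w. a * \<xi> w + b * \<eta> w) = a * degen_functional t \<delta> n \<xi> + b * degen_functional t \<delta> n \<eta>"
proof (induction n arbitrary: \<xi> \<eta> rule: less_induct)
  case (less n)
  have "(\<Sum>k\<in>{1..n}. degen_functional t \<delta> (n - k) (\<lambda>w. a * \<xi> (k # w) + b * \<eta> (k # w)))
      = (\<Sum>k\<in>{1..n}. a * degen_functional t \<delta> (n - k) (shift k \<xi>) + b * degen_functional t \<delta> (n - k) (shift k \<eta>))"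
    by (rule sum.cong[OF refl], rule less.IH) auto
  then show ?case
    by (subst (1 2 3) degen_functional.simps) (simp add: sum.distrib sum_distrib_left algebra_simps)
qed

lemma degen_functional_cong:
  assumes "\<And>u. u \<in> compositions n \<Longrightarrow> \<xi> u = \<eta> u" shows "degen_functional t \<delta> n \<xi> = degen_functional t \<delta> n \<eta>"
  using assms
proof (induction n arbitrary: \<xi> \<eta> rule: less_induct)
  case (less n)
  have "(\<Sum>k\<in>{1..n}. degen_functional t \<delta> (n - k) (shift k \<xi>)) = (\<Sum>k\<in>{1..n}. degen_functional t \<delta> (n - k) (shift k \<eta>))"
    by (rule sum.cong[OF refl], rule less.IH) (auto intro!: less.prems simp: Cons_compositions)
  then show ?case
    by (subst (1 2) degen_functional.simps) (use less.prems[of "[]"] in auto)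
qed

lemma degen_functional_scale: "degen_functional t \<delta> n (\<lambda>w. a * \<xi> w) = a * degen_functional t \<delta> n \<xi>"
  using degen_functional_linear[of t \<delta> n a \<xi> 0 "\<lambda>w. 0"] by simp

lemma degen_functional_add: "degen_functional t \<delta> n (\<lambda>w. \<xi> w + \<eta> w) = degen_functional t \<delta> n \<xi> + degen_functional t \<delta> n \<eta>"
  using degen_functional_linear[of t \<delta> n 1 \<xi> 1 \<eta>] by simp

lemma degen_functional_zero [simp]: "degen_functional t \<delta> n (\<lambda>w. 0) = 0"
  using degen_functional_scale[of t \<delta> n 0 "\<lambda>w. 0"] by simp

lemma degen_functional_weight: "degen_functional t \<delta> n (\<lambda>w. g (sum_list w) * \<xi> w) = g n * degen_functional t \<delta> n \<xi>"
  unfolding degen_functional_scale[symmetric] by (rule degen_functional_cong) (simp add: compositions_def)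

section \<open>The algebra behind the BPZ recursion\<close>

lemma sum_1_less:
  fixes X \<phi> :: complex
  assumes "j > 0"
  shows "(\<Sum>k\<in>{1..<j}. of_nat (k + j) * (X + of_nat (j - k) * \<phi>))
     = 3 * of_nat j * (of_nat j - 1) / 2 * X + \<phi> * of_nat j * (of_nat j - 1) * (4 * of_nat j + 1) / 6"
proof -
  have "(\<Sum>k\<in>{1..<j}. of_nat (k + j) * (X + of_nat (j - k) * \<phi>))
    = (\<Sum>k\<in>{1..<j}. of_nat (k + j) * (X + (of_nat j - of_nat k) * \<phi>))"
    by (rule sum.cong) (auto simp: of_nat_diff)
  moreover have "(\<Sum>k\<in>{1..<Suc i}. of_nat (k + j) * (X + (of_nat j - of_nat k) * \<phi>))
     = X * (of_nat i * of_nat j + of_nat i * (of_nat i + 1) / 2)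
      + \<phi> * (of_nat i * of_nat j ^ 2 - of_nat i * (of_nat i + 1) * (2 * of_nat i + 1) / 6)" for i
    by (induction i) (simp_all add: field_simps power2_eq_square)
  from this[of "j - 1"] assms have "(\<Sum>k\<in>{1..<j}. of_nat (k + j) * (X + (of_nat j - of_nat k) * \<phi>))
     = X * ((of_nat j - 1) * of_nat j + (of_nat j - 1) * (of_nat j) / 2)
      + \<phi> * ((of_nat j - 1) * of_nat j ^ 2 - (of_nat j - 1) * (of_nat j) * (2 * of_nat j - 1) / 6)"
    by (simp add: of_nat_diff algebra_simps)
  ultimately show ?thesis by (simp add: field_simps power2_eq_square)
qed

text \<open>The level 2 null vector of the degenerate field enters here: \<phi> and c are
  parametrised by t, and the relation between d and h is the fusion rule. \<open>b\<close> stands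
  for a value on level n and \<open>A\<close> for a sum of n terms of the recursion, which the last
  hypothesis eliminates. The same identity closes the inductions of
  \<open>sum_degen_functional_creation\<close> and of its dual
  \<open>three_point_bpz\<close>.\<close>

lemma bpz_algebra:
  fixes t c \<phi> d \<delta> h n j b A :: complex
  assumes t: "t \<noteq> 0" and c: "c = 13 - 6 * t - 6 / t" and \<phi>: "\<phi> = (3 * t - 2) / 4"
    and d: "2 * d + \<delta> = t / 2" and h: "2 * d\<^sup>2 + t * d = 2 * h * t + (3 * t - 2) * (t - 2) / 8"
    and A: "t * A = n * (n - \<delta>) * b"
  shows "t * ((n + d + j * \<phi> + 2 * j) * A + (3 * j * (j - 1) / 2 * (n + d) + \<phi> * j * (j - 1) * (4 * j + 1) / 6
       + (2 * j * (h + n) + c / 12 * (j ^ 3 - j))) * b) = (n + j) * (n + j - \<delta>) * (n + d + j * \<phi>) * b"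
proof -
  have tc: "t * c = 13 * t - 6 * t\<^sup>2 - 6" using t c by (simp add: field_simps power2_eq_square)
  have \<delta>: "\<delta> = t / 2 - 2 * d" using d by algebra
  have th: "t * h = d\<^sup>2 + t * d / 2 - (3 * t - 2) * (t - 2) / 16" using h by (simp add: field_simps) algebra
  have "t * ((n + d + j * \<phi> + 2 * j) * A + (3 * j * (j - 1) / 2 * (n + d) + \<phi> * j * (j - 1) * (4 * j + 1) / 6
       + (2 * j * (h + n) + c / 12 * (j ^ 3 - j))) * b)
    = (n + d + j * \<phi> + 2 * j) * (t * A) + (t * (3 * j * (j - 1) / 2 * (n + d) + \<phi> * j * (j - 1) * (4 * j + 1) / 6)
       + 2 * j * (t * h + t * n) + (t * c) / 12 * (j ^ 3 - j)) * b"
    by (simp add: algebra_simps)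
  also have "\<dots> = (n + j) * (n + j - \<delta>) * (n + d + j * \<phi>) * b"
    unfolding A tc th \<delta> \<phi> by (simp add: field_simps power2_eq_square power3_eq_cube)
  finally show ?thesis .
qed

lemma sum_shift_split:
  fixes F :: "nat \<Rightarrow> complex"
  assumes "j > 0"
  shows "(\<Sum>k\<in>{1..n + j}. F k) = (\<Sum>k\<in>{1..<j}. F k) + F j + (\<Sum>k\<in>{1..n}. F (k + j))"
proof -
  have "{1..n + j} = {1..<j} \<union> {j} \<union> {1 + j..n + j}" using assms by auto
  moreover have "(\<Sum>k\<in>{1 + j..n + j}. F k) = (\<Sum>k\<in>{1..n}. F (k + j))"
    by (rule sum.shift_bounds_cl_nat_ivl)
  moreover have "sum F ({1..<j} \<union> {j} \<union> {1 + j..n + j}) = sum F ({1..<j} \<union> {j}) + sum F {1 + j..n + j}"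
    by (rule sum.union_disjoint) auto
  ultimately show ?thesis by simp
qed

section \<open>The BPZ recursion\<close>

text \<open>
  Here \<open>\<phi>\<close> is the weight of the degenerate field and \<open>d = h - h'\<close>, where \<open>h\<close> and \<open>h'\<close> are neighbouring
  weights \<open>h\<^sub>m\<close>, \<open>h\<^sub>m\<^sub>\<plusminus>\<^sub>1\<close>; \<open>h + \<delta>\<close> is the other neighbour of \<open>h'\<close>.
\<close>

locale bpz =
  fixes t c h d \<delta> \<phi> :: complex
  assumes t: "t \<noteq> 0" and c: "c = 13 - 6 * t - 6 / t" and \<phi>: "\<phi> = (3 * t - 2) / 4"
    and d: "2 * d + \<delta> = t / 2" and h: "2 * d\<^sup>2 + t * d = 2 * h * t + (3 * t - 2) * (t - 2) / 8"
begin

text \<open>Left undivided, and with the commutation rule on lower levels as an assumption, so that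
  it remains valid at n + j = \<delta>. There the recursion cannot be solved for the new
  coefficient, and this is the case that produces the contradiction.\<close>

lemma sum_degen_functional_creation:
  assumes j: "j > 0"
    and IH: "\<And>k n' \<xi>. n' + k < n + j \<Longrightarrow> k > 0 \<Longrightarrow>
      degen_functional t \<delta> (n' + k) (creation c h k \<xi>) = (of_nat n' + d + of_nat k * \<phi>) * degen_functional t \<delta> n' \<xi>"
    and ne: "of_nat n \<noteq> \<delta> \<or> n = 0"
  shows "t * (\<Sum>k\<in>{1..n + j}. degen_functional t \<delta> (n + j - k) (shift k (creation c h j \<xi>)))
    = of_nat (n + j) * (of_nat (n + j) - \<delta>) * (of_nat n + d + of_nat j * \<phi>) * degen_functional t \<delta> n \<xi>"
proof -
  define E where "E = of_nat n + d + of_nat j * \<phi>"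
  define a where "a k = degen_functional t \<delta> (n - k) (shift k \<xi>)" for k
  define b where "b = degen_functional t \<delta> n \<xi>"
  define A where "A = (\<Sum>k\<in>{1..n}. a k)"
  \<comment> \<open>\<open>R k\<close> is the contribution of the bracket of L(k) and L(-j); for k <
    j the induction hypothesis has already been applied.\<close>
  define R where "R k = (if k < j then of_nat (k + j) * (of_nat n + d + of_nat (j - k) * \<phi>) * b
      else if k = j then (2 * of_nat j * (h + of_nat n) + c / 12 * (of_nat j ^ 3 - of_nat j)) * b
      else of_nat (k + j) * a (k - j))" for k
  have 1: "degen_functional t \<delta> (n + j - k) (shift k (creation c h j \<xi>))
      = (if k \<le> n then (E - of_nat k) * a k else 0) + R k" if k: "k \<in> {1..n + j}" for k
  proof -
    have X: "degen_functional t \<delta> (n + j - k) (creation c h j (shift k \<xi>)) = (if k \<le> n then (E - of_nat k) * a k else 0)"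
    proof (cases "k \<le> n")
      case True
      then have "degen_functional t \<delta> ((n - k) + j) (creation c h j (shift k \<xi>)) = (of_nat (n - k) + d + of_nat j * \<phi>) * a k"
        unfolding a_def using k j by (intro IH) auto
      then show ?thesis using True by (simp add: E_def of_nat_diff algebra_simps)
    next
      case False
      have "degen_functional t \<delta> (n + j - k) (creation c h j (shift k \<xi>)) = degen_functional t \<delta> (n + j - k) (\<lambda>w. 0)"
        by (rule degen_functional_cong, rule creation_trunc) (use False k in auto)
      then show ?thesis using False by simp
    qed
    have Y: "degen_functional t \<delta> (n + j - k) (\<lambda>w. if k < j then of_nat (k + j) * creation c h (j - k) \<xi> w
      else if k = j then (2 * of_nat j * (h + of_nat (sum_list w)) + c / 12 * (of_nat j ^ 3 - of_nat j)) * \<xi> w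
      else of_nat (k + j) * \<xi> ((k - j) # w)) = R k"
    proof -
      consider "k < j" | "k = j" | "k > j" by linarith
      then show ?thesis
      proof cases
        case 1
        then have "degen_functional t \<delta> (n + (j - k)) (creation c h (j - k) \<xi>) = (of_nat n + d + of_nat (j - k) * \<phi>) * b"
          unfolding b_def using k by (intro IH) auto
        then show ?thesis using 1 by (simp add: R_def degen_functional_scale)
      next
        case 2
        then show ?thesis
          using degen_functional_weight[of t \<delta> n "\<lambda>m. 2 * of_nat j * (h + of_nat m) + c / 12 * (of_nat j ^ 3 - of_nat j)" \<xi>]
          by (simp add: R_def b_def)
      next
        case 3
        then show ?thesis using k by (simp add: R_def a_def degen_functional_scale)
      qed
    qed
    have "shift k (creation c h j \<xi>) = (\<lambda>w. creation c h j (shift k \<xi>) w +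
      (if k < j then of_nat (k + j) * creation c h (j - k) \<xi> w
      else if k = j then (2 * of_nat j * (h + of_nat (sum_list w)) + c / 12 * (of_nat j ^ 3 - of_nat j)) * \<xi> w
      else of_nat (k + j) * \<xi> ((k - j) # w)))"
      by (rule ext) auto
    then show ?thesis by (simp only: degen_functional_add X Y)
  qed
  have "(\<Sum>k\<in>{1..n + j}. degen_functional t \<delta> (n + j - k) (shift k (creation c h j \<xi>)))
      = (\<Sum>k\<in>{1..n + j}. if k \<le> n then (E - of_nat k) * a k else 0) + (\<Sum>k\<in>{1..n + j}. R k)"
    unfolding sum.distrib[symmetric] by (rule sum.cong[OF refl 1])
  also have "(\<Sum>k\<in>{1..n + j}. if k \<le> n then (E - of_nat k) * a k else 0) = (\<Sum>k\<in>{1..n}. (E - of_nat k) * a k)"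
    by (rule sum.mono_neutral_cong_right) auto
  also have "(\<Sum>k\<in>{1..n + j}. R k) = (\<Sum>k\<in>{1..<j}. R k) + R j + (\<Sum>k\<in>{1..n}. R (k + j))"
    by (rule sum_shift_split[OF j])
  also have "(\<Sum>k\<in>{1..<j}. R k) = (\<Sum>k\<in>{1..<j}. of_nat (k + j) * ((of_nat n + d) + of_nat (j - k) * \<phi>)) * b"
    by (simp add: R_def sum_distrib_right)
  also have "\<dots> = (3 * of_nat j * (of_nat j - 1) / 2 * (of_nat n + d)
      + \<phi> * of_nat j * (of_nat j - 1) * (4 * of_nat j + 1) / 6) * b"
    by (simp only: sum_1_less[OF j])
  also have "(\<Sum>k\<in>{1..n}. R (k + j)) = (\<Sum>k\<in>{1..n}. of_nat (k + j + j) * a k)"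
    using j by (intro sum.cong) (auto simp: R_def)
  also have "R j = (2 * of_nat j * (h + of_nat n) + c / 12 * (of_nat j ^ 3 - of_nat j)) * b"
    by (simp add: R_def)
  finally have 2: "(\<Sum>k\<in>{1..n + j}. degen_functional t \<delta> (n + j - k) (shift k (creation c h j \<xi>)))
     = (of_nat n + d + of_nat j * \<phi> + 2 * of_nat j) * A
     + (3 * of_nat j * (of_nat j - 1) / 2 * (of_nat n + d) + \<phi> * of_nat j * (of_nat j - 1) * (4 * of_nat j + 1) / 6
       + (2 * of_nat j * (h + of_nat n) + c / 12 * (of_nat j ^ 3 - of_nat j))) * b"
    unfolding A_def E_def
    by (simp add: algebra_simps sum.distrib sum_distrib_left sum_subtractf)
  have "t * A = of_nat n * (of_nat n - \<delta>) * b"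
    unfolding A_def a_def b_def using degen_functional_rec[OF ne] by simp
  from bpz_algebra[OF t c \<phi> d h this, of "of_nat j"]
  show ?thesis by (simp only: 2 b_def of_nat_add)
qed

text \<open>The bra is annihilated by L(-k) acting from the right, so only the commutator of the
  field with L(-k) is left. The proof divides the undivided identity by (n + k)(n + k - \<delta>),
  which is why \<delta> must avoid all levels up to n + k.\<close>

lemma degen_functional_creation:
  assumes "k > 0" and ne: "\<And>j. 0 < j \<Longrightarrow> j \<le> n + k \<Longrightarrow> of_nat j \<noteq> \<delta>"
  shows "degen_functional t \<delta> (n + k) (creation c h k \<xi>) = (of_nat n + d + of_nat k * \<phi>) * degen_functional t \<delta> n \<xi>"
  using assms
proof (induction "n + k" arbitrary: n k \<xi> rule: less_induct)
  case less
  have "t * (\<Sum>i\<in>{1..n + k}. degen_functional t \<delta> (n + k - i) (shift i (creation c h k \<xi>)))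
    = of_nat (n + k) * (of_nat (n + k) - \<delta>) * (of_nat n + d + of_nat k * \<phi>) * degen_functional t \<delta> n \<xi>"
  proof (rule sum_degen_functional_creation[OF less.prems(1)])
    show "of_nat n \<noteq> \<delta> \<or> n = 0" using less.prems(2)[of n] by auto
  qed (use less in auto)
  moreover have "of_nat (n + k) \<noteq> \<delta>" "of_nat (n + k) \<noteq> (0 :: complex)"
    using less.prems by (auto simp del: of_nat_add)
  ultimately show ?case
    using degen_functional_rec[of "n + k" \<delta> t "creation c h k \<xi>"] less.prems(1) by (simp del: of_nat_add creation.simps)
qed

end

text \<open>
  The degenerate field as a map to functions on words for the weight \<open>h' = h - d\<close>; \<open>n\<close> is the level of \<open>\<xi>\<close>.
\<close>

fun degen_operator :: "complex \<Rightarrow> complex \<Rightarrow> complex \<Rightarrow> complex \<Rightarrow> nat \<Rightarrow> (nat list \<Rightarrow> complex) \<Rightarrow> nat list \<Rightarrow> complex" where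
  "degen_operator t d \<delta> \<phi> n \<xi> [] = degen_functional t \<delta> n \<xi>"
| "degen_operator t d \<delta> \<phi> n \<xi> (k # w) = (if k \<le> n then degen_operator t d \<delta> \<phi> (n - k) (shift k \<xi>) w else 0)
     + (of_nat (sum_list w) - of_nat n - d + of_nat k * \<phi>) * degen_operator t d \<delta> \<phi> n \<xi> w"

lemma degen_operator_linear:
  "degen_operator t d \<delta> \<phi> n (\<lambda>u. a * \<xi> u + b * \<eta> u) w = a * degen_operator t d \<delta> \<phi> n \<xi> w + b * degen_operator t d \<delta> \<phi> n \<eta> w"
proof (induction w arbitrary: n \<xi> \<eta>)
  case Nil
  show ?case by (simp add: degen_functional_linear)
next
  case (Cons k w)
  show ?case
    unfolding degen_operator.simps Cons.IH Cons.IH[of "n - k" "shift k \<xi>" "shift k \<eta>"] by (simp add: algebra_simps)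
qed

lemma degen_operator_cong:
  assumes "\<And>u. u \<in> compositions n \<Longrightarrow> \<xi> u = \<eta> u" "0 \<notin> set w"
  shows "degen_operator t d \<delta> \<phi> n \<xi> w = degen_operator t d \<delta> \<phi> n \<eta> w"
  using assms
proof (induction w arbitrary: n \<xi> \<eta>)
  case Nil
  from degen_functional_cong[OF Nil.prems(1)] show ?case by simp
next
  case (Cons k w)
  have "k \<le> n \<Longrightarrow> degen_operator t d \<delta> \<phi> (n - k) (shift k \<xi>) w = degen_operator t d \<delta> \<phi> (n - k) (shift k \<eta>) w"
    using Cons.prems by (intro Cons.IH) (auto simp: Cons_compositions)
  moreover have "degen_operator t d \<delta> \<phi> n \<xi> w = degen_operator t d \<delta> \<phi> n \<eta> w"
    using Cons.prems by (intro Cons.IH) auto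
  ultimately show ?case by simp
qed

lemma degen_operator_add: "degen_operator t d \<delta> \<phi> n (\<lambda>u. \<xi> u + \<eta> u) w = degen_operator t d \<delta> \<phi> n \<xi> w + degen_operator t d \<delta> \<phi> n \<eta> w"
  using degen_operator_linear[of t d \<delta> \<phi> n 1 \<xi> 1 \<eta> w] by simp

lemma degen_operator_scale: "degen_operator t d \<delta> \<phi> n (\<lambda>u. a * \<xi> u) w = a * degen_operator t d \<delta> \<phi> n \<xi> w"
  using degen_operator_linear[of t d \<delta> \<phi> n a \<xi> 0 \<xi> w] by simp

lemma degen_operator_weight:
  assumes "0 \<notin> set w"
  shows "degen_operator t d \<delta> \<phi> n (\<lambda>u. g (sum_list u) * \<xi> u) w = g n * degen_operator t d \<delta> \<phi> n \<xi> w"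
  unfolding degen_operator_scale[symmetric] by (rule degen_operator_cong) (use assms in \<open>auto simp: compositions_def\<close>)

lemma degen_operator_zero: "0 \<notin> set w \<Longrightarrow> (\<And>u. u \<in> compositions n \<Longrightarrow> \<xi> u = 0) \<Longrightarrow> degen_operator t d \<delta> \<phi> n \<xi> w = 0"
proof -
  assume "0 \<notin> set w" "\<And>u. u \<in> compositions n \<Longrightarrow> \<xi> u = 0"
  then have "degen_operator t d \<delta> \<phi> n \<xi> w = degen_operator t d \<delta> \<phi> n (\<lambda>u. 0 * \<xi> u) w"
    by (intro degen_operator_cong) auto
  then show ?thesis using degen_operator_scale[of t d \<delta> \<phi> n 0 \<xi> w] by (simp only: mult_zero_left)
qed

context bpz begin

text \<open>\<open>degen_operator\<close> has the commutators with the lowering operators built in;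
  those with the creation operators have to be proved. The null vector enters through the empty
  word, where the claim is \<open>degen_functional_creation\<close>; longer words need only the
  Virasoro relations.\<close>

lemma degen_operator_creation:
  assumes ne: "\<And>i. 0 < i \<Longrightarrow> of_nat i \<noteq> \<delta>" and "0 \<notin> set w" "j > 0"
  shows "degen_operator t d \<delta> \<phi> (n + j) (creation c h j \<xi>) w = creation c (h - d) j (degen_operator t d \<delta> \<phi> n \<xi>) w
    + (of_nat n + d - of_nat (sum_list w) + of_nat j * \<phi>) * degen_operator t d \<delta> \<phi> n \<xi> w"
  using assms(2,3)
proof (induction w arbitrary: n j \<xi>)
  case Nil
  then show ?case using degen_functional_creation ne by simp
next
  case (Cons k w)
  let ?P = "degen_operator t d \<delta> \<phi>"
  define s where "s = (of_nat (sum_list w) :: complex)"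
  define C where "C = c / 12 * (of_nat j ^ 3 - of_nat j :: complex)"
  have k: "k > 0" and w: "0 \<notin> set w" using Cons.prems by auto
  define T1 where "T1 = (if k < j then of_nat (k + j) * creation c (h - d) (j - k) (?P n \<xi>) w
      else if k = j then (2 * of_nat j * (h - d + s) + C) * ?P n \<xi> w
      else of_nat (k + j) * ?P n \<xi> ((k - j) # w))"
  define X where "X = (if k \<le> n then creation c (h - d) j (?P (n - k) (shift k \<xi>)) w else 0)"
  define Z where "Z = (if k \<le> n then ?P (n - k) (shift k \<xi>) w else 0)"
  have R: "creation c (h - d) j (?P n \<xi>) (k # w)
     = X + (s - of_nat j - of_nat n - d + of_nat k * \<phi>) * creation c (h - d) j (?P n \<xi>) w + T1"
  proof -
    have "creation c (h - d) j (shift k (?P n \<xi>)) w = X + (s - of_nat j - of_nat n - d + of_nat k * \<phi>) * creation c (h - d) j (?P n \<xi>) w"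
    proof -
      define r where "r = - of_nat n - d + of_nat k * \<phi>"
      have "shift k (?P n \<xi>) = (\<lambda>u. (if k \<le> n then 1 else 0) * ?P (n - k) (shift k \<xi>) u
          + 1 * ((r + of_nat (sum_list u)) * ?P n \<xi> u))"
        by (rule ext) (simp add: r_def algebra_simps)
      then show ?thesis
        by (simp only: creation_linear creation_weight) (simp add: X_def s_def r_def algebra_simps)
    qed
    then show ?thesis by (simp add: T1_def s_def C_def)
  qed
  have L1: "(if k \<le> n + j then ?P (n + j - k) (creation c h j (shift k \<xi>)) w else 0)
     = X + (of_nat n - of_nat k + d - s + of_nat j * \<phi>) * Z"
  proof (cases "k \<le> n")
    case True
    then have "?P ((n - k) + j) (creation c h j (shift k \<xi>)) w
      = creation c (h - d) j (?P (n - k) (shift k \<xi>)) w + (of_nat (n - k) + d - s + of_nat j * \<phi>) * ?P (n - k) (shift k \<xi>) w"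
      unfolding s_def using Cons.prems by (intro Cons.IH) auto
    then show ?thesis using True by (simp add: X_def Z_def of_nat_diff)
  next
    case False
    have "?P (n + j - k) (creation c h j (shift k \<xi>)) w = 0"  if "k \<le> n + j"
      by (rule degen_operator_zero[OF w], rule creation_trunc) (use False that in auto)
    then show ?thesis using False by (simp add: X_def Z_def)
  qed
  define T2 where "T2 = (if k < j then of_nat (k + j) * ?P (n + (j - k)) (creation c h (j - k) \<xi>) w
      else if k = j then (2 * of_nat j * (h + of_nat n) + C) * ?P n \<xi> w
      else if k \<le> n + j then of_nat (k + j) * ?P (n + j - k) (shift (k - j) \<xi>) w else 0)"
  \<comment> \<open>\<open>T1\<close> and \<open>T2\<close> are the bracket terms of L(k) and L(-j)
    taken after and before the field. They differ by what the commutation of the field with L(k - j)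
    prescribes.\<close>
  have T12: "T2 = T1 + (of_nat k + of_nat j) * (of_nat n + d - s + (of_nat j - of_nat k) * \<phi>) * ?P n \<xi> w"
  proof -
    consider "k < j" | "k = j" | "k > j" by linarith
    then show ?thesis
    proof cases
      case 1
      have "?P (n + (j - k)) (creation c h (j - k) \<xi>) w
        = creation c (h - d) (j - k) (?P n \<xi>) w + (of_nat n + d - s + of_nat (j - k) * \<phi>) * ?P n \<xi> w"
        unfolding s_def using 1 w by (intro Cons.IH) auto
      then have "T2 = of_nat (k + j) * (creation c (h - d) (j - k) (?P n \<xi>) w + (of_nat n + d - s + of_nat (j - k) * \<phi>) * ?P n \<xi> w)"
        using 1 by (simp only: T2_def if_True)
      then show ?thesis using 1 by (simp add: T1_def of_nat_diff algebra_simps)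
    next
      case 2
      then show ?thesis by (simp add: T1_def T2_def algebra_simps)
    next
      case 3
      have "k - j \<le> n \<longleftrightarrow> k \<le> n + j" "k \<le> n + j \<Longrightarrow> n + j - k = n - (k - j)" using 3 by auto
      then show ?thesis using 3 by (simp add: T1_def T2_def of_nat_diff s_def algebra_simps)
    qed
  qed
  have L2: "(if k \<le> n + j then ?P (n + j - k) (shift k (creation c h j \<xi>)) w else 0)
    = (if k \<le> n + j then ?P (n + j - k) (creation c h j (shift k \<xi>)) w else 0) + T2"
  proof -
    have wt: "?P n (\<lambda>u. (2 * of_nat j * (h + of_nat (sum_list u)) + C) * \<xi> u) w = (2 * of_nat j * (h + of_nat n) + C) * ?P n \<xi> w"
      using degen_operator_weight[OF w, of t d \<delta> \<phi> n "\<lambda>i. 2 * of_nat j * (h + of_nat i) + C" \<xi>] .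
    consider "k < j" | "k = j" | "k > j" "k \<le> n + j" | "k > j" "\<not> k \<le> n + j" by linarith
    then show ?thesis
    proof cases
      case 1
      then have "n + (j - k) = n + j - k" by simp
      with 1 show ?thesis by (simp add: degen_operator_add T2_def degen_operator_scale del: of_nat_add)
    qed (simp_all add: degen_operator_add T2_def degen_operator_scale wt[unfolded C_def times_divide_eq_left] C_def del: of_nat_add)
  qed
  have IH: "?P (n + j) (creation c h j \<xi>) w = creation c (h - d) j (?P n \<xi>) w + (of_nat n + d - s + of_nat j * \<phi>) * ?P n \<xi> w"
    unfolding s_def using Cons.prems by (intro Cons.IH) auto
  have "?P (n + j) (creation c h j \<xi>) (k # w)
      = (if k \<le> n + j then ?P (n + j - k) (shift k (creation c h j \<xi>)) w else 0)
       + (s - of_nat (n + j) - d + of_nat k * \<phi>) * ?P (n + j) (creation c h j \<xi>) w"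
    by (simp only: degen_operator.simps s_def)
  also have "\<dots> = X + (of_nat n - of_nat k + d - s + of_nat j * \<phi>) * Z
      + (T1 + (of_nat k + of_nat j) * (of_nat n + d - s + (of_nat j - of_nat k) * \<phi>) * ?P n \<xi> w)
      + (s - of_nat (n + j) - d + of_nat k * \<phi>) * (creation c (h - d) j (?P n \<xi>) w + (of_nat n + d - s + of_nat j * \<phi>) * ?P n \<xi> w)"
    by (simp only: L2 L1 T12 IH)
  also have "\<dots> = creation c (h - d) j (?P n \<xi>) (k # w)
      + (of_nat n + d - (of_nat k + s) + of_nat j * \<phi>) * (Z + (s - of_nat n - d + of_nat k * \<phi>) * ?P n \<xi> w)"
    unfolding R by (simp add: algebra_simps)
  also have "Z + (s - of_nat n - d + of_nat k * \<phi>) * ?P n \<xi> w = ?P n \<xi> (k # w)"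
    by (simp add: Z_def s_def)
  finally show ?case by (simp add: s_def)
qed

end

text \<open>
  \<open>generated c h n \<xi>\<close>: on words of level \<open>n\<close>, \<open>\<xi>\<close> agrees with an element of the module generated by the
  functional dual to the empty word. This module is irreducible, so equivalently \<open>\<xi>\<close> vanishes on
  level \<open>n\<close> of the maximal submodule of the Verma module.
\<close>

inductive generated :: "complex \<Rightarrow> complex \<Rightarrow> nat \<Rightarrow> (nat list \<Rightarrow> complex) \<Rightarrow> bool" for c h where
  base: "generated c h 0 \<xi>"
| step: "generated c h n \<xi> \<Longrightarrow> k > 0 \<Longrightarrow> generated c h (n + k) (creation c h k \<xi>)"
| comb: "generated c h n \<xi> \<Longrightarrow> generated c h n \<eta> \<Longrightarrow> generated c h n (\<lambda>w. \<xi> w + a * \<eta> w)"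
| cong: "generated c h n \<xi> \<Longrightarrow> (\<And>w. w \<in> compositions n \<Longrightarrow> \<xi> w = \<eta> w) \<Longrightarrow> generated c h n \<eta>"

lemma generated_zero: "generated c h n (\<lambda>w. 0)"
proof (cases "n = 0")
  case False
  have "generated c h (0 + n) (creation c h n (\<lambda>w. 0))"
    by (rule generated.step[OF generated.base]) (use False in auto)
  then have "generated c h n (creation c h n (\<lambda>w. 0))" by simp
  then show ?thesis by (rule generated.cong) simp
qed (auto intro: generated.base)

lemma generated_add: "generated c h n \<xi> \<Longrightarrow> generated c h n \<eta> \<Longrightarrow> generated c h n (\<lambda>w. \<xi> w + \<eta> w)"
  using generated.comb[of c h n \<xi> \<eta> 1] by simp

lemma generated_scale: "generated c h n \<eta> \<Longrightarrow> generated c h n (\<lambda>w. a * \<eta> w)"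
  using generated.comb[OF generated_zero, of c h n \<eta> a] by simp

lemma generated_sum: "(\<And>i. i \<in> I \<Longrightarrow> generated c h n (\<xi> i)) \<Longrightarrow> generated c h n (\<lambda>w. \<Sum>i\<in>I. \<xi> i w)"
  by (induction I rule: infinite_finite_induct) (auto intro: generated_zero generated_add)

text \<open>
  The three-point coefficient \<open>\<langle>a| \<psi>(1) L(-k\<^sub>1) \<dots> L(-k\<^sub>r) |h\<rangle>\<close> for a field \<open>\<psi>\<close> of weight \<open>\<phi>\<close>, with \<open>d = h - a\<close>.
\<close>

fun three_point :: "complex \<Rightarrow> complex \<Rightarrow> nat list \<Rightarrow> complex" where
  "three_point d \<phi> [] = 1"
| "three_point d \<phi> (k # w) = (of_nat (sum_list w) + d + of_nat k * \<phi>) * three_point d \<phi> w"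

context bpz begin

text \<open>The BPZ equation in dual form: creation operators act on the functional, where
  \<open>degen_functional\<close> lets lowering operators act on its argument.\<close>

lemma three_point_bpz:
  assumes "0 \<notin> set w"
  shows "t * (\<Sum>k\<in>{1..sum_list w}. creation c h k (three_point d \<phi>) w)
    = of_nat (sum_list w) * (of_nat (sum_list w) - \<delta>) * three_point d \<phi> w"
  using assms
proof (induction w)
  case (Cons j w)
  define g where "g = three_point d \<phi>"
  define n where "n = sum_list w"
  have j: "j > 0" and w: "w \<in> compositions n" using Cons.prems by (auto simp: compositions_def n_def)
  define E where "E = of_nat n + d + of_nat j * \<phi>"
  define a where "a k = creation c h k g w" for k
  define A where "A = (\<Sum>k\<in>{1..n}. a k)"
  define b where "b = g w"
  define R where "R k = (if k < j then of_nat (k + j) * (of_nat n + d + of_nat (j - k) * \<phi>) * b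
      else if k = j then (2 * of_nat j * (h + of_nat n) + c / 12 * (of_nat j ^ 3 - of_nat j)) * b
      else of_nat (k + j) * a (k - j))" for k
  have 1: "creation c h k g (j # w) = (if k \<le> n then (E - of_nat k) * a k else 0) + R k" if k: "k \<in> {1..n + j}" for k
  proof -
    have "shift j g = (\<lambda>u. (d + of_nat j * \<phi> + of_nat (sum_list u)) * g u)"
      by (rule ext) (simp add: g_def algebra_simps)
    then have "creation c h k (shift j g) w = (E - of_nat k) * a k"
      by (simp only: creation_weight) (simp add: E_def a_def n_def algebra_simps)
    moreover have "a k = 0" if "\<not> k \<le> n" unfolding a_def by (rule creation_trunc[OF w]) (use that in simp)
    ultimately show ?thesis
      by (auto simp: R_def a_def b_def g_def n_def add.commute)
  qed
  have "(\<Sum>k\<in>{1..n + j}. creation c h k g (j # w))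
      = (\<Sum>k\<in>{1..n + j}. if k \<le> n then (E - of_nat k) * a k else 0) + (\<Sum>k\<in>{1..n + j}. R k)"
    unfolding sum.distrib[symmetric] by (rule sum.cong[OF refl 1])
  also have "(\<Sum>k\<in>{1..n + j}. if k \<le> n then (E - of_nat k) * a k else 0) = (\<Sum>k\<in>{1..n}. (E - of_nat k) * a k)"
    by (rule sum.mono_neutral_cong_right) auto
  also have "(\<Sum>k\<in>{1..n + j}. R k) = (\<Sum>k\<in>{1..<j}. R k) + R j + (\<Sum>k\<in>{1..n}. R (k + j))"
    by (rule sum_shift_split[OF j])
  also have "(\<Sum>k\<in>{1..<j}. R k) = (\<Sum>k\<in>{1..<j}. of_nat (k + j) * ((of_nat n + d) + of_nat (j - k) * \<phi>)) * b"
    by (simp add: R_def sum_distrib_right)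
  also have "\<dots> = (3 * of_nat j * (of_nat j - 1) / 2 * (of_nat n + d)
      + \<phi> * of_nat j * (of_nat j - 1) * (4 * of_nat j + 1) / 6) * b"
    by (simp only: sum_1_less[OF j])
  also have "(\<Sum>k\<in>{1..n}. R (k + j)) = (\<Sum>k\<in>{1..n}. of_nat (k + j + j) * a k)"
    using j by (intro sum.cong) (auto simp: R_def)
  also have "R j = (2 * of_nat j * (h + of_nat n) + c / 12 * (of_nat j ^ 3 - of_nat j)) * b"
    by (simp add: R_def)
  finally have 2: "(\<Sum>k\<in>{1..n + j}. creation c h k g (j # w))
     = (of_nat n + d + of_nat j * \<phi> + 2 * of_nat j) * A
     + (3 * of_nat j * (of_nat j - 1) / 2 * (of_nat n + d) + \<phi> * of_nat j * (of_nat j - 1) * (4 * of_nat j + 1) / 6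
       + (2 * of_nat j * (h + of_nat n) + c / 12 * (of_nat j ^ 3 - of_nat j))) * b"
    unfolding A_def E_def
    by (simp add: algebra_simps sum.distrib sum_distrib_left sum_subtractf)
  have "t * A = of_nat n * (of_nat n - \<delta>) * b"
    using Cons unfolding A_def a_def b_def g_def n_def by simp
  from bpz_algebra[OF t c \<phi> d h this, of "of_nat j"]
  have "t * (\<Sum>k\<in>{1..n + j}. creation c h k g (j # w)) = (of_nat n + of_nat j) * (of_nat n + of_nat j - \<delta>) * (E * b)"
    by (simp only: 2 E_def mult.assoc)
  then show ?case
    by (simp add: g_def n_def E_def b_def add.commute mult.assoc del: creation.simps)
qed simp

text \<open>\<open>three_point_bpz\<close> expresses level N through creation operators applied to
  lower levels, and away from resonance it can be divided by N (N - \<delta>).\<close>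

lemma generated_three_point:
  assumes ne: "\<And>i. 0 < i \<Longrightarrow> of_nat i \<noteq> \<delta>"
  shows "generated c h N (three_point d \<phi>)"
proof (induction N rule: less_induct)
  case (less N)
  show ?case
  proof (cases "N = 0")
    case False
    have "generated c h N (creation c h k (three_point d \<phi>))" if "k \<in> {1..N}" for k
      using generated.step[OF less.IH[of "N - k"], of k] that by simp
    then have "generated c h N (\<lambda>w. t / (of_nat N * (of_nat N - \<delta>)) * (\<Sum>k\<in>{1..N}. creation c h k (three_point d \<phi>) w))"
      by (intro generated_scale generated_sum)
    then show ?thesis
    proof (rule generated.cong)
      fix w assume "w \<in> compositions N"
      then have "0 \<notin> set w" "sum_list w = N" by (auto simp: compositions_def)
      moreover have "of_nat N \<noteq> \<delta>" using ne False by auto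
      ultimately show "t / (of_nat N * (of_nat N - \<delta>)) * (\<Sum>k\<in>{1..N}. creation c h k (three_point d \<phi>) w) = three_point d \<phi> w"
        using three_point_bpz[of w] False by (simp add: field_simps)
    qed
  qed (auto intro: generated.base)
qed

end

lemma degen_operator_base:
  assumes "0 \<notin> set w"
  shows "degen_operator t d \<delta> \<phi> 0 \<xi> w = \<xi> [] * three_point (- d) \<phi> w"
  using assms by (induction w) auto

context bpz begin

text \<open>The image of the empty word's dual is a multiple of the three-point functional of the
  reverse fusion, from h - d to h. The resonance of that fusion is \<delta>', hence the second set
  of inequalities. All other elements follow by moving creation operators through the field.\<close>

lemma generated_degen_operator:
  assumes ne: "\<And>i. 0 < i \<Longrightarrow> of_nat i \<noteq> \<delta>"
    and ne': "\<And>i. 0 < i \<Longrightarrow> of_nat i \<noteq> \<delta>'" and d': "\<delta>' = t / 2 + 2 * d"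
    and "generated c h n \<xi>"
  shows "generated c (h - d) N (degen_operator t d \<delta> \<phi> n \<xi>)"
proof -
  interpret dual: bpz t c "h - d" "- d" \<delta>' \<phi>
  proof
    show "2 * (- d)\<^sup>2 + t * (- d) = 2 * (h - d) * t + (3 * t - 2) * (t - 2) / 8"
      using h by (simp add: algebra_simps)
  qed (use t c \<phi> d' in auto)
  show ?thesis
    using assms(4)
  proof (induction arbitrary: N rule: generated.induct)
    case (base \<xi>)
    have "generated c (h - d) N (\<lambda>w. \<xi> [] * three_point (- d) \<phi> w)"
      using dual.generated_three_point[OF ne'] by (rule generated_scale)
    then show ?case
      by (rule generated.cong) (auto simp: degen_operator_base compositions_def)
  next
    case (step n \<xi> k)
    let ?a = "of_nat n + d - of_nat N + of_nat k * \<phi>"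
    have 1: "generated c (h - d) N (creation c (h - d) k (degen_operator t d \<delta> \<phi> n \<xi>))"
    proof (cases "k \<le> N")
      case True
      then show ?thesis using generated.step[OF step.IH[of "N - k"] \<open>k > 0\<close>] by simp
    next
      case False
      show ?thesis by (rule generated.cong[OF generated_zero]) (use False in \<open>simp add: creation_trunc\<close>)
    qed
    have "generated c (h - d) N (\<lambda>w. creation c (h - d) k (degen_operator t d \<delta> \<phi> n \<xi>) w + ?a * degen_operator t d \<delta> \<phi> n \<xi> w)"
      by (rule generated.comb[OF 1 step.IH])
    then show ?case
      by (rule generated.cong) (use \<open>k > 0\<close> in \<open>auto simp: compositions_def degen_operator_creation[OF ne]\<close>)
  next
    case (comb n \<xi> \<eta> a)
    have "generated c (h - d) N (\<lambda>w. degen_operator t d \<delta> \<phi> n \<xi> w + a * degen_operator t d \<delta> \<phi> n \<eta> w)"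
      by (rule generated.comb[OF comb.IH])
    then show ?case
      by (rule generated.cong) (use degen_operator_linear[of t d \<delta> \<phi> n 1 \<xi> a \<eta>] in simp)
  next
    case (cong n \<xi> \<eta>)
    show ?case
    proof (rule generated.cong[OF cong.IH])
      fix w assume "w \<in> compositions N"
      then show "degen_operator t d \<delta> \<phi> n \<xi> w = degen_operator t d \<delta> \<phi> n \<eta> w"
        by (intro degen_operator_cong cong.hyps) (auto simp: compositions_def)
    qed
  qed
qed

end

section \<open>Fusion with the degenerate field\<close>

text \<open>Subtracting 2^(D+1) times the value at n from the value at 2n removes the top
  coefficient and multiplies the i-th by 2^i - 2^(D+1), which is nonzero. Induction yields the lower
  coefficients, and the value at 1 then yields the top one.\<close>

lemma generated_interpolate:
  assumes "\<And>n::nat. n > 0 \<Longrightarrow> generated c h N (\<lambda>w. \<Sum>j\<le>D. a j w * of_nat n ^ j)" "j \<le> D"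
  shows "generated c h N (a j)"
  using assms
proof (induction D arbitrary: a j)
  case 0
  then show ?case using "0.prems"(1)[of 1] by simp
next
  case (Suc D)
  have ne: "(2 :: complex) ^ i \<noteq> 2 ^ Suc D" if "i \<le> D" for i
  proof
    assume "(2 :: complex) ^ i = 2 ^ Suc D"
    then have "norm ((2 :: complex) ^ i) = norm ((2 :: complex) ^ Suc D)" by simp
    then have "(2 :: real) ^ i = 2 ^ Suc D" by (simp add: norm_power norm_mult)
    then have "i = Suc D" by (subst (asm) power_inject_exp) auto
    with that show False by simp
  qed
  have low: "generated c h N (a i)" if i: "i \<le> D" for i
  proof -
    let ?b = "\<lambda>i w. (2 ^ i - 2 ^ Suc D) * a i w"
    have "generated c h N (?b i)"
    proof (rule Suc.IH[OF _ i])
      fix n :: nat assume n: "n > 0"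
      have "generated c h N (\<lambda>w. (\<Sum>j\<le>Suc D. a j w * of_nat (2 * n) ^ j) + (- (2 ^ Suc D)) * (\<Sum>j\<le>Suc D. a j w * of_nat n ^ j))"
        by (rule generated.comb) (use n in \<open>auto intro!: Suc.prems(1) simp del: of_nat_mult sum.atMost_Suc\<close>)
      then show "generated c h N (\<lambda>w. \<Sum>j\<le>D. ?b j w * of_nat n ^ j)"
        by (rule generated.cong)
          (simp add: sum_distrib_left power_mult_distrib algebra_simps flip: sum.distrib sum_subtractf)
    qed
    then have "generated c h N (\<lambda>w. 1 / (2 ^ i - 2 ^ Suc D) * ?b i w)" by (rule generated_scale)
    moreover have "(2 :: complex) ^ i - 2 ^ Suc D \<noteq> 0" using ne[OF i] by simp
    ultimately show ?thesis by simp
  qed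
  show ?case
  proof (cases "j \<le> D")
    case False
    have "generated c h N (\<lambda>w. (\<Sum>j\<le>Suc D. a j w * of_nat 1 ^ j) + (-1) * (\<Sum>j\<le>D. a j w))"
      by (rule generated.comb[OF Suc.prems(1)[of 1]]) (auto intro!: generated_sum low)
    then show ?thesis using False Suc.prems(2) by (simp add: le_Suc_eq)
  qed (rule low)
qed

text \<open>A level has only finitely many words, so the degrees are bounded and the coefficients
  can be recovered simultaneously for all words.\<close>

lemma generated_interpolate_poly:
  assumes "\<And>n::nat. n > 0 \<Longrightarrow> generated c h N (\<lambda>w. poly (P w) (of_nat n))"
  shows "generated c h N (\<lambda>w. poly (P w) x)"
proof -
  define D where "D = Max ((\<lambda>w. degree (P w)) ` compositions N \<union> {0})"
  have D: "degree (P w) \<le> D" if "w \<in> compositions N" for w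
    unfolding D_def by (rule Max_ge) (use that finite_compositions in auto)
  have eq: "poly (P w) y = (\<Sum>j\<le>D. coeff (P w) j * y ^ j)" if "w \<in> compositions N" for w y
    unfolding poly_altdef using D[OF that]
    by (intro sum.mono_neutral_left) (auto simp: coeff_eq_0 not_le)
  have "generated c h N (\<lambda>w. coeff (P w) j)" if "j \<le> D" for j
  proof (rule generated_interpolate[OF _ that])
    fix n :: nat assume "n > 0"
    from assms[OF this] show "generated c h N (\<lambda>w. \<Sum>j\<le>D. coeff (P w) j * of_nat n ^ j)"
      by (rule generated.cong) (simp add: eq)
  qed
  then have "generated c h N (\<lambda>w. \<Sum>j\<le>D. x ^ j * coeff (P w) j)"
    by (intro generated_sum generated_scale) auto
  then show ?thesis by (rule generated.cong) (simp add: eq mult.commute)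
qed

text \<open>
  The image of \<open>three_point (- e) 1\<close> under \<open>degen_operator\<close> is a combination of values at consecutive
  integers of \<open>partial_sum\<close>, which satisfies \<open>den_poly n * S (n + 1) = num_poly n * S n\<close>. Up to a
  factor, this combination is a polynomial in \<open>n\<close>, so it stays in the generated module when \<open>n\<close> is
  replaced by any complex number. At a root \<open>\<nu>\<close> of \<open>num_poly\<close> the recursion terminates (this is the
  expansion of the hypergeometric function at infinity), and one is left with \<open>three_point (- (e - \<nu>)) 1\<close>.
\<close>

context
  fixes t d \<delta> \<phi> e \<nu> \<mu> :: complex
begin

definition num_poly :: "complex \<Rightarrow> complex" where "num_poly x = (x - \<nu>) * (x - \<mu>)"
definition den_poly :: "complex \<Rightarrow> complex" where "den_poly x = x * (x - \<delta>)"

definition partial_sum :: "nat \<Rightarrow> complex" where "partial_sum n = (\<Sum>j<n. degen_functional t \<delta> j (three_point (- e) 1))"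

text \<open>For a field of weight 1, removing any letter k from a word of level n multiplies the
  three-point functional by the same factor n - e. The sum in the recursion therefore collapses to a
  partial sum, and the partial sums, rather than the single values, obey a two-term
  recursion.\<close>

lemma degen_functional_three_point_rec:
  assumes "of_nat n \<noteq> \<delta> \<or> n = 0"
  shows "den_poly (of_nat n) * degen_functional t \<delta> n (three_point (- e) 1) = t * (of_nat n - e) * partial_sum n"
proof -
  have "degen_functional t \<delta> (n - k) (shift k (three_point (- e) 1)) = (of_nat n - e) * degen_functional t \<delta> (n - k) (three_point (- e) 1)"
    if "k \<in> {1..n}" for k
    using degen_functional_weight[of t \<delta> "n - k" "\<lambda>i. of_nat i - e + of_nat k" "three_point (- e) 1"] that
    by (simp add: of_nat_diff)
  then have "den_poly (of_nat n) * degen_functional t \<delta> n (three_point (- e) 1)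
     = t * (\<Sum>k\<in>{1..n}. (of_nat n - e) * degen_functional t \<delta> (n - k) (three_point (- e) 1))"
    using degen_functional_rec[OF assms, of t "three_point (- e) 1"] by (simp add: den_poly_def)
  also have "(\<Sum>k\<in>{1..n}. degen_functional t \<delta> (n - k) (three_point (- e) 1)) = partial_sum n"
    unfolding partial_sum_def by (rule sum.reindex_bij_witness[of _ "\<lambda>j. n - j" "\<lambda>k. n - k"]) auto
  then have "(\<Sum>k\<in>{1..n}. (of_nat n - e) * degen_functional t \<delta> (n - k) (three_point (- e) 1)) = (of_nat n - e) * partial_sum n"
    by (simp only: sum_distrib_left[symmetric])
  finally show ?thesis by simp
qed

lemma partial_sum_rec:
  assumes "of_nat n \<noteq> \<delta> \<or> n = 0" "\<nu> + \<mu> = \<delta> - t" "\<nu> * \<mu> = - (t * e)"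
  shows "den_poly (of_nat n) * partial_sum (Suc n) = num_poly (of_nat n) * partial_sum n"
proof -
  have "den_poly (of_nat n) * partial_sum (Suc n) = (den_poly (of_nat n) + t * (of_nat n - e)) * partial_sum n"
    using degen_functional_three_point_rec[OF assms(1)] by (simp add: partial_sum_def algebra_simps)
  moreover have "den_poly x + t * (x - e) = num_poly x" for x
  proof -
    have "num_poly x = x * x - (\<nu> + \<mu>) * x + \<nu> * \<mu>" by (simp add: num_poly_def algebra_simps)
    also have "\<dots> = den_poly x + t * (x - e)"
      unfolding assms(2,3) by (simp add: den_poly_def algebra_simps)
    finally show ?thesis ..
  qed
  ultimately show ?thesis by simp
qed

lemma partial_sum_nonzero:
  assumes "\<And>i. 0 < i \<Longrightarrow> i < n \<Longrightarrow> of_nat i \<noteq> \<delta> \<and> of_nat i \<noteq> \<nu> \<and> of_nat i \<noteq> \<mu>"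
    "\<nu> + \<mu> = \<delta> - t" "\<nu> * \<mu> = - (t * e)" "n > 0"
  shows "partial_sum n \<noteq> 0"
  using assms(1,4)
proof (induction n)
  case (Suc n)
  show ?case
  proof (cases "n = 0")
    case True
    then show ?thesis by (simp add: partial_sum_def)
  next
    case False
    then have "num_poly (of_nat n) * partial_sum n \<noteq> 0" using Suc by (simp add: num_poly_def)
    moreover have "den_poly (of_nat n) * partial_sum (Suc n) = num_poly (of_nat n) * partial_sum n"
      using Suc.prems(1)[of n] False assms by (intro partial_sum_rec) auto
    ultimately show ?thesis by auto
  qed
qed simp

text \<open>
  The solution of the recursion at the points \<open>x, \<dots>, x + M + 1\<close>, with denominators cleared so that it is
  a polynomial in \<open>x\<close>.
\<close>

definition sol_grid :: "nat \<Rightarrow> complex \<Rightarrow> nat \<Rightarrow> complex" where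
  "sol_grid M x j = (\<Prod>l<j. num_poly (x + of_nat l)) * (\<Prod>l\<in>{j..M}. den_poly (x + of_nat l))"

text \<open>This is \<open>degen_operator\<close> on level x + i with x an indeterminate. On the
  empty word it is a difference of neighbouring partial sums, that is, a single value of
  \<open>degen_functional\<close>.\<close>

fun interpolant :: "nat \<Rightarrow> complex \<Rightarrow> nat list \<Rightarrow> nat \<Rightarrow> complex" where
  "interpolant M x [] i = sol_grid M x (Suc i) - sol_grid M x i"
| "interpolant M x (k # w) i = (if k \<le> i then (x + of_nat i - e) * interpolant M x w (i - k) else 0)
     + (of_nat (sum_list w) - (x + of_nat i) - d + of_nat k * \<phi>) * interpolant M x w i"

lemma sol_grid_rec:
  assumes "j \<le> M" shows "den_poly (x + of_nat j) * sol_grid M x (Suc j) = num_poly (x + of_nat j) * sol_grid M x j"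
proof -
  have "{j..M} = insert j {Suc j..M}" using assms by auto
  then have "(\<Prod>l\<in>{j..M}. den_poly (x + of_nat l)) = den_poly (x + of_nat j) * (\<Prod>l\<in>{Suc j..M}. den_poly (x + of_nat l))"
    by simp
  then show ?thesis by (simp add: sol_grid_def)
qed

lemma sol_grid_poly: "\<exists>p. \<forall>x. sol_grid M x j = poly p x"
proof -
  have "sol_grid M x j = poly ((\<Prod>l<j. [:of_nat l - \<nu>, 1:] * [:of_nat l - \<mu>, 1:])
     * (\<Prod>l\<in>{j..M}. [:of_nat l, 1:] * [:of_nat l - \<delta>, 1:])) x" for x
    by (simp add: sol_grid_def num_poly_def den_poly_def poly_prod algebra_simps)
  then show ?thesis by blast
qed

lemma interpolant_poly: "\<exists>p. \<forall>x. interpolant M x w i = poly p x"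
proof (induction w arbitrary: i)
  case Nil
  obtain p q where "\<forall>x. sol_grid M x (Suc i) = poly p x" "\<forall>x. sol_grid M x i = poly q x" using sol_grid_poly by meson
  then have "\<forall>x. interpolant M x [] i = poly (p - q) x" by simp
  then show ?case by blast
next
  case (Cons k w)
  obtain p q where p: "\<forall>x. interpolant M x w (i - k) = poly p x" and q: "\<forall>x. interpolant M x w i = poly q x"
    using Cons.IH by meson
  have "\<forall>x. interpolant M x (k # w) i = poly ((if k \<le> i then [:of_nat i - e, 1:] * p else 0)
     + [:of_nat (sum_list w) - of_nat i - d + of_nat k * \<phi>, -1:] * q) x"
    by (simp add: p q algebra_simps)
  then show ?case by blast
qed

text \<open>\<open>sol_grid\<close> and the partial sums from n onwards solve the same two-term
  recursion, so they are proportional. The statement is cross-multiplied by their initial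
  values.\<close>

lemma interpolant_degen_operator:
  assumes ne: "\<And>i. 0 < i \<Longrightarrow> of_nat i \<noteq> \<delta>" and "\<nu> + \<mu> = \<delta> - t" "\<nu> * \<mu> = - (t * e)" and n: "n > 0"
    and "0 \<notin> set w" "sum_list w \<le> i" "i \<le> M"
  shows "interpolant M (of_nat n) w i * partial_sum n = sol_grid M (of_nat n) 0 * degen_operator t d \<delta> \<phi> (n + i) (three_point (- e) 1) w"
  using assms(5-7)
proof (induction w arbitrary: i)
  case Nil
  have gS: "sol_grid M (of_nat n) j * partial_sum n = sol_grid M (of_nat n) 0 * partial_sum (n + j)" if "j \<le> Suc M" for j
    using that
  proof (induction j)
    case (Suc j)
    have den_poly: "den_poly (of_nat (n + j)) \<noteq> 0" using n ne[of "n + j"] by (auto simp: den_poly_def simp del: of_nat_add)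
    have "den_poly (of_nat (n + j)) * (sol_grid M (of_nat n) (Suc j) * partial_sum n) = num_poly (of_nat (n + j)) * (sol_grid M (of_nat n) j * partial_sum n)"
      using sol_grid_rec[of j M "of_nat n"] Suc.prems by simp
    also have "\<dots> = sol_grid M (of_nat n) 0 * (num_poly (of_nat (n + j)) * partial_sum (n + j))"
      using Suc by simp
    also have "num_poly (of_nat (n + j)) * partial_sum (n + j) = den_poly (of_nat (n + j)) * partial_sum (Suc (n + j))"
      using assms ne[of "n + j"] by (subst partial_sum_rec) auto
    finally show ?case using den_poly by simp
  qed simp
  have "interpolant M (of_nat n) [] i * partial_sum n = sol_grid M (of_nat n) 0 * (partial_sum (Suc (n + i)) - partial_sum (n + i))"
    using gS[of i] gS[of "Suc i"] Nil.prems by (simp add: algebra_simps)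
  then show ?case by (simp add: partial_sum_def)
next
  case (Cons k w)
  let ?\<rho> = "three_point (- e) 1"
  have k: "k \<le> i" and w: "0 \<notin> set w" using Cons.prems by auto
  have "degen_operator t d \<delta> \<phi> (n + i - k) (shift k ?\<rho>) w = (of_nat (n + i) - e) * degen_operator t d \<delta> \<phi> (n + i - k) ?\<rho> w"
    using degen_operator_weight[OF w, of t d \<delta> \<phi> "n + i - k" "\<lambda>j. of_nat j - e + of_nat k" ?\<rho>] k by (simp add: of_nat_diff)
  moreover have nk: "n + i - k = n + (i - k)" "(k \<le> n + i) = True" using k by auto
  ultimately have "degen_operator t d \<delta> \<phi> (n + i) ?\<rho> (k # w) = (of_nat n + of_nat i - e) * degen_operator t d \<delta> \<phi> (n + (i - k)) ?\<rho> w
     + (of_nat (sum_list w) - (of_nat n + of_nat i) - d + of_nat k * \<phi>) * degen_operator t d \<delta> \<phi> (n + i) ?\<rho> w"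
    by (simp only: degen_operator.simps nk if_True of_nat_add)
  moreover have "interpolant M (of_nat n) w (i - k) * partial_sum n = sol_grid M (of_nat n) 0 * degen_operator t d \<delta> \<phi> (n + (i - k)) ?\<rho> w"
    "interpolant M (of_nat n) w i * partial_sum n = sol_grid M (of_nat n) 0 * degen_operator t d \<delta> \<phi> (n + i) ?\<rho> w"
    by (rule Cons.IH; use Cons.prems in auto)+
  moreover have "(a * x + b * y) * s = a * (x * s) + b * (y * s)" for a b x y s :: complex
    by (simp add: algebra_simps)
  ultimately show ?case using k by (simp only: interpolant.simps if_True) (simp only: algebra_simps)
qed

text \<open>At x = \<nu> every \<open>sol_grid\<close> entry beyond the first contains the factor
  \<open>num_poly\<close> of \<nu>, which is 0. Only the difference at i = 0 survives, with a minus
  sign, and it is reached only if every letter of the word lowers the level; each letter then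
  contributes a factor of the new three-point functional.\<close>

lemma interpolant_top:
  assumes "0 \<notin> set w" "sum_list w \<le> i"
  shows "interpolant M \<nu> w i = (if i = sum_list w then - sol_grid M \<nu> 0 * three_point (- (e - \<nu>)) 1 w else 0)"
  using assms
proof (induction w arbitrary: i)
  case Nil
  have "sol_grid M \<nu> (Suc j) = 0" for j
  proof -
    have "(\<Prod>l<Suc j. num_poly (\<nu> + of_nat l)) = 0" by (rule prod_zero) (auto simp: num_poly_def intro!: bexI[of _ 0])
    then show ?thesis by (simp add: sol_grid_def)
  qed
  then show ?case by (cases i) auto
next
  case (Cons k w)
  have k: "0 < k" "k \<le> i" "sum_list w < i" using Cons.prems by auto
  then have "interpolant M \<nu> (k # w) i = (\<nu> + of_nat i - e) * interpolant M \<nu> w (i - k)"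
    using Cons.IH[of i] Cons.prems by simp
  also have "interpolant M \<nu> w (i - k) = (if i - k = sum_list w then - sol_grid M \<nu> 0 * three_point (- (e - \<nu>)) 1 w else 0)"
    using Cons.prems by (intro Cons.IH) auto
  finally have *: "interpolant M \<nu> (k # w) i
     = (\<nu> + of_nat i - e) * (if i - k = sum_list w then - sol_grid M \<nu> 0 * three_point (- (e - \<nu>)) 1 w else 0)" .
  show ?case
  proof (cases "i = k + sum_list w")
    case True
    then show ?thesis unfolding * by (simp add: algebra_simps)
  next
    case False
    then have "i - k \<noteq> sum_list w" using k by auto
    then show ?thesis unfolding * using False by simp
  qed
qed

end

context bpz begin

text \<open>The conditions on \<delta> and t / 2 + 2 d let the field preserve the generated module,
  those on \<nu> and \<mu> keep the partial sums away from 0, and the condition on \<nu> + i keeps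
  the cleared denominators nonzero after n has been replaced by \<nu>.\<close>

lemma generated_transfer:
  assumes generated: "\<And>n. generated c h n (three_point (- e) 1)"
    and ne: "\<And>i. 0 < i \<Longrightarrow> of_nat i \<noteq> \<delta> \<and> of_nat i \<noteq> t / 2 + 2 * d \<and> of_nat i \<noteq> \<nu> \<and> of_nat i \<noteq> \<mu>"
    and \<nu>: "\<And>i. \<nu> + of_nat i \<noteq> 0 \<and> \<nu> + of_nat i \<noteq> \<delta>"
    and roots: "\<nu> + \<mu> = \<delta> - t" "\<nu> * \<mu> = - (t * e)"
  shows "generated c (h - d) N (three_point (- (e - \<nu>)) 1)"
proof -
  let ?interpolant = "interpolant d \<delta> \<phi> e \<nu> \<mu> N"
  have "\<forall>w. \<exists>p. \<forall>x. ?interpolant x w N = poly p x" using interpolant_poly by blast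
  then obtain P where P: "\<And>w x. ?interpolant x w N = poly (P w) x" by metis
  have "generated c (h - d) N (\<lambda>w. poly (P w) \<nu>)"
  proof (rule generated_interpolate_poly)
    fix n :: nat assume n: "n > 0"
    let ?S = "partial_sum t \<delta> e n" and ?g = "sol_grid \<delta> \<nu> \<mu> N (of_nat n) 0"
    have S: "?S \<noteq> 0"
      using ne n by (intro partial_sum_nonzero[of n \<delta> \<nu> \<mu>, OF _ roots]) auto
    have "generated c (h - d) N (degen_operator t d \<delta> \<phi> (n + N) (three_point (- e) 1))"
      using ne by (intro generated_degen_operator[OF _ _ refl generated]) auto
    then have "generated c (h - d) N (\<lambda>w. (?g / ?S) * degen_operator t d \<delta> \<phi> (n + N) (three_point (- e) 1) w)"
      by (rule generated_scale)
    then show "generated c (h - d) N (\<lambda>w. poly (P w) (of_nat n))"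
    proof (rule generated.cong)
      fix w assume "w \<in> compositions N"
      then have "?interpolant (of_nat n) w N * ?S = ?g * degen_operator t d \<delta> \<phi> (n + N) (three_point (- e) 1) w"
        using ne n by (intro interpolant_degen_operator roots) (auto simp: compositions_def)
      then show "(?g / ?S) * degen_operator t d \<delta> \<phi> (n + N) (three_point (- e) 1) w = poly (P w) (of_nat n)"
        unfolding P[symmetric] using S by (simp add: field_simps)
    qed
  qed
  moreover have g: "sol_grid \<delta> \<nu> \<mu> N \<nu> 0 \<noteq> 0"
    using \<nu> by (auto simp: sol_grid_def den_poly_def)
  ultimately have "generated c (h - d) N (\<lambda>w. (- 1 / sol_grid \<delta> \<nu> \<mu> N \<nu> 0) * poly (P w) \<nu>)"
    by (intro generated_scale)
  then show ?thesis
    by (rule generated.cong) (use g in \<open>auto simp: P[symmetric] interpolant_top compositions_def\<close>)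
qed

text \<open>At n = \<delta> the left side of the recursion loses its unknown, and its right side
  becomes an obstruction. On the image of a creation operator,
  \<open>sum_degen_functional_creation\<close> gives the obstruction with the factor n - \<delta> =
  0.\<close>

lemma generated_sum_degen_functional_shift:
  assumes "generated c h n \<xi>" "of_nat n = \<delta>" "n > 0" "\<And>i. 0 < i \<Longrightarrow> i < n \<Longrightarrow> of_nat i \<noteq> \<delta>"
  shows "(\<Sum>k\<in>{1..n}. degen_functional t \<delta> (n - k) (shift k \<xi>)) = 0"
  using assms
proof (induction rule: generated.induct)
  case (step n \<xi> k)
  have "t * (\<Sum>i\<in>{1..n + k}. degen_functional t \<delta> (n + k - i) (shift i (creation c h k \<xi>))) = 0"
  proof (subst sum_degen_functional_creation[OF step.hyps(2)])
    show "of_nat n \<noteq> \<delta> \<or> n = 0" using step.prems(3)[of n] step.hyps by auto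
    show "degen_functional t \<delta> (n' + k') (creation c h k' \<xi>) = (of_nat n' + d + of_nat k' * \<phi>) * degen_functional t \<delta> n' \<xi>"
      if "n' + k' < n + k" "k' > 0" for k' n' \<xi>
      using that step.prems by (intro degen_functional_creation) auto
  qed (use step.prems in auto)
  then show ?case using t by simp
next
  case (comb n \<xi> \<eta> a)
  then show ?case
    using degen_functional_linear[of t \<delta> _ 1 _ a] by (simp add: sum.distrib flip: sum_distrib_left)
next
  case (cong n \<xi> \<eta>)
  have "(\<Sum>k\<in>{1..n}. degen_functional t \<delta> (n - k) (shift k \<eta>)) = (\<Sum>k\<in>{1..n}. degen_functional t \<delta> (n - k) (shift k \<xi>))"
    by (intro sum.cong degen_functional_cong refl) (use cong.hyps(2) in \<open>auto simp: Cons_compositions\<close>)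
  then show ?case using cong by simp
qed simp

text \<open>For \<open>three_point (- e) 1\<close> the obstruction equals n - e times a nonzero
  partial sum. That sum runs over levels below n, so the junk value of
  \<open>degen_functional\<close> at n = \<delta> does not occur in it.\<close>

lemma generated_resonance:
  assumes generated: "generated c h n (three_point (- e) 1)" and n: "of_nat n = \<delta>" "n > 0"
    and ne: "\<And>i. 0 < i \<Longrightarrow> i < n \<Longrightarrow> of_nat i \<noteq> \<nu> \<and> of_nat i \<noteq> \<mu>"
    and roots: "\<nu> + \<mu> = \<delta> - t" "\<nu> * \<mu> = - (t * e)"
  shows "of_nat n = e"
proof (rule ccontr)
  assume e: "of_nat n \<noteq> e"
  have ne': "of_nat i \<noteq> \<delta>" if "0 < i" "i < n" for i using n that by auto
  have "degen_functional t \<delta> (n - k) (shift k (three_point (- e) 1)) = (of_nat n - e) * degen_functional t \<delta> (n - k) (three_point (- e) 1)"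
    if "k \<in> {1..n}" for k
    using degen_functional_weight[of t \<delta> "n - k" "\<lambda>i. of_nat i - e + of_nat k" "three_point (- e) 1"] that
    by (simp add: of_nat_diff)
  then have "(\<Sum>k\<in>{1..n}. (of_nat n - e) * degen_functional t \<delta> (n - k) (three_point (- e) 1)) = 0"
    using generated_sum_degen_functional_shift[OF generated n ne'] by simp
  then have "(\<Sum>k\<in>{1..n}. degen_functional t \<delta> (n - k) (three_point (- e) 1)) = 0"
    using e by (simp only: sum_distrib_left[symmetric]) simp
  also have "(\<Sum>k\<in>{1..n}. degen_functional t \<delta> (n - k) (three_point (- e) 1)) = partial_sum t \<delta> e n"
    unfolding partial_sum_def by (rule sum.reindex_bij_witness[of _ "\<lambda>j. n - j" "\<lambda>k. n - k"]) auto
  finally show False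
    using partial_sum_nonzero[of n \<delta> \<nu> \<mu>, OF _ roots n(2)] ne ne' by auto
qed

end

section \<open>Fusion along the weights h_m of the Kac table\<close>

definition kac_weight :: "complex \<Rightarrow> nat \<Rightarrow> complex" where
  "kac_weight t m = (of_nat m - 1) * ((of_nat m + 1) * t - 2) / 4"

text \<open>For h = h_m, the quadratic condition on d in the locale has the roots h_m - h_(m+1) and
  h_m - h_(m-1); the first is taken.\<close>

lemma bpz_kac:
  assumes "t \<noteq> 0"
  shows "bpz t (13 - 6 * t - 6 / t) (kac_weight t m) (kac_weight t m - kac_weight t (Suc m))
    ((of_nat m + 1) * t - 1) ((3 * t - 2) / 4)"
  using assms by unfold_locales (auto simp: kac_weight_def field_simps power2_eq_square)

lemma not_all_generated_three_point:
  fixes p q :: nat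
  assumes "coprime p q" "p \<ge> 2" "q \<ge> 2"
  defines "t \<equiv> of_nat p / of_nat q"
  shows "\<exists>n. \<not> generated (13 - 6 * t - 6 / t) 0 n (three_point (- 1) 1)"
proof (rule ccontr)
  define c where "c = 13 - 6 * t - 6 / t"
  assume "\<nexists>n. \<not> generated (13 - 6 * t - 6 / t) 0 n (three_point (- 1) 1)"
  then have start: "generated c 0 n (three_point (- 1) 1)" for n by (simp add: c_def)
  have t0: "t \<noteq> 0" using assms by simp
  have nonint: "of_nat j * t \<noteq> of_int z" if "0 < j" "j < q" for j z
  proof
    assume "of_nat j * t = of_int z"
    then have "(of_nat (j * p) :: complex) = of_int (z * int q)"
      using assms by (simp add: t_def field_simps)
    then have "int (j * p) = z * int q"
      by (metis of_int_eq_iff of_int_of_nat_eq)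
    then have "int q dvd int (j * p)" by simp
    then have "q dvd j * p" by (simp only: of_nat_dvd_iff)
    then have "q dvd j" using assms(1) by (simp add: coprime_commute coprime_dvd_mult_left_iff)
    then show False using that by (auto dest: dvd_imp_le)
  qed
  have nt: "t \<noteq> of_int z" for z using nonint[of 1 z] assms by simp
  have \<mu>: "of_nat i \<noteq> of_nat m * t - 1" if "m < q" for i m
  proof (cases "m = 0")
    case True
    have "of_int (int i) \<noteq> (of_int (- 1) :: complex)" by (subst of_int_eq_iff) simp
    then show ?thesis using True by simp
  next
    case False
    then show ?thesis using nonint[of m "int i + 1"] that by (auto simp: algebra_simps)
  qed
  have chain: "generated c (kac_weight t (Suc m)) n (three_point (- (1 - of_nat m * t)) 1)" if "m < q - 1" for m n
    using that
  proof (induction m arbitrary: n)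
    case 0
    then show ?case using start by (simp add: kac_weight_def)
  next
    case (Suc m)
    have mq: "Suc m < q" using Suc.prems by simp
    let ?d = "kac_weight t (Suc m) - kac_weight t (Suc (Suc m))"
    interpret bpz t c "kac_weight t (Suc m)" ?d "(of_nat (Suc m) + 1) * t - 1" "(3 * t - 2) / 4"
      unfolding c_def by (rule bpz_kac[OF t0])
    have "generated c (kac_weight t (Suc m) - ?d) n (three_point (- (1 - of_nat m * t - t)) 1)"
    \<comment> \<open>The two roots correspond to the two neighbours of the bra weight h_(m-1):
      \<nu> = t moves it to h_m, whereas \<mu> would move it to h_(m-2).\<close>
    proof (rule generated_transfer[where \<mu> = "of_nat m * t - 1"])
      show "generated c (kac_weight t (Suc m)) n (three_point (- (1 - of_nat m * t)) 1)" for n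
        using Suc by simp
      fix i :: nat
      show "t + of_nat i \<noteq> 0 \<and> t + of_nat i \<noteq> (of_nat (Suc m) + 1) * t - 1"
        using nt[of "- int i"] nonint[of "Suc m" "int i + 1", OF _ mq]
        by (auto simp: algebra_simps eq_neg_iff_add_eq_0)
      have d: "t / 2 + 2 * ?d = 1 - of_nat (Suc m) * t"
        by (simp add: kac_weight_def field_simps)
      have "of_nat i \<noteq> 1 - of_nat (Suc m) * t"
        using nonint[of "Suc m" "1 - int i", OF _ mq] by (auto simp: algebra_simps)
      moreover have "of_nat i \<noteq> (of_nat (Suc m) + 1) * t - 1"
        using \<mu>[of "Suc (Suc m)" i] Suc.prems by (simp add: algebra_simps)
      moreover have "of_nat i \<noteq> t" using nt[of "int i"] by auto
      moreover have "of_nat i \<noteq> of_nat m * t - 1" by (rule \<mu>) (use mq in simp)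
      ultimately show "of_nat i \<noteq> (of_nat (Suc m) + 1) * t - 1 \<and> of_nat i \<noteq> t / 2 + 2 * ?d
        \<and> of_nat i \<noteq> t \<and> of_nat i \<noteq> of_nat m * t - 1"
        unfolding d by blast
    qed (simp_all add: algebra_simps)
    then show ?case by (simp add: algebra_simps)
  qed
  interpret bpz t c "kac_weight t (q - 1)" "kac_weight t (q - 1) - kac_weight t (Suc (q - 1))"
    "(of_nat (q - 1) + 1) * t - 1" "(3 * t - 2) / 4"
    unfolding c_def by (rule bpz_kac[OF t0])
  have "of_nat (p - 1) = 1 - of_nat (q - 2) * t"
  proof (rule generated_resonance[where \<mu> = "of_nat (q - 2) * t - 1" and \<nu> = t])
    have "Suc (q - 2) = q - 1" using assms by simp
    then show "generated c (kac_weight t (q - 1)) (p - 1) (three_point (- (1 - of_nat (q - 2) * t)) 1)"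
      using chain[of "q - 2" "p - 1"] assms by simp
    show "of_nat (p - 1) = (of_nat (q - 1) + 1) * t - 1"
      using assms by (simp add: t_def of_nat_diff)
    show "t + (of_nat (q - 2) * t - 1) = (of_nat (q - 1) + 1) * t - 1 - t"
      using assms by (simp add: of_nat_diff algebra_simps)
    fix i :: nat
    show "of_nat i \<noteq> t \<and> of_nat i \<noteq> of_nat (q - 2) * t - 1"
      using nt[of "int i"] \<mu>[of "q - 2" i] assms by auto
  qed (use assms in \<open>simp_all add: algebra_simps\<close>)
  then have "(of_nat (2 * (p * q)) :: complex) = of_nat (2 * (p + q))"
    using assms by (simp add: t_def of_nat_diff field_simps)
  then have "p * q = p + q" by (simp only: of_nat_eq_iff) simp
  then have "(p - 1) * (q - 1) = 1"
    using assms by (simp add: diff_mult_distrib diff_mult_distrib2)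
  then have "p = 2" "q = 2" by auto
  then show False using assms(1) by simp
qed

lemma sum_fun_apply:
  fixes f :: "'i \<Rightarrow> 'a \<Rightarrow> 'b::comm_monoid_add"
  shows "(\<Sum>i\<in>A. f i) x = (\<Sum>i\<in>A. f i x)"
  by (induction A rule: infinite_finite_induct) auto

section \<open>The vacuum module of the Virasoro algebra\<close>

lemma (in vector_space) separating_functional:
  assumes "subspace U" "x \<notin> U"
  obtains f where "Vector_Spaces.linear scale ((*) :: 'a \<Rightarrow> 'a \<Rightarrow> 'a) f" "f x = 1" "\<And>u. u \<in> U \<Longrightarrow> f u = 0"
proof -
  interpret F: vector_space "(*) :: 'a \<Rightarrow> 'a \<Rightarrow> 'a" by unfold_locales (auto simp: algebra_simps)
  interpret P: vector_space_pair scale "(*) :: 'a \<Rightarrow> 'a \<Rightarrow> 'a" ..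
  obtain B where B: "B \<subseteq> U" "independent B" "U = span B"
    using basis_exists[of U] assms(1) span_subspace by metis
  have "independent (insert x B)" using B assms(2) by (subst independent_insert) auto
  then obtain f where f: "Vector_Spaces.linear scale (*) f" "\<forall>y\<in>insert x B. f y = (if y = x then 1 else 0)"
    using P.linear_independent_extend[of "insert x B" "\<lambda>y. if y = x then 1 else 0"] by blast
  interpret f: Vector_Spaces.linear scale "(*)" f by (rule f(1))
  have "f u = 0" if "u \<in> U" for u
  proof -
    have "u \<in> span B" using that B by simp
    then show ?thesis
    proof (induction rule: span_induct_alt)
      case base
      then show ?case by (rule f.zero)
    next
      case (step a b y)
      then have "b \<noteq> x" using B assms(2) by auto
      then show ?case using step f(2) by (simp add: f.add f.scale)
    qed
  qed
  then show ?thesis using f that by auto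
qed

locale virasoro =
  fixes s :: "complex \<Rightarrow> 'v::ab_group_add \<Rightarrow> 'v" and L :: "int \<Rightarrow> 'v \<Rightarrow> 'v" and c :: complex
  assumes rep: "virasoro_rep s L c"
begin

sublocale vector_space s using rep by (simp add: virasoro_rep_def)

lemma linear_L: "Vector_Spaces.linear s s (L n)"
  using rep by (simp add: virasoro_rep_def)

lemma L_add: "L n (x + y) = L n x + L n y"
  by (rule module_hom.add[OF linear_L[THEN Vector_Spaces.linear.axioms(3)]])

lemma L_scale: "L n (s a x) = s a (L n x)"
  by (rule module_hom.scale[OF linear_L[THEN Vector_Spaces.linear.axioms(3)]])

lemma L_zero: "L n 0 = 0" using L_scale[of n 0 0] by simp

lemma L_minus: "L n (- x) = - L n x" using L_scale[of n "-1" x] by (simp add: scale_minus_left)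

lemma L_diff: "L n (x - y) = L n x - L n y" using L_add[of n x "- y"] by (simp add: L_minus)

lemma L_sum: "L n (\<Sum>i\<in>I. f i) = (\<Sum>i\<in>I. L n (f i))"
  by (induction I rule: infinite_finite_induct) (auto simp: L_zero L_add)

lemmas L_linear = L_add L_scale L_zero L_minus L_diff L_sum

lemma L_commute: "L m (L n v) = L n (L m v) + s (of_int (m - n)) (L (m + n) v)
        + (if m + n = 0 then s (of_int (m ^ 3 - m) / 12 * c) v else 0)"
  using rep unfolding virasoro_rep_def by (metis add.assoc diff_eq_eq add.commute)

fun L_word :: "nat list \<Rightarrow> 'v \<Rightarrow> 'v" where
  "L_word [] v = v"
| "L_word (k # w) v = L (- int k) (L_word w v)"

end

locale virasoro_vacuum = virasoro +
  fixes vac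
  assumes hw: "virasoro_highest_weight s L c 0 vac"
begin

lemma vac: "vac \<noteq> 0" "n \<ge> 0 \<Longrightarrow> L n vac = 0"
  using hw by (cases "n = 0"; auto simp: virasoro_highest_weight_def)+

lemma generated: "module.subspace s S \<Longrightarrow> (\<And>n v. v \<in> S \<Longrightarrow> L n v \<in> S) \<Longrightarrow> vac \<in> S \<Longrightarrow> v \<in> S"
  using hw by (auto simp: virasoro_highest_weight_def virasoro_submodule_def)

lemma L0_L_word: "L 0 (L_word w vac) = s (of_nat (sum_list w)) (L_word w vac)"
  by (induction w) (auto simp: vac L_commute[of 0] L_linear scale_left_distrib add.commute)

text \<open>The words are unordered, so applying a negative mode just prepends a letter. Commutators
  are needed only to push the other modes towards the vacuum.\<close>

lemma spanning: "v \<in> span {L_word w vac | w. 0 \<notin> set w}"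
proof (rule generated)
  let ?S = "{L_word w vac | w. 0 \<notin> set w}"
  have neg: "L m v \<in> span ?S" if "m < 0" "v \<in> span ?S" for m v
    using that(2)
  proof (induction rule: span_induct_alt)
    case (step a x y)
    then obtain w where "x = L_word w vac" "0 \<notin> set w" by auto
    then have "L m x = L_word (nat (- m) # w) vac" "0 \<notin> set (nat (- m) # w)" using that(1) by auto
    then have "L m x \<in> ?S" by blast
    then show ?case using step by (auto simp: L_linear intro: span_add span_scale span_base)
  qed (simp add: L_zero span_zero)
  have gen: "L m (L_word w vac) \<in> span ?S" if "0 \<notin> set w" for w m
    using that
  proof (induction w arbitrary: m)
    case Nil
    have "vac \<in> span ?S" by (rule span_base) (auto intro!: exI[of _ "[]"])
    then show ?case using neg[of m vac] vac(2)[of m] by (cases "m < 0") (auto simp: span_zero)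
  next
    case (Cons k w)
    have 1: "L_word w vac \<in> span ?S" by (rule span_base) (use Cons.prems in auto)
    have 2: "L n (L_word w vac) \<in> span ?S" for n using Cons by simp
    have 3: "L (- int k) (L m (L_word w vac)) \<in> span ?S" using Cons.prems by (intro neg 2) auto
    show ?case
      by (simp add: L_commute[of m]) (use 1 2 3 in \<open>auto intro: span_add span_scale\<close>)
  qed
  show "L n v \<in> span ?S" if "v \<in> span ?S" for n v
    using that
  proof (induction rule: span_induct_alt)
    case (step a x y)
    then show ?case using gen by (auto simp: L_linear intro!: span_add span_scale)
  qed (simp add: L_zero span_zero)
  show "vac \<in> span ?S" by (rule span_base) (auto intro!: exI[of _ "[]"])
qed simp

text \<open>\<open>T M\<close> is the product of L(0) - i over i = 1, ..., M. For large M it kills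
  any given combination of nonempty words, whose weights are positive integers, while it multiplies
  the vacuum by a nonzero number.\<close>

lemma vac_notin: "vac \<notin> span {L_word w vac | w. 0 \<notin> set w \<and> w \<noteq> []}"
proof
  assume *: "vac \<in> span {L_word w vac | w. 0 \<notin> set w \<and> w \<noteq> []}"
  define T where "T = rec_nat (\<lambda>v. v) (\<lambda>M f v. L 0 (f v) - s (of_nat (Suc M)) (f v))"
  have T: "T 0 v = v" "T (Suc M) v = L 0 (T M v) - s (of_nat (Suc M)) (T M v)" for M v
    by (simp_all add: T_def)
  have lin: "T M (s a x + y) = s a (T M x) + T M y" for M a x y
    by (induction M) (simp_all add: T L_linear algebra_simps scale_right_distrib scale_right_diff_distrib)
  have T0: "T M 0 = 0" for M by (induction M) (simp_all add: T L_zero)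
  have eig: "T M v = s (\<Prod>i<M. (a - of_nat (Suc i))) v" if "L 0 v = s a v" for M a v
    by (induction M) (simp_all add: T L_scale that scale_left_diff_distrib[symmetric] algebra_simps)
  have "\<exists>M0. \<forall>M\<ge>M0. T M v = 0" if "v \<in> span {L_word w vac | w. 0 \<notin> set w \<and> w \<noteq> []}" for v
    using that
  proof (induction rule: span_induct_alt)
    case base
    then show ?case using T0 by blast
  next
    case (step a x y)
    then obtain M0 w where M0: "\<forall>M\<ge>M0. T M y = 0" and w: "x = L_word w vac" "0 \<notin> set w" "w \<noteq> []" by auto
    then have "sum_list w > 0" by (cases w) auto
    then obtain n where n: "sum_list w = Suc n" using gr0_conv_Suc by blast
    have "T M (s a x + y) = 0" if M: "M \<ge> max M0 (Suc n)" for M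
    proof -
      have "(\<Prod>i<M. (of_nat (sum_list w) - of_nat (Suc i)) :: complex) = 0"
        by (rule prod_zero) (use M n in \<open>auto intro!: bexI[of _ n]\<close>)
      then show ?thesis using M M0 eig[OF L0_L_word, of M w] w by (simp add: lin)
    qed
    then show ?case by blast
  qed
  from this[OF *] obtain M where "T M vac = 0" by blast
  moreover have "T M vac = s (\<Prod>i<M. (0 - of_nat (Suc i))) vac"
    by (rule eig) (simp add: vac)
  moreover have "(\<Prod>i<M. (0 - of_nat (Suc i) :: complex)) \<noteq> 0"
    by (simp del: of_nat_Suc)
  ultimately show False using vac by simp
qed

text \<open>The bra dual to the vacuum; since the words span, the conditions determine it.\<close>

definition vac_coeff :: "'a \<Rightarrow> complex" where
  "vac_coeff = (SOME f. Vector_Spaces.linear s (*) f \<and> f vac = 1 \<and>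
     (\<forall>u\<in>span {L_word w vac | w. 0 \<notin> set w \<and> w \<noteq> []}. f u = 0))"

lemma vac_coeff: "Vector_Spaces.linear s (*) vac_coeff" "vac_coeff vac = 1"
  "u \<in> span {L_word w vac | w. 0 \<notin> set w \<and> w \<noteq> []} \<Longrightarrow> vac_coeff u = 0"
proof -
  have "\<exists>f. Vector_Spaces.linear s (*) f \<and> f vac = 1 \<and>
     (\<forall>u\<in>span {L_word w vac | w. 0 \<notin> set w \<and> w \<noteq> []}. f u = 0)"
    by (rule separating_functional[OF subspace_span vac_notin]) blast
  from someI_ex[OF this] show "Vector_Spaces.linear s (*) vac_coeff" "vac_coeff vac = 1"
  "u \<in> span {L_word w vac | w. 0 \<notin> set w \<and> w \<noteq> []} \<Longrightarrow> vac_coeff u = 0"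
    unfolding vac_coeff_def by auto
qed

lemma vac_coeff_add: "vac_coeff (x + y) = vac_coeff x + vac_coeff y"
  by (rule module_hom.add[OF vac_coeff(1)[THEN Vector_Spaces.linear.axioms(3)]])

lemma vac_coeff_scale: "vac_coeff (s a x) = a * vac_coeff x"
  by (rule module_hom.scale[OF vac_coeff(1)[THEN Vector_Spaces.linear.axioms(3)]])

lemma vac_coeff_zero: "vac_coeff 0 = 0" using vac_coeff_scale[of 0 0] by simp

lemma vac_coeff_sum: "vac_coeff (\<Sum>i\<in>I. f i) = (\<Sum>i\<in>I. vac_coeff (f i))"
  by (induction I rule: infinite_finite_induct) (auto simp: vac_coeff_zero vac_coeff_add)

lemma vac_coeff_L: assumes "k \<le> 0" shows "vac_coeff (L k v) = 0"
  using spanning[of v]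
proof (induction rule: span_induct_alt)
  case (step a x y)
  then obtain w where w: "x = L_word w vac" "0 \<notin> set w" by auto
  have "vac_coeff (L k x) = 0"
  proof (cases "k = 0")
    case True
    have "of_nat (sum_list w) * vac_coeff (L_word w vac) = 0"
    proof (cases "w = []")
      case False
      then have "vac_coeff (L_word w vac) = 0" using w(2) by (intro vac_coeff(3) span_base) auto
      then show ?thesis by simp
    qed simp
    then show ?thesis using True w by (simp add: L0_L_word vac_coeff_scale)
  next
    case False
    then have "L k x = L_word (nat (- k) # w) vac" using w assms by simp
    moreover have "0 \<notin> set (nat (- k) # w)" using False assms w by auto
    ultimately show ?thesis by (intro vac_coeff(3) span_base) blast
  qed
  then show ?case using step by (simp add: L_linear vac_coeff_add vac_coeff_scale)
qed (simp add: L_zero vac_coeff_zero)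

definition vac_expectation :: "int list \<Rightarrow> complex" where "vac_expectation a = vac_coeff (foldr L a vac)"

lemma foldr_L_linear: "foldr L x (a + b) = foldr L x a + foldr L x b" "foldr L x (s k a) = s k (foldr L x a)"
  by (induction x) (simp_all add: L_linear)

lemma foldr_L_zero: "foldr L x 0 = 0"
  by (induction x) (simp_all add: L_zero)

lemma vac_expectation_swap: "vac_expectation (x @ a # b # y) = vac_expectation (x @ b # a # y) + of_int (a - b) * vac_expectation (x @ (a + b) # y)
    + (if a + b = 0 then of_int (a ^ 3 - a) / 12 * c * vac_expectation (x @ y) else 0)"
  unfolding vac_expectation_def foldr_append foldr_Cons comp_def L_commute[of a b]
  by (simp add: foldr_L_linear foldr_L_zero vac_coeff_add vac_coeff_scale vac_coeff_zero)

lemma vac_expectation_last: "k \<ge> 0 \<Longrightarrow> vac_expectation (a @ [k]) = 0"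
  by (simp add: vac_expectation_def vac foldr_L_zero vac_coeff_zero)

lemma vac_expectation_first: "k \<le> 0 \<Longrightarrow> vac_expectation (k # a) = 0"
  by (simp add: vac_expectation_def vac_coeff_L)

text \<open>
  Both sides satisfy the commutation relation \<open>vac_expectation_swap\<close> and vanish under the same boundary
  conditions; these determine them by induction on the length of the word.
\<close>

lemma vac_expectation_rev: "vac_expectation a = vac_expectation (rev (map uminus a))"
proof (induction "length a" arbitrary: a rule: less_induct)
  case less
  define F where "F b = vac_expectation b - vac_expectation (rev (map uminus b))" for b
  have small: "F b = 0" if "length b < length a" for b
    unfolding F_def right_minus_eq by (rule less[OF that])
  have swap: "F (x @ i # j # y) = F (x @ j # i # y)" if "length x + length y + 2 = length a" for x i j y
  proof -
    let ?x = "rev (map uminus x)" and ?y = "rev (map uminus y)"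
    have r: "rev (map uminus (x @ i # j # y)) = ?y @ (- j) # (- i) # ?x"
      "rev (map uminus (x @ j # i # y)) = ?y @ (- i) # (- j) # ?x"
      "rev (map uminus (x @ (i + j) # y)) = ?y @ (- j + - i) # ?x" "rev (map uminus (x @ y)) = ?y @ ?x"
      by simp_all
    have "F (x @ (i + j) # y) = 0" "F (x @ y) = 0" using that by (auto intro!: small)
    then have z: "vac_expectation (x @ (i + j) # y) = vac_expectation (?y @ (- j + - i) # ?x)" "vac_expectation (x @ y) = vac_expectation (?y @ ?x)"
      by (simp_all only: F_def r) simp_all
    have cube: "(- j) ^ 3 - - j = i ^ 3 - i" if "i + j = 0"
      using that by (simp add: add_eq_0_iff)
    show ?thesis
    proof (cases "i + j = 0")
      case True
      then have "- j + - i = 0" by simp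
      show ?thesis
        unfolding F_def r vac_expectation_swap[of x i j y] vac_expectation_swap[of ?y "- j" "- i" ?x] z
        by (simp only: cube[OF True] True \<open>- j + - i = 0\<close>) simp
    next
      case False
      then have "(i + j = 0) = False" "(- j + - i = 0) = False" by auto
      then show ?thesis
        unfolding F_def r vac_expectation_swap[of x i j y] vac_expectation_swap[of ?y "- j" "- i" ?x] z
        by (simp only: if_False) simp
    qed
  qed
  have move: "F (x @ i # y) = F (x @ y @ [i])" if "length x + length y + 1 = length a" for x i y
    using that
  proof (induction y arbitrary: x)
    case (Cons j y)
    have "F (x @ i # j # y) = F ((x @ [j]) @ i # y)" using swap[of x y i j] Cons.prems by simp
    also have "\<dots> = F ((x @ [j]) @ y @ [i])" using Cons.prems by (intro Cons.IH) simp
    finally show ?case by simp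
  qed simp
  have "F a = 0"
  proof (cases "\<exists>k\<in>set a. k \<ge> 0")
    case True
    then obtain k x y where k: "k \<ge> 0" "a = x @ k # y" by (auto dest: split_list)
    then have "F a = F ((x @ y) @ [k])" using move[of x y k] by simp
    also have "\<dots> = 0" using k vac_expectation_last[of k "x @ y"] vac_expectation_first[of "- k"] by (simp add: F_def)
    finally show ?thesis .
  next
    case False
    show ?thesis
    proof (cases a)
      case (Cons k z)
      then have "k < 0" using False by auto
      then show ?thesis using Cons vac_expectation_first[of k z] vac_expectation_last[of "- k"] by (simp add: F_def)
    qed (simp add: F_def)
  qed
  then show ?case by (simp add: F_def)
qed

section \<open>The contravariant pairing, and functionals that descend to L(c,0)\<close>

fun vac_pairing :: "'a \<Rightarrow> nat list \<Rightarrow> complex" where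
  "vac_pairing v [] = vac_coeff v"
| "vac_pairing v (m # w) = vac_pairing (L (int m) v) w"

lemma vac_pairing_add: "vac_pairing (x + y) w = vac_pairing x w + vac_pairing y w"
  by (induction w arbitrary: x y) (simp_all add: vac_coeff_add L_linear)

lemma vac_pairing_scale: "vac_pairing (s a x) w = a * vac_pairing x w"
  by (induction w arbitrary: x) (simp_all add: vac_coeff_scale L_linear)

lemma vac_pairing_zero: "vac_pairing 0 w = 0" using vac_pairing_scale[of 0 0 w] by simp

lemma vac_pairing_foldr: "vac_pairing v w = vac_coeff (foldr L (map int (rev w)) v)"
  by (induction w arbitrary: v) auto

lemma vac_pairing_L0: "vac_pairing (L 0 v) w = of_nat (sum_list w) * vac_pairing v w"
proof (induction w arbitrary: v)
  case (Cons m w)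
  have "L (int m) (L 0 v) = L 0 (L (int m) v) + s (of_nat m) (L (int m) v)"
    by (subst L_commute) auto
  then show ?case by (simp add: vac_pairing_add vac_pairing_scale Cons.IH algebra_simps)
qed (simp add: vac_coeff_L)

text \<open>This relation is what \<open>creation\<close> is modelled on: L(-k) is commuted to the
  left through the lowering operators until the bra annihilates it.\<close>

lemma vac_pairing_L: "k > 0 \<Longrightarrow> vac_pairing (L (- int k) v) w = creation c 0 k (vac_pairing v) w"
proof (induction w arbitrary: k v)
  case Nil
  then show ?case by (simp add: vac_coeff_L)
next
  case (Cons m w)
  have 1: "vac_pairing (L (- int k) (L (int m) v)) w = creation c 0 k (shift m (vac_pairing v)) w"
    using Cons by simp
  consider "m < k" | "m = k" | "m > k" by linarith
  then show ?case
  proof cases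
    case 1
    have "int m - int k = - int (k - m)" using 1 by simp
    then show ?thesis using 1 \<open>vac_pairing (L (- int k) (L (int m) v)) w = _\<close> Cons.IH[of "k - m" v]
      by (simp add: L_commute[of "int m"] vac_pairing_add vac_pairing_scale)
  next
    case 2
    then show ?thesis using \<open>vac_pairing (L (- int k) (L (int m) v)) w = _\<close>
      by (simp add: L_commute[of "int k" "- int k"] vac_pairing_add vac_pairing_scale vac_pairing_L0 field_simps)
  next
    case 3
    have "int m - int k = int (m - k)" using 3 by simp
    then show ?thesis using 3 \<open>vac_pairing (L (- int k) (L (int m) v)) w = _\<close>
      by (simp add: L_commute[of "int m"] vac_pairing_add vac_pairing_scale vac_pairing_zero)
  qed
qed

lemma generated_vac_pairing: "generated c 0 n (vac_pairing v)"
  using spanning[of v]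
proof (induction rule: span_induct_alt)
  case base
  show ?case by (rule generated.cong[OF generated_zero]) (simp add: vac_pairing_zero)
next
  case (step a x y)
  then obtain u where u: "x = L_word u vac" "0 \<notin> set u" by auto
  have "generated c 0 (sum_list u) (vac_pairing (L_word u vac))" using u(2)
  proof (induction u)
    case Nil
    then show ?case by (auto intro: generated.base)
  next
    case (Cons k u)
    then have "generated c 0 (sum_list u + k) (creation c 0 k (vac_pairing (L_word u vac)))" by (intro generated.step) auto
    moreover have "creation c 0 k (vac_pairing (L_word u vac)) = vac_pairing (L_word (k # u) vac)"
      using Cons.prems vac_pairing_L[of k] by (intro ext) auto
    ultimately show ?case by (simp add: add.commute)
  qed
  \<comment> \<open>L(0) can be evaluated on either side of the pairing, so vectors and words of
    different levels pair to zero.\<close>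
  moreover have "vac_pairing (L_word u vac) w = 0" if "w \<in> compositions n" "sum_list u \<noteq> n" for w
  proof -
    have "of_nat (sum_list u) * vac_pairing (L_word u vac) w = of_nat (sum_list w) * vac_pairing (L_word u vac) w"
      using vac_pairing_L0[of "L_word u vac" w] by (simp add: L0_L_word vac_pairing_scale)
    then show ?thesis using that by (auto simp: compositions_def)
  qed
  ultimately have "generated c 0 n (vac_pairing x)"
    by (cases "sum_list u = n") (auto simp: u intro: generated.cong[OF generated_zero])
  then have "generated c 0 n (\<lambda>w. vac_pairing y w + a * vac_pairing x w)" using step by (intro generated.comb)
  then show ?case by (rule generated.cong) (simp add: vac_pairing_add vac_pairing_scale)
qed

lemma foldr_L_word: "foldr L (u @ map (\<lambda>k. - int k) w) vac = foldr L u (L_word w vac)"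
proof -
  have "foldr L (map (\<lambda>k. - int k) w) vac = L_word w vac" by (induction w) auto
  then show ?thesis by simp
qed

text \<open>If \<rho> were not generated, a linear form would separate it from the generated
  functionals. Its coefficients define a vector \<open>v\<close> orthogonal to all pairings. Such a
  \<open>v\<close> lies in the radical of the contravariant form, hence vanishes by irreducibility.
  Thus the coefficients form a linear relation, which \<rho> respects, against the choice of the
  linear form.\<close>

lemma generated_of_functional:
  assumes irr: "virasoro_irreducible s L"
    and rel: "\<And>b. (\<Sum>w\<in>compositions n. s (b w) (L_word w vac)) = 0 \<Longrightarrow> (\<Sum>w\<in>compositions n. b w * \<rho> w) = 0"
  shows "generated c 0 n \<rho>"
proof (rule ccontr)
  assume no: "\<not> generated c 0 n \<rho>"
  let ?sf = "\<lambda>(a :: complex) (\<xi> :: nat list \<Rightarrow> complex) w. a * \<xi> w"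
  interpret f: vector_space ?sf by unfold_locales (auto simp: algebra_simps fun_eq_iff)
  \<comment> \<open>Cutting off outside level n leaves finitely many words, so that the separating
    form is given by a finite list of coefficients.\<close>
  define r where "r \<xi> = (\<lambda>w. if w \<in> compositions n then \<xi> w else 0)" for \<xi> :: "nat list \<Rightarrow> complex"
  have LLr: "generated c 0 n (r \<xi>) \<longleftrightarrow> generated c 0 n \<xi>" for \<xi>
    by (auto simp: r_def intro: generated.cong[of c 0 n \<xi>] generated.cong[of c 0 n "r \<xi>" \<xi>, unfolded r_def])
  define U where "U = {\<xi>. generated c 0 n \<xi> \<and> r \<xi> = \<xi>}"
  have "f.subspace U"
    by (auto simp: f.subspace_def U_def fun_eq_iff r_def zero_fun_def plus_fun_def generated_zero intro: generated_add generated_scale)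
  moreover have "r \<rho> \<notin> U" using no LLr by (simp add: U_def)
  ultimately obtain F where F: "Vector_Spaces.linear ?sf (*) F" "F (r \<rho>) = 1" "\<And>\<xi>. \<xi> \<in> U \<Longrightarrow> F \<xi> = 0"
    using f.separating_functional by blast
  interpret F: Vector_Spaces.linear ?sf "(*)" F by (rule F(1))
  define b where "b w = F (\<lambda>u. if u = w then 1 else 0)" for w
  have Fr: "F (r \<xi>) = (\<Sum>w\<in>compositions n. b w * \<xi> w)" for \<xi>
  proof -
    have "r \<xi> = (\<Sum>w\<in>compositions n. ?sf (\<xi> w) (\<lambda>u. if u = w then 1 else 0))"
    proof
      fix u
      show "r \<xi> u = (\<Sum>w\<in>compositions n. ?sf (\<xi> w) (\<lambda>u. if u = w then 1 else 0)) u"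
        using finite_compositions[of n] by (simp add: r_def sum_fun_apply if_distrib sum.delta cong: if_cong)
    qed
    then show ?thesis by (simp add: F.sum F.scale b_def mult.commute)
  qed
  define v where "v = (\<Sum>w\<in>compositions n. s (b w) (L_word w vac))"
  have "vac_coeff (foldr L u v) = 0" for u
  proof -
    have fs: "foldr L u (\<Sum>i\<in>I. g i) = (\<Sum>i\<in>I. foldr L u (g i))" for I :: "nat list set" and g
      by (induction I rule: infinite_finite_induct) (auto simp: foldr_L_zero foldr_L_linear)
    define x where "x = foldr L (rev (map uminus u)) vac"
    \<comment> \<open>Reversal moves \<open>u\<close> to the other side of the form: testing
      \<open>v\<close> against \<open>u\<close> becomes testing the words of \<open>v\<close>
      against the vector \<open>x\<close>.\<close>
    have "vac_coeff (foldr L u (L_word w vac)) = vac_pairing x w" for w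
    proof -
      have "vac_coeff (foldr L u (L_word w vac)) = vac_expectation (u @ map (\<lambda>k. - int k) w)" by (simp only: vac_expectation_def foldr_L_word)
      also have "\<dots> = vac_expectation (map int (rev w) @ rev (map uminus u))"
        by (subst vac_expectation_rev) (simp add: rev_map comp_def)
      finally show ?thesis by (simp add: vac_expectation_def vac_pairing_foldr x_def)
    qed
    then have "vac_coeff (foldr L u v) = (\<Sum>w\<in>compositions n. b w * vac_pairing x w)"
      by (simp add: v_def fs foldr_L_linear vac_coeff_sum vac_coeff_scale)
    also have "\<dots> = F (r (vac_pairing x))" by (rule Fr[symmetric])
    also have "\<dots> = 0" by (rule F(3)) (auto simp: U_def LLr generated_vac_pairing, simp add: r_def fun_eq_iff)
    finally show ?thesis .
  qed
  moreover define Z where "Z = {v. \<forall>u. vac_coeff (foldr L u v) = 0}"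
  ultimately have vZ: "v \<in> Z" by simp
  have "virasoro_submodule s L Z"
    unfolding virasoro_submodule_def
  proof (intro conjI allI ballI)
    show "subspace Z" by (auto simp: subspace_def Z_def foldr_L_zero foldr_L_linear vac_coeff_zero vac_coeff_add vac_coeff_scale)
    show "L m y \<in> Z" if "y \<in> Z" for m y
    proof -
      have "vac_coeff (foldr L (u @ [m]) y) = 0" for u using that unfolding Z_def by blast
      then show ?thesis by (simp add: Z_def)
    qed
  qed
  moreover have "vac \<notin> Z" using vac_coeff(2) by (auto simp: Z_def intro!: exI[of _ "[]"])
  ultimately have "Z = {0}" using irr by (auto simp: virasoro_irreducible_def)
  then have "v = 0" using vZ by simp
  then have "F (r \<rho>) = 0" using rel[of b] by (simp add: v_def Fr)
  then show False using F(2) by simp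
qed

end

lemma Sum_any_lessThan:
  assumes "\<And>i. i \<ge> N \<Longrightarrow> f i = 0" shows "Sum_any f = (\<Sum>i<N. f (i :: nat))"
  by (rule Sum_any.expand_superset) (use assms in \<open>auto simp: not_le\<close>, use assms not_le in blast)

lemma gchoose_zero_eq: "(0 :: complex) gchoose i = (if i = 0 then 1 else 0)"
  by (cases i) auto

lemma gchoose_minus2: "(- 2 :: complex) gchoose i = (-1) ^ i * of_nat (Suc i)"
proof -
  have "(- 2 :: complex) gchoose i = (-1) ^ i * (of_nat (Suc i) gchoose i)"
    using gbinomial_minus[of "2 :: complex" i] by (simp add: algebra_simps)
  also have "of_nat (Suc i) gchoose i = (of_nat (Suc i) :: complex)"
    by (subst binomial_gbinomial[symmetric]) simp
  finally show ?thesis .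
qed

lemma gchoose_one: "(1 :: complex) gchoose i = (if i \<le> 1 then 1 else 0)"
proof -
  have "(of_nat 1 :: complex) gchoose i = of_nat (1 choose i)" by (rule binomial_gbinomial[symmetric])
  then show ?thesis by (auto simp: le_Suc_eq)
qed

lemma gchoose_three: "(x + 1 :: complex) gchoose 3 = (x ^ 3 - x) / 6"
  unfolding gbinomial_prod_rev by (simp add: eval_nat_numeral field_simps)

section \<open>Weak modules\<close>

locale voa_weak_module =
  fixes sV :: "complex \<Rightarrow> 'v::ab_group_add \<Rightarrow> 'v" and Y vac \<omega> c
    and sW :: "complex \<Rightarrow> 'w::ab_group_add \<Rightarrow> 'w" and YW :: "'v \<Rightarrow> int \<Rightarrow> 'w \<Rightarrow> 'w"
  assumes voa: "vertex_operator_algebra sV Y vac \<omega> c"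
    and weak: "weak_module sV Y vac sW YW"
begin

sublocale V: virasoro sV "Lmode Y \<omega>" c
  using voa by unfold_locales (simp add: vertex_operator_algebra_def)

sublocale W: vector_space sW
  using weak by (simp add: weak_module_def)

lemma linear_arg: "Vector_Spaces.linear sW sW (YW u n)" and linear_vec: "Vector_Spaces.linear sV sW (\<lambda>u. YW u n w)"
  using weak by (auto simp: weak_module_def)

lemma Y_add: "YW u n (x + y) = YW u n x + YW u n y"
  by (rule module_hom.add[OF linear_arg[THEN Vector_Spaces.linear.axioms(3)]])

lemma Y_scale: "YW u n (sW a x) = sW a (YW u n x)"
  by (rule module_hom.scale[OF linear_arg[THEN Vector_Spaces.linear.axioms(3)]])

lemma Y_zero: "YW u n 0 = 0" using Y_scale[of u n 0 0] by simp

lemma Y_sum: "YW u n (\<Sum>i\<in>I. f i) = (\<Sum>i\<in>I. YW u n (f i))"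
  by (induction I rule: infinite_finite_induct) (auto simp: Y_zero Y_add)

lemma vec_add: "YW (u + v) n x = YW u n x + YW v n x"
  by (rule module_hom.add[OF linear_vec[THEN Vector_Spaces.linear.axioms(3)]])

lemma vec_scale: "YW (sV a u) n x = sW a (YW u n x)"
  by (rule module_hom.scale[OF linear_vec[THEN Vector_Spaces.linear.axioms(3)]])

lemma vec_zero: "YW 0 n x = 0" using vec_scale[of 0 0 n x] by simp

lemma vec_sum: "YW (\<Sum>i\<in>I. f i) n x = (\<Sum>i\<in>I. YW (f i) n x)"
  by (induction I rule: infinite_finite_induct) (auto simp: vec_zero vec_add)

lemma vac_mode: "YW vac n w = (if n = -1 then w else 0)"
  using weak by (auto simp: weak_module_def)

lemma truncation: obtains N where "\<And>n. n \<ge> N \<Longrightarrow> YW u n w = 0"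
proof -
  have "\<exists>N. \<forall>n\<ge>N. YW u n w = 0" using weak by (simp only: weak_module_def)
  then show ?thesis using that by auto
qed

lemma truncation_nat: obtains N :: nat where "\<And>n. n \<ge> int N \<Longrightarrow> YW u n w = 0"
proof -
  obtain M where M: "\<And>n. n \<ge> M \<Longrightarrow> YW u n w = 0" using truncation[of u w] by blast
  show ?thesis by (rule that[of "nat M"], rule M) linarith
qed

lemma vacuum_V: "n \<ge> 0 \<Longrightarrow> Y v n vac = 0" "Y v (- 1) vac = v"
  using voa by (auto simp: vertex_operator_algebra_def vertex_algebra_def)

lemma truncation_V: obtains N :: nat where "\<And>n. n \<ge> int N \<Longrightarrow> Y u n v = 0"
proof -
  have "\<exists>M. \<forall>n\<ge>M. Y u n v = 0"
    using voa by (simp only: vertex_operator_algebra_def vertex_algebra_def weak_module_def)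
  then obtain M where M: "\<And>n. n \<ge> M \<Longrightarrow> Y u n v = 0" by blast
  show ?thesis by (rule that[of "nat M"], rule M) linarith
qed

lemma jacobi:
  "Sum_any (\<lambda>i::nat. sW ((of_int m :: complex) gchoose i) (YW (Y u (l + int i) v) (m + n - int i) w))
   = Sum_any (\<lambda>i::nat. sW ((-1) ^ i * ((of_int l :: complex) gchoose i)) (YW u (m + l - int i) (YW v (n + int i) w)))
   - Sum_any (\<lambda>i::nat. sW ((-1) powi l * (-1) ^ i * ((of_int l :: complex) gchoose i))
        (YW v (n + l - int i) (YW u (m + int i) w)))"
  using weak by (simp only: weak_module_def jacobi_identity_def)

lemma commutator:
  assumes "\<And>i. i \<ge> int N \<Longrightarrow> Y u i v = 0"
  shows "YW u m (YW v n w) = YW v n (YW u m w)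
     + (\<Sum>i<N. sW (of_int m gchoose i) (YW (Y u (int i) v) (m + n - int i) w))"
proof -
  have "Sum_any (\<lambda>i::nat. sW ((-1) ^ i * ((of_int 0 :: complex) gchoose i)) (YW u (m + 0 - int i) (YW v (n + int i) w)))
     = (\<Sum>i<1. sW ((-1) ^ i * ((of_int 0 :: complex) gchoose i)) (YW u (m + 0 - int i) (YW v (n + int i) w)))"
    by (rule Sum_any_lessThan) (simp add: gchoose_zero_eq)
  moreover have "Sum_any (\<lambda>i::nat. sW ((-1) powi 0 * (-1) ^ i * ((of_int 0 :: complex) gchoose i)) (YW v (n + 0 - int i) (YW u (m + int i) w)))
     = (\<Sum>i<1. sW ((-1) powi 0 * (-1) ^ i * ((of_int 0 :: complex) gchoose i)) (YW v (n + 0 - int i) (YW u (m + int i) w)))"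
    by (rule Sum_any_lessThan) (simp add: gchoose_zero_eq)
  moreover have "Sum_any (\<lambda>i::nat. sW ((of_int m :: complex) gchoose i) (YW (Y u (0 + int i) v) (m + n - int i) w))
     = (\<Sum>i<N. sW ((of_int m :: complex) gchoose i) (YW (Y u (0 + int i) v) (m + n - int i) w))"
    by (rule Sum_any_lessThan) (simp add: assms vec_zero)
  ultimately show ?thesis using jacobi[of m u 0 v n w] by (simp add: algebra_simps)
qed

lemma iterate:
  assumes "\<And>i. i \<ge> N \<Longrightarrow> YW v (n + int i) w = 0" "\<And>i. i \<ge> N \<Longrightarrow> YW u (int i) w = 0"
  shows "YW (Y u l v) n w = (\<Sum>i<N. sW ((-1) ^ i * (of_int l gchoose i)) (YW u (l - int i) (YW v (n + int i) w)))
     - (\<Sum>i<N. sW ((-1) powi l * (-1) ^ i * (of_int l gchoose i)) (YW v (n + l - int i) (YW u (int i) w)))"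
proof -
  have "Sum_any (\<lambda>i::nat. sW ((of_int 0 :: complex) gchoose i) (YW (Y u (l + int i) v) (0 + n - int i) w))
     = (\<Sum>i<1. sW ((of_int 0 :: complex) gchoose i) (YW (Y u (l + int i) v) (0 + n - int i) w))"
    by (rule Sum_any_lessThan) (simp add: gchoose_zero_eq)
  moreover have "Sum_any (\<lambda>i::nat. sW ((-1) ^ i * ((of_int l :: complex) gchoose i)) (YW u (0 + l - int i) (YW v (n + int i) w)))
     = (\<Sum>i<N. sW ((-1) ^ i * (of_int l gchoose i)) (YW u (0 + l - int i) (YW v (n + int i) w)))"
    by (rule Sum_any_lessThan) (simp add: assms Y_zero)
  moreover have "Sum_any (\<lambda>i::nat. sW ((-1) powi l * (-1) ^ i * ((of_int l :: complex) gchoose i)) (YW v (n + l - int i) (YW u (0 + int i) w)))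
     = (\<Sum>i<N. sW ((-1) powi l * (-1) ^ i * (of_int l gchoose i)) (YW v (n + l - int i) (YW u (0 + int i) w)))"
    by (rule Sum_any_lessThan) (simp add: assms Y_zero)
  ultimately show ?thesis using jacobi[of 0 u l v n w] by simp
qed

abbreviation L where "L \<equiv> Lmode Y \<omega>"
abbreviation M where "M \<equiv> Lmode YW \<omega>"

lemma L_vac: "n \<ge> -1 \<Longrightarrow> L n vac = 0"
  by (simp add: Lmode_def vacuum_V)

lemma omega: "\<omega> = L (-2) vac"
  by (simp add: Lmode_def vacuum_V)

lemma L_derivative_V: "Y (L (-1) v) n w = sV (- of_int n) (Y v (n - 1) w)"
  using voa by (simp add: vertex_operator_algebra_def)

text \<open>In V one has L(-1) v = v_(-2) vac. As vac_n vanishes except for n = -1, each sum of the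
  iterate formula retains at most one term: the first when n < 0, the second when n > 0.\<close>

lemma L_derivative: "YW (L (-1) v) n w = sW (- of_int n) (YW v (n - 1) w)"
proof -
  have v: "L (-1) v = Y v (-2) vac"
    using L_derivative_V[of v "-1" vac] vacuum_V(2)[of "L (-1) v"] by simp
  obtain N0 where N0: "\<And>i. i \<ge> int N0 \<Longrightarrow> YW v i w = 0" using truncation_nat[of v w] by blast
  define N where "N = max N0 (nat \<bar>n\<bar> + 1)"
  have "YW (L (-1) v) n w = (\<Sum>i<N. sW ((-1) ^ i * (of_int (-2) gchoose i)) (YW v (-2 - int i) (YW vac (n + int i) w)))
     - (\<Sum>i<N. sW ((-1) powi (-2) * (-1) ^ i * (of_int (-2) gchoose i)) (YW vac (n + -2 - int i) (YW v (int i) w)))"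
    unfolding v by (rule iterate) (use N0 in \<open>auto simp: N_def vac_mode\<close>)
  also have "(\<Sum>i<N. sW ((-1) ^ i * (of_int (-2) gchoose i)) (YW v (-2 - int i) (YW vac (n + int i) w)))
     = (\<Sum>i<N. if i = nat (- 1 - n) \<and> n < 0 then sW (- of_int n) (YW v (n - 1) w) else 0)"
    by (rule sum.cong) (auto simp: vac_mode gchoose_minus2 Y_zero power_mult_distrib[symmetric] simp flip: mult.assoc)
  also have "\<dots> = (if n < 0 then sW (- of_int n) (YW v (n - 1) w) else 0)"
    by (cases "n < 0") (auto simp: N_def sum.delta)
  also have "(\<Sum>i<N. sW ((-1) powi (-2) * (-1) ^ i * (of_int (-2) gchoose i)) (YW vac (n + -2 - int i) (YW v (int i) w)))
     = (\<Sum>i<N. if i = nat (n - 1) \<and> n > 0 then sW (of_int n) (YW v (n - 1) w) else 0)"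
    by (rule sum.cong) (auto simp: vac_mode gchoose_minus2 power_int_def power_mult_distrib[symmetric] simp flip: mult.assoc)
  also have "\<dots> = (if n > 0 then sW (of_int n) (YW v (n - 1) w) else 0)"
    by (cases "n > 0") (auto simp: N_def sum.delta)
  finally show ?thesis by (cases n "0 :: int" rule: linorder_cases) auto
qed

lemma L_omega: "L 0 \<omega> = sV 2 \<omega>" "L 1 \<omega> = 0" "L 2 \<omega> = sV (c / 2) vac" "n \<ge> 3 \<Longrightarrow> L n \<omega> = 0"
proof -
  have "L n (L (-2) vac) = sV (of_int (n + 2)) (L (n - 2) vac) + (if n = 2 then sV (c / 2) vac else 0)" if "n \<ge> 0" for n
    using that by (simp add: V.L_commute[of n "-2"] L_vac V.L_zero)
  then have *: "L n \<omega> = sV (of_int (n + 2)) (L (n - 2) vac) + (if n = 2 then sV (c / 2) vac else 0)" if "n \<ge> 0" for n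
    using that by (simp flip: omega)
  show "L 0 \<omega> = sV 2 \<omega>" "L 1 \<omega> = 0" "L 2 \<omega> = sV (c / 2) vac"
    by (simp_all add: * L_vac flip: omega)
  show "n \<ge> 3 \<Longrightarrow> L n \<omega> = 0" by (simp add: * L_vac)
qed

text \<open>The Virasoro relations on the module come from the commutator formula for \<omega> with
  itself: \<omega>_0 \<omega> = L(-1) \<omega> and \<omega>_1 \<omega> = 2 \<omega> give the linear
  term, \<omega>_3 \<omega> = (c / 2) vac gives the central one.\<close>

sublocale W: virasoro sW M c
proof
  have "M m (M n w) = M n (M m w) + (sW (of_int (m - n)) (M (m + n) w)
        + (if m + n = 0 then sW (of_int (m ^ 3 - m) / 12 * c) w else 0))" for m n w
  proof -
    have Y: "Y \<omega> i v = L (i - 1) v" for i v by (simp add: Lmode_def)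
    have "M m (M n w) = M n (M m w)
      + (\<Sum>i<4. sW (of_int (m + 1) gchoose i) (YW (Y \<omega> (int i) \<omega>) (m + 1 + (n + 1) - int i) w))"
      unfolding Lmode_def by (rule commutator) (simp add: Y L_omega)
    also have "(\<Sum>i<4. sW (of_int (m + 1) gchoose i) (YW (Y \<omega> (int i) \<omega>) (m + 1 + (n + 1) - int i) w))
       = sW (- of_int (m + n + 2)) (YW \<omega> (m + n + 1) w) + sW (of_int (m + 1) * 2) (YW \<omega> (m + n + 1) w)
        + (if m + n = 0 then sW ((of_int (m + 1) gchoose 3) * (c / 2)) w else 0)"
      by (simp add: eval_nat_numeral lessThan_Suc Y L_omega L_derivative vec_scale vec_zero vac_mode algebra_simps)
    also have "(of_int (m + 1) gchoose 3) * (c / 2) = of_int (m ^ 3 - m) / 12 * c"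
      by (simp only: of_int_add of_int_1 gchoose_three) simp
    also have "sW (- of_int (m + n + 2)) (YW \<omega> (m + n + 1) w) + sW (of_int (m + 1) * 2) (YW \<omega> (m + n + 1) w)
      = sW (of_int (m - n)) (M (m + n) w)"
      unfolding W.scale_left_distrib[symmetric] Lmode_def
      by (rule arg_cong2[where f = sW]) (simp_all add: algebra_simps)
    finally show ?thesis .
  qed
  moreover have "x = y + z \<Longrightarrow> x - y = z" for x y z :: 'w by simp
  ultimately have "\<forall>m n w. M m (M n w) - M n (M m w) = sW (of_int (m - n)) (M (m + n) w)
        + (if m + n = 0 then sW (of_int (m ^ 3 - m) / 12 * c) w else 0)" by blast
  moreover have "Vector_Spaces.linear sW sW (M n)" for n
  proof -
    have "M n = YW \<omega> (n + 1)" by (rule ext) (simp add: Lmode_def)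
    then show ?thesis by (simp only: linear_arg)
  qed
  ultimately show "virasoro_rep sW M c"
    unfolding virasoro_rep_def using W.vector_space_axioms by blast
qed

lemma M_m1_mode: "M (-1) (YW v n w) = YW v n (M (-1) w) - sW (of_int n) (YW v (n - 1) w)"
proof -
  obtain N where N: "\<And>i. i \<ge> int N \<Longrightarrow> Y \<omega> i v = 0" using truncation_V[of \<omega> v] by blast
  have "M (-1) (YW v n w) = YW v n (M (-1) w) + (\<Sum>i<Suc N. sW (of_int 0 gchoose i) (YW (Y \<omega> (int i) v) (0 + n - int i) w))"
    using commutator[of "Suc N" \<omega> v 0 n w] N by (simp add: Lmode_def)
  also have "(\<Sum>i<Suc N. sW (of_int 0 gchoose i) (YW (Y \<omega> (int i) v) (0 + n - int i) w)) = YW (L (-1) v) n w"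
    by (subst sum.lessThan_Suc_shift) (simp add: Lmode_def)
  finally show ?thesis by (simp add: L_derivative)
qed

lemma M_0_mode: "M 0 (YW v n w) = YW v n (M 0 w) + YW (L 0 v) n w - sW (of_int (n + 1)) (YW v n w)"
proof -
  obtain N where N: "\<And>i. i \<ge> int N \<Longrightarrow> Y \<omega> i v = 0" using truncation_V[of \<omega> v] by blast
  have "M 0 (YW v n w) = YW v n (M 0 w) + (\<Sum>i<Suc (Suc N). sW (of_int 1 gchoose i) (YW (Y \<omega> (int i) v) (1 + n - int i) w))"
    using commutator[of "Suc (Suc N)" \<omega> v 1 n w] N by (simp add: Lmode_def)
  also have "(\<Sum>i<Suc (Suc N). sW (of_int 1 gchoose i) (YW (Y \<omega> (int i) v) (1 + n - int i) w))
     = YW (L (-1) v) (n + 1) w + YW (L 0 v) n w"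
    by (simp only: sum.lessThan_Suc_shift) (simp add: Lmode_def gchoose_one add.commute)
  finally show ?thesis
    by (simp only: L_derivative W.scale_minus_left) simp
qed

end

section \<open>Zero-mode derivations\<close>

lemma sum_square_triangle:
  fixes g :: "nat \<Rightarrow> nat \<Rightarrow> 'a::comm_monoid_add"
  assumes "\<And>i j. i + j \<ge> B \<Longrightarrow> g i j = 0"
  shows "(\<Sum>i<B. \<Sum>j<B. g i j) = (\<Sum>k<B. \<Sum>i\<le>k. g i (k - i))"
proof -
  have "(\<Sum>i<B. \<Sum>j<B. g i j) = (\<Sum>(i, j)\<in>{..<B} \<times> {..<B}. g i j)"
    by (rule sum.cartesian_product)
  also have "\<dots> = (\<Sum>(i, j)\<in>{(i, j). i + j < B}. g i j)"
  proof (rule sum.mono_neutral_right)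
    have "(case x of (i, j) \<Rightarrow> g i j) = 0" if "x \<notin> {(i, j). i + j < B}" for x
      using that assms by (cases x) (simp add: not_less)
    then show "\<forall>x\<in>{..<B} \<times> {..<B} - {(i, j). i + j < B}. (case x of (i, j) \<Rightarrow> g i j) = 0"
      by blast
  qed auto
  also have "\<dots> = (\<Sum>k<B. \<Sum>i\<le>k. g i (k - i))"
    by (rule sum.triangle_reindex)
  finally show ?thesis .
qed

text \<open>An s-fold application of Pascal's rule, in the form (a + 1 choose l) - (a choose l - 1)
  = (a choose l). It evaluates the coefficients that arise in
  \<open>skew_mode_derivation\<close>.\<close>

lemma gbinomial_alternating_convolution:
  fixes a :: complex
  shows "(\<Sum>r\<le>l. (-1) ^ r * of_nat (s choose r) * ((a + of_nat s - of_nat r) gchoose (l - r))) = a gchoose l"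
proof (induction s arbitrary: a l)
  case 0
  have "(\<Sum>r\<le>l. (-1) ^ r * of_nat (0 choose r) * ((a + of_nat 0 - of_nat r) gchoose (l - r)))
     = (\<Sum>r\<le>l. if r = 0 then a gchoose l else 0)"
    by (rule sum.cong) auto
  then show ?case by (simp add: sum.delta)
next
  case (Suc s)
  show ?case
  proof (cases l)
    case (Suc k)
    let ?g = "\<lambda>r. (a + of_nat s - of_nat r) gchoose (k - r)"
    have "(\<Sum>r\<le>l. (-1) ^ r * of_nat (Suc s choose r) * ((a + of_nat (Suc s) - of_nat r) gchoose (l - r)))
       = ((a + 1 + of_nat s) gchoose Suc k) + (\<Sum>r\<le>k. (-1) ^ Suc r * of_nat (Suc s choose Suc r) * ?g r)"
      unfolding Suc by (subst sum.atMost_Suc_shift) (simp add: algebra_simps)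
    also have "(\<Sum>r\<le>k. (-1) ^ Suc r * of_nat (Suc s choose Suc r) * ?g r)
       = (\<Sum>r\<le>k. (-1) ^ Suc r * of_nat (s choose Suc r) * ?g r) - (\<Sum>r\<le>k. (-1) ^ r * of_nat (s choose r) * ?g r)"
      unfolding sum_subtractf[symmetric] by (intro sum.cong refl) (simp add: algebra_simps)
    also have "(\<Sum>r\<le>k. (-1) ^ r * of_nat (s choose r) * ?g r) = a gchoose k"
      by (rule Suc.IH)
    also have "((a + 1 + of_nat s) gchoose Suc k) + ((\<Sum>r\<le>k. (-1) ^ Suc r * of_nat (s choose Suc r) * ?g r) - (a gchoose k))
       = (\<Sum>r\<le>Suc k. (-1) ^ r * of_nat (s choose r) * ((a + 1 + of_nat s - of_nat r) gchoose (Suc k - r))) - (a gchoose k)"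
      by (subst sum.atMost_Suc_shift) (simp add: algebra_simps)
    also have "\<dots> = ((a + 1) gchoose Suc k) - (a gchoose k)"
      by (simp only: Suc.IH)
    also have "\<dots> = a gchoose Suc k" by (simp add: gbinomial_Suc_Suc)
    finally show ?thesis by (simp add: Suc)
  qed simp
qed

context voa_weak_module begin

definition divpow :: "nat \<Rightarrow> 'w \<Rightarrow> 'w" where
  "divpow j x = sW (1 / fact j) ((M (-1) ^^ j) x)"

lemma divpow_0 [simp]: "divpow 0 x = x" by (simp add: divpow_def)

lemma divpow_Suc: "sW (of_nat (Suc j)) (divpow (Suc j) x) = M (-1) (divpow j x)"
proof -
  have "of_nat (Suc j) * (1 / fact (Suc j)) = (1 / fact j :: complex)"
    by (simp add: fact_Suc del: of_nat_Suc)
  then show ?thesis by (simp add: divpow_def W.L_scale del: of_nat_Suc fact_Suc)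
qed

lemma divpow_Suc': "divpow (Suc j) x = sW (1 / of_nat (Suc j)) (M (-1) (divpow j x))"
  unfolding divpow_Suc[symmetric] by (simp del: of_nat_Suc)

lemma divpow_add: "divpow j (x + y) = divpow j x + divpow j y"
  by (induction j) (simp_all add: divpow_Suc' W.L_add W.scale_right_distrib)

lemma divpow_scale: "divpow j (sW a x) = sW a (divpow j x)"
  by (induction j) (simp_all add: divpow_Suc' W.L_scale mult.commute)

lemma divpow_zero: "divpow j 0 = 0" using divpow_scale[of j 0 0] by simp

lemma divpow_diff: "divpow j (x - y) = divpow j x - divpow j y"
  using divpow_add[of j "x - y" y] by simp

lemma divpow_sum: "divpow j (\<Sum>i\<in>I. f i) = (\<Sum>i\<in>I. divpow j (f i))"
  by (induction I rule: infinite_finite_induct) (auto simp: divpow_zero divpow_add)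

lemma divpow_divpow: "divpow j (divpow k x) = sW (of_nat ((j + k) choose j)) (divpow (j + k) x)"
proof -
  have "(M (-1) ^^ j) (sW a y) = sW a ((M (-1) ^^ j) y)" for a y
    by (induction j) (simp_all add: W.L_scale)
  moreover have "1 / fact j * (1 / fact k) = of_nat ((j + k) choose j) * (1 / fact (j + k) :: complex)"
    by (simp add: binomial_fact)
  ultimately show ?thesis by (simp add: divpow_def funpow_add)
qed

text \<open>The coefficient form of Y(u,x) exp(y L(-1)) = exp(y L(-1)) Y(u, x - y).\<close>

lemma mode_divpow: "YW u n (divpow l x) = (\<Sum>i\<le>l. sW (of_int n gchoose i) (divpow (l - i) (YW u (n - int i) x)))"
proof (induction l arbitrary: n)
  case (Suc l)
  let ?F = "\<lambda>i. divpow (Suc l - i) (YW u (n - int i) x)"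
  have DM: "YW u n (M (-1) y) = M (-1) (YW u n y) + sW (of_int n) (YW u (n - 1) y)" for y
    by (simp add: M_m1_mode)
  have "sW (of_nat (Suc l)) (YW u n (divpow (Suc l) x)) = YW u n (M (-1) (divpow l x))"
    by (simp only: divpow_Suc flip: Y_scale)
  also have "\<dots> = M (-1) (\<Sum>i\<le>l. sW (of_int n gchoose i) (divpow (l - i) (YW u (n - int i) x)))
     + sW (of_int n) (\<Sum>i\<le>l. sW (of_int (n - 1) gchoose i) (divpow (l - i) (YW u (n - 1 - int i) x)))"
    by (simp only: DM Suc.IH)
  also have "M (-1) (\<Sum>i\<le>l. sW (of_int n gchoose i) (divpow (l - i) (YW u (n - int i) x)))
     = (\<Sum>i\<le>l. sW (of_nat (Suc l - i) * (of_int n gchoose i)) (?F i))"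
  proof -
    have "M (-1) (sW (of_int n gchoose i) (divpow (l - i) (YW u (n - int i) x))) = sW (of_nat (Suc l - i) * (of_int n gchoose i)) (?F i)"
      if "i \<le> l" for i
      using that by (simp add: W.L_scale Suc_diff_le mult.commute flip: divpow_Suc W.scale_scale del: of_nat_Suc)
    then show ?thesis by (simp add: W.L_sum)
  qed
  also have "\<dots> = (\<Sum>i\<le>Suc l. sW (of_nat (Suc l - i) * (of_int n gchoose i)) (?F i))"
    by simp
  also have "sW (of_int n) (\<Sum>i\<le>l. sW (of_int (n - 1) gchoose i) (divpow (l - i) (YW u (n - 1 - int i) x)))
     = (\<Sum>i\<le>l. sW (of_nat (Suc i) * (of_int n gchoose Suc i)) (?F (Suc i)))"
  proof -
    have "of_int n * ((of_int (n - 1) :: complex) gchoose i) = of_nat (Suc i) * (of_int n gchoose Suc i)" for i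
      using gbinomial_absorption[of i "of_int n :: complex"] by simp
    then show ?thesis
      unfolding W.scale_sum_right by (intro sum.cong refl) (simp add: algebra_simps)
  qed
  also have "\<dots> = (\<Sum>i\<le>Suc l. sW (of_nat i * (of_int n gchoose i)) (?F i))"
    by (subst sum.atMost_Suc_shift) simp
  also have "(\<Sum>i\<le>Suc l. sW (of_nat (Suc l - i) * (of_int n gchoose i)) (?F i)) + (\<Sum>i\<le>Suc l. sW (of_nat i * (of_int n gchoose i)) (?F i))
     = sW (of_nat (Suc l)) (\<Sum>i\<le>Suc l. sW (of_int n gchoose i) (?F i))"
  proof -
    have "sW (of_nat (Suc l - i) * a) y + sW (of_nat i * a) y = sW (of_nat (Suc l)) (sW a y)" if "i \<le> Suc l" for i a y
    proof -
      have "of_nat (Suc l - i) + of_nat i = (of_nat (Suc l) :: complex)"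
        using that by (metis le_add_diff_inverse2 of_nat_add)
      then show ?thesis by (simp only: W.scale_left_distrib[symmetric] distrib_right[symmetric] W.scale_scale)
    qed
    then show ?thesis unfolding W.scale_sum_right sum.distrib[symmetric] by (intro sum.cong refl) auto
  qed
  finally show ?case by (simp only: W.scale_cancel_left) (simp del: of_nat_Suc)
qed simp

abbreviation skew where "skew \<equiv> skew_mode YW \<omega> sW"

lemma skew_sum:
  assumes "\<And>j. j \<ge> N \<Longrightarrow> YW v (n + int j) w = 0"
  shows "skew w n v = - (\<Sum>j<N. sW ((-1) powi n * (-1) ^ j) (divpow j (YW v (n + int j) w)))"
proof -
  have sg: "(-1 :: complex) powi (- (n + int j) - 1) = - ((-1) powi n * (-1) ^ j)" for j
  proof -
    have "(-1 :: complex) powi (- (n + int j) - 1) = (-1) powi (- (n + int j + 1))"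
      by (rule arg_cong[where f = "(powi) (-1)"]) simp
    also have "\<dots> = (-1) powi (n + int j + 1)" by (rule power_int_minus_one_minus)
    also have "\<dots> = - ((-1) powi n * (-1) ^ j)" by (simp add: power_int_add)
    finally show ?thesis .
  qed
  have "skew w n v = (\<Sum>j<N. sW ((-1) powi (- (n + int j) - 1) / fact j) ((M (-1) ^^ j) (YW v (n + int j) w)))"
    unfolding skew_mode_def
  proof (rule Sum_any_lessThan)
    have "(M (-1) ^^ j) 0 = 0" for j by (induction j) (simp_all add: W.L_zero)
    then show "sW ((-1) powi (- (n + int j) - 1) / fact j) ((M (-1) ^^ j) (YW v (n + int j) w)) = 0" if "j \<ge> N" for j
      using assms[OF that] by simp
  qed
  also have "\<dots> = (\<Sum>j<N. - sW ((-1) powi n * (-1) ^ j) (divpow j (YW v (n + int j) w)))"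
    unfolding sg divpow_def by simp
  finally show ?thesis by (simp add: sum_negf)
qed

text \<open>Expanding (u_n v)_j w by the iterate formula yields two double sums. The first becomes
  u_n (w_0 v) once u_n has been commuted past the powers of L(-1); the second becomes (w_0 u)_n v by
  the alternating binomial convolution.\<close>

lemma skew_mode_derivation: "skew w 0 (Y u n v) = YW u n (skew w 0 v) + skew (skew w 0 u) n v"
proof -
  obtain Nv where Nv: "\<And>i. i \<ge> int Nv \<Longrightarrow> YW v i w = 0" using truncation_nat[of v w] by blast
  obtain Nu where Nu: "\<And>i. i \<ge> int Nu \<Longrightarrow> YW u i w = 0" using truncation_nat[of u w] by blast
  obtain Nuv where Nuv: "\<And>i. i \<ge> int Nuv \<Longrightarrow> YW (Y u n v) i w = 0" using truncation_nat[of "Y u n v" w] by blast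
  obtain N3 where N3: "\<And>i. i \<ge> int N3 \<Longrightarrow> YW v i (skew w 0 u) = 0" using truncation_nat[of v "skew w 0 u"] by blast
  have "\<exists>k. \<forall>i\<ge>int k. YW v i (YW u (int l) w) = 0" for l using truncation_nat[of v "YW u (int l) w"] by metis
  then obtain kf where kf: "\<And>l i. i \<ge> int (kf l) \<Longrightarrow> YW v i (YW u (int l) w) = 0" by metis
  \<comment> \<open>Only finitely many u_l w with l \<ge> 0 are nonzero, so a single truncation
    bound for v serves all of them.\<close>
  define K where "K = (\<Sum>l<Nu. kf l)"
  have K: "YW v i (YW u (int l) w) = 0" if "i \<ge> int K" for i l
  proof (cases "l < Nu")
    case True
    then have "kf l \<le> K" unfolding K_def by (intro member_le_sum) auto
    then show ?thesis using that by (intro kf) linarith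
  next
    case False
    then show ?thesis by (simp add: Nu Y_zero)
  qed
  define B where "B = Suc (Nv + Nu + Nuv + N3 + K + nat \<bar>n\<bar>)"
  define \<epsilon> where "\<epsilon> = ((-1) powi n :: complex)"
  define C where "C i = (of_int n gchoose i :: complex)" for i
  define T where "T l r = divpow r (YW v (n + int r - int l) (YW u (int l) w))" for l r
  have T0: "T l r = 0" if "r \<ge> B" for l r
  proof (cases "l < Nu")
    case True
    then have "n + int r - int l \<ge> int K" using that unfolding B_def by linarith
    then show ?thesis by (simp add: T_def K divpow_zero)
  qed (simp add: T_def Nu Y_zero divpow_zero)
  define g where "g i j = sW ((-1) ^ (i + j) * C i) (divpow j (YW u (n - int i) (YW v (int (i + j)) w)))" for i j
  have g0: "g i j = 0" if "i + j \<ge> B" for i j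
    unfolding g_def using that by (subst Nv) (auto simp: B_def Y_zero divpow_zero)

  have 1: "skew w 0 (Y u n v) = - (\<Sum>i<B. \<Sum>j<B. g i j) + (\<Sum>l<B. \<Sum>r<B. sW (\<epsilon> * (-1) ^ (r + l) * C l) (T l r))"
  proof -
    have it: "YW (Y u n v) (int j) w = (\<Sum>i<B. sW ((-1) ^ i * C i) (YW u (n - int i) (YW v (int (i + j)) w)))
       - (\<Sum>i<B. sW (\<epsilon> * (-1) ^ i * C i) (YW v (n + int j - int i) (YW u (int i) w)))" for j
      using iterate[of B v "int j" w u n] unfolding C_def \<epsilon>_def
      by (simp add: B_def Nv Nu add.commute)
    have "skew w 0 (Y u n v) = - (\<Sum>j<B. sW ((-1) ^ j) (divpow j (YW (Y u n v) (int j) w)))"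
      using skew_sum[of B "Y u n v" 0 w] by (simp add: Nuv B_def)
    also have "(\<Sum>j<B. sW ((-1) ^ j) (divpow j (YW (Y u n v) (int j) w)))
      = (\<Sum>j<B. (\<Sum>i<B. g i j) - (\<Sum>l<B. sW (\<epsilon> * (-1) ^ (j + l) * C l) (T l j)))"
      unfolding it by (intro sum.cong refl)
        (simp add: divpow_diff divpow_sum divpow_scale W.scale_right_diff_distrib W.scale_sum_right g_def T_def power_add mult_ac)
    also have "\<dots> = (\<Sum>j<B. \<Sum>i<B. g i j) - (\<Sum>j<B. \<Sum>l<B. sW (\<epsilon> * (-1) ^ (j + l) * C l) (T l j))"
      by (simp add: sum_subtractf)
    finally show ?thesis
      using sum.swap[of g "{..<B}" "{..<B}"] sum.swap[of "\<lambda>l j. sW (\<epsilon> * (-1) ^ (j + l) * C l) (T l j)" "{..<B}" "{..<B}"]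
      by simp
  qed
  have 2: "YW u n (skew w 0 v) = - (\<Sum>i<B. \<Sum>j<B. g i j)"
  proof -
    have "skew w 0 v = - (\<Sum>j<B. sW ((-1) ^ j) (divpow j (YW v (int j) w)))"
      using skew_sum[of B v 0 w] by (simp add: Nv B_def)
    then have "YW u n (skew w 0 v) = - (\<Sum>k<B. sW ((-1) ^ k) (YW u n (divpow k (YW v (int k) w))))"
      using Y_scale[of u n "-1"] by (simp add: Y_sum Y_scale)
    also have "(\<Sum>k<B. sW ((-1) ^ k) (YW u n (divpow k (YW v (int k) w)))) = (\<Sum>k<B. \<Sum>i\<le>k. g i (k - i))"
      unfolding mode_divpow by (simp add: W.scale_sum_right g_def C_def)
    finally show ?thesis by (simp add: sum_square_triangle[of B g, OF g0])
  qed
  have 3: "skew (skew w 0 u) n v = (\<Sum>l<B. \<Sum>r<B. sW (\<epsilon> * (-1) ^ (r + l) * C l) (T l r))"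
  proof -
    have su: "skew w 0 u = - (\<Sum>l<B. sW ((-1) ^ l) (divpow l (YW u (int l) w)))"
      using skew_sum[of B u 0 w] by (simp add: Nu B_def)
    have n3: "YW v (n + int j) (skew w 0 u) = 0" if "j \<ge> B" for j
      using that by (intro N3) (simp add: B_def)
    \<comment> \<open>The last factor extends the sum over r beyond l up to the common bound, so
      that the double sum can be rearranged along k = j + r.\<close>
    define b where "b l j r = (of_int (n + int j) gchoose (l - r)) * of_nat ((j + r) choose j) * (-1) ^ j * (if r \<le> l then 1 else 0 :: complex)" for l j r
    have vD: "divpow j (YW v (n + int j) (divpow l (YW u (int l) w))) = (\<Sum>r\<le>l. sW ((of_int (n + int j) gchoose (l - r)) * of_nat ((j + r) choose j)) (T l (j + r)))" for j l
    proof -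
      have "divpow j (YW v (n + int j) (divpow l (YW u (int l) w)))
        = (\<Sum>i\<le>l. sW ((of_int (n + int j) gchoose i) * of_nat ((j + (l - i)) choose j)) (divpow (j + (l - i)) (YW v (n + int j - int i) (YW u (int l) w))))"
        by (simp add: mode_divpow divpow_sum divpow_scale divpow_divpow)
      also have "\<dots> = (\<Sum>r\<le>l. sW ((of_int (n + int j) gchoose (l - r)) * of_nat ((j + r) choose j)) (T l (j + r)))"
        by (rule sum.reindex_bij_witness[of _ "\<lambda>r. l - r" "\<lambda>i. l - i"]) (auto simp: T_def of_nat_diff algebra_simps)
      finally show ?thesis .
    qed
    have "skew (skew w 0 u) n v = - (\<Sum>j<B. sW (\<epsilon> * (-1) ^ j) (divpow j (YW v (n + int j) (skew w 0 u))))"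
      unfolding \<epsilon>_def by (rule skew_sum) (rule n3)
    also have "\<dots> = (\<Sum>j<B. \<Sum>l<B. sW (\<epsilon> * (-1) ^ l * (-1) ^ j) (divpow j (YW v (n + int j) (divpow l (YW u (int l) w)))))"
      using Y_scale[of _ _ "-1"] divpow_scale[of _ "-1"]
      by (simp add: su Y_sum Y_scale divpow_sum divpow_scale W.scale_sum_right sum_negf mult_ac)
    also have "\<dots> = (\<Sum>l<B. \<Sum>j<B. sW (\<epsilon> * (-1) ^ l * (-1) ^ j) (divpow j (YW v (n + int j) (divpow l (YW u (int l) w)))))"
      by (rule sum.swap)
    also have "\<dots> = (\<Sum>l<B. \<Sum>j<B. \<Sum>r<B. sW (\<epsilon> * (-1) ^ l * b l j r) (T l (j + r)))"
    proof (intro sum.cong refl)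
      fix l j assume "l \<in> {..<B}"
      have "sW (\<epsilon> * (-1) ^ l * (-1) ^ j) (divpow j (YW v (n + int j) (divpow l (YW u (int l) w))))
        = (\<Sum>r\<le>l. sW (\<epsilon> * (-1) ^ l * b l j r) (T l (j + r)))"
        unfolding vD W.scale_sum_right by (intro sum.cong refl) (simp add: b_def mult_ac)
      also have "\<dots> = (\<Sum>r<B. sW (\<epsilon> * (-1) ^ l * b l j r) (T l (j + r)))"
        by (rule sum.mono_neutral_left) (use \<open>l \<in> {..<B}\<close> in \<open>auto simp: b_def\<close>)
      finally show "sW (\<epsilon> * (-1) ^ l * (-1) ^ j) (divpow j (YW v (n + int j) (divpow l (YW u (int l) w))))
        = (\<Sum>r<B. sW (\<epsilon> * (-1) ^ l * b l j r) (T l (j + r)))" .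
    qed
    also have "\<dots> = (\<Sum>l<B. \<Sum>k<B. \<Sum>j\<le>k. sW (\<epsilon> * (-1) ^ l * b l j (k - j)) (T l k))"
    proof (rule sum.cong[OF refl])
      fix l
      have "(\<Sum>j<B. \<Sum>r<B. sW (\<epsilon> * (-1) ^ l * b l j r) (T l (j + r)))
        = (\<Sum>k<B. \<Sum>j\<le>k. sW (\<epsilon> * (-1) ^ l * b l j (k - j)) (T l (j + (k - j))))"
        by (rule sum_square_triangle) (simp add: T0)
      then show "(\<Sum>j<B. \<Sum>r<B. sW (\<epsilon> * (-1) ^ l * b l j r) (T l (j + r)))
        = (\<Sum>k<B. \<Sum>j\<le>k. sW (\<epsilon> * (-1) ^ l * b l j (k - j)) (T l k))" by simp
    qed
    also have "\<dots> = (\<Sum>l<B. \<Sum>k<B. sW (\<epsilon> * (-1) ^ (k + l) * C l) (T l k))"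
    proof (intro sum.cong refl)
      fix l k
      have "(\<Sum>j\<le>k. b l j (k - j)) = (\<Sum>r\<le>k. b l (k - r) r)"
        by (rule sum.reindex_bij_witness[of _ "\<lambda>r. k - r" "\<lambda>j. k - j"]) auto
      also have "\<dots> = (\<Sum>r\<in>{..k} \<inter> {..l}. b l (k - r) r)"
        by (rule sum.mono_neutral_right) (auto simp: b_def)
      also have "\<dots> = (\<Sum>r\<in>{..k} \<inter> {..l}. (-1) ^ k * ((-1) ^ r * of_nat (k choose r) * ((of_int n + of_nat k - of_nat r) gchoose (l - r))))"
      proof (intro sum.cong refl)
        fix r assume r: "r \<in> {..k} \<inter> {..l}"
        then have "(k choose (k - r)) = (k choose r)" by (simp add: binomial_symmetric[symmetric])
        moreover have "(-1 :: complex) ^ (k - r) = (-1) ^ k * (-1) ^ r"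
          using r by (auto simp: minus_one_power_iff)
        ultimately show "b l (k - r) r = (-1) ^ k * ((-1) ^ r * of_nat (k choose r) * ((of_int n + of_nat k - of_nat r) gchoose (l - r)))"
          using r by (simp add: b_def of_nat_diff algebra_simps)
      qed
      also have "\<dots> = (\<Sum>r\<le>l. (-1) ^ k * ((-1) ^ r * of_nat (k choose r) * ((of_int n + of_nat k - of_nat r) gchoose (l - r))))"
        by (rule sum.mono_neutral_left) (auto simp: binomial_eq_0)
      also have "\<dots> = (-1) ^ k * C l"
        unfolding sum_distrib_left[symmetric] gbinomial_alternating_convolution C_def ..
      finally have "(\<Sum>j\<le>k. \<epsilon> * (-1) ^ l * b l j (k - j)) = \<epsilon> * (-1) ^ (k + l) * C l"
        unfolding sum_distrib_left[symmetric] by (simp add: power_add mult_ac)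
      then show "(\<Sum>j\<le>k. sW (\<epsilon> * (-1) ^ l * b l j (k - j)) (T l k)) = sW (\<epsilon> * (-1) ^ (k + l) * C l) (T l k)"
        unfolding W.scale_sum_left[symmetric] by simp
    qed
    finally show ?thesis .
  qed
  show ?thesis unfolding 1 2 3 ..
qed

end

section \<open>The linear system for the zero mode\<close>

context virasoro begin

text \<open>The guard turns the commutation relation into a terminating rewrite rule: nonnegative
  modes move right past negative ones, and negative modes are sorted with L(-1) leftmost.\<close>

lemma normal_order:
  "m \<ge> 0 \<and> n < 0 \<or> m < n \<and> n < 0 \<Longrightarrow> L m (L n v) = L n (L m v) + s (of_int (m - n)) (L (m + n) v)
        + (if m + n = 0 then s (of_int (m ^ 3 - m) / 12 * c) v else 0)"
  by (rule L_commute)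

text \<open>
  Turns identities between vectors into ring identities, which are easier to automate.
\<close>

lemma functional_eqI:
  assumes "\<And>\<phi> :: 'v \<Rightarrow> complex. (\<And>x y. \<phi> (x + y) = \<phi> x + \<phi> y) \<Longrightarrow> (\<And>x y. \<phi> (x - y) = \<phi> x - \<phi> y) \<Longrightarrow>
    (\<And>a x. \<phi> (s a x) = a * \<phi> x) \<Longrightarrow> (\<And>x. \<phi> (- x) = - \<phi> x) \<Longrightarrow> \<phi> x = \<phi> y"
  shows "x = y"
proof (rule ccontr)
  assume "x \<noteq> y"
  then have "x - y \<notin> {0}" by simp
  then obtain \<phi> where \<phi>: "Vector_Spaces.linear s ((*) :: complex \<Rightarrow> complex \<Rightarrow> complex) \<phi>" "\<phi> (x - y) = 1"
    using separating_functional[OF subspace_single_0] by blast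
  interpret \<phi>: module_hom s "(*)" \<phi> by (rule \<phi>(1)[THEN Vector_Spaces.linear.axioms(3)])
  have "\<phi> x = \<phi> y" by (rule assms) (rule \<phi>.add \<phi>.diff \<phi>.scale \<phi>.neg)+
  then show False using \<phi>(2) by (simp add: \<phi>.diff)
qed

lemma weight_L: "L 0 x = s a x \<Longrightarrow> L 0 (L n x) = s (a - of_int n) (L n x)"
  by (subst L_commute) (simp add: L_scale scale_left_diff_distrib)

text \<open>If L(-1) x = 0, then L(n) x = 0 implies (n + 1) L(n - 1) x = 0. Descending from a large
  n, where the bound on the weights applies, one arrives at L(0) x = 0.\<close>

lemma L_minus_one_injective:
  assumes low: "\<And>k x. L 0 x = s (of_int k) x \<Longrightarrow> k < r \<Longrightarrow> x = 0"
    and x: "L 0 x = s (of_int k) x" "k \<noteq> 0" and 0: "L (-1) x = 0"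
  shows "x = 0"
proof -
  have step: "L (n - 1) x = 0" if "n \<ge> 1" "L n x = 0" for n
  proof -
    have "s (of_int (n + 1)) (L (n - 1) x) = 0"
      using L_commute[of n "-1" x] that 0 by (auto simp: L_zero split: if_splits)
    moreover have "(of_int (n + 1) :: complex) \<noteq> 0" using that by (subst of_int_eq_0_iff) simp
    ultimately show ?thesis by (simp only: scale_eq_0_iff) simp
  qed
  define N where "N = max 1 (k - r + 1)"
  have "L N x = 0"
    by (rule low[of _ "k - N"]) (use weight_L[OF x(1), of N] in \<open>auto simp: N_def\<close>)
  have "L (N - int i) x = 0" if "int i \<le> N" for i
    using that
  proof (induction i)
    case (Suc i)
    then show ?case using step[of "N - int i"] by (simp add: algebra_simps)
  qed (use \<open>L N x = 0\<close> in simp)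
  moreover have "N \<ge> 1" by (simp add: N_def)
  ultimately have "L 0 x = 0" using \<open>\<And>i. int i \<le> N \<Longrightarrow> L (N - int i) x = 0\<close>[of "nat N"] by simp
  then show ?thesis using x by (simp add: scale_eq_0_iff)
qed

text \<open>In w_0 \<omega> the terms L(-1) w and L(-1) L(0) w cancel, and what remains is -1/2
  L(-1)^2 y. Subtracting the zero mode of \<open>w\<close> thus replaces \<open>g\<close> by g + 1/2
  L(-1) y. The last two conclusions say that L(4) and L(2) annihilate this vector; L(4) y vanishes
  for weight reasons.\<close>

lemma weight_one_coboundary:
  assumes low: "\<And>k x. L 0 x = s (of_int k) x \<Longrightarrow> k < -3 \<Longrightarrow> x = 0"
    and g: "L 0 g = g"
    and eq1: "L 3 g = s (2 / 5) (L (-1) (L 4 g))"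
    and eq2: "L 1 g = s (1 / 3) (L (-1) (L 2 g)) - s (1 / 60) (L (-1) (L (-1) (L (-1) (L 4 g))))"
    and c: "c \<noteq> 25" "c \<noteq> 26" "c \<noteq> 28" "c \<noteq> 152 / 5"
  obtains w y where "L 0 w = w" "L 0 y = 0"
    "y = L 1 w - s (1 / 3) (L (-1) (L 2 w)) + s (1 / 12) (L (-1) (L (-1) (L 3 w))) - s (1 / 60) (L (-1) (L (-1) (L (-1) (L 4 w))))"
    "L 3 y = s (- 2 / 5) (L 4 g)" "s 3 (L 1 y) + L (-1) (L 2 y) = s (- 2) (L 2 g)"
proof -
  \<comment> \<open>On these four vectors the positive modes act in closed form. \<open>a\<close>
    and \<open>d\<close> have weight -3, so all positive modes kill them; \<open>u\<close> is moved
    only by L(1), to \<open>d\<close>; and L(1) b = u, while L(2) b turns out to be a multiple of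
    \<open>a\<close>.\<close>
  define a b where "a = L 4 g" and "b = L 2 g"
  define u d where "u = L 1 b" and "d = L 1 u"
  have wg: "L 0 g = s (of_int 1) g" using g by simp
  have a0: "L 0 a = s (of_int (-3)) a" using weight_L[OF wg, of 4] by (simp add: a_def)
  have b0: "L 0 b = s (of_int (-1)) b" using weight_L[OF wg, of 2] by (simp add: b_def)
  have u0: "L 0 u = s (of_int (-2)) u" using weight_L[OF b0, of 1] by (simp add: u_def)
  have d0: "L 0 d = s (of_int (-3)) d" using weight_L[OF u0, of 1] by (simp add: d_def)
  have kill: "L n x = 0" if "L 0 x = s (of_int k) x" "n > k + 3" for n k x
    by (rule low[of _ "k - n"]) (use weight_L[OF that(1), of n] that(2) in auto)
  have ak: "L n a = 0" if "n > 0" for n using kill[OF a0] that by simp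
  have dk: "L n d = 0" if "n > 0" for n using kill[OF d0] that by simp
  have uk: "L n u = 0" if "n > 1" for n using kill[OF u0] that by simp
  have bk: "L n b = 0" if "n > 2" for n using kill[OF b0] that by simp
  \<comment> \<open>L(2) L(1) g is computed by the commutator and by \<open>eq2\<close>. The
    difference is L(-1) applied to a vector of weight -3, where L(-1) is injective.\<close>
  have b2: "L 2 b = s (- 6 / 5) a"
  proof -
    have "L 2 (L 1 g) = L 1 b + L 3 g"
      using L_commute[of 2 1 g] by (simp add: b_def)
    then have "L 2 (s (1 / 3) (L (-1) b) - s (1 / 60) (L (-1) (L (-1) (L (-1) a)))) = u + s (2 / 5) (L (-1) a)"
      by (simp only: eq1 eq2 u_def flip: a_def b_def)
    moreover have "L 2 (s (1 / 3) (L (-1) b) - s (1 / 60) (L (-1) (L (-1) (L (-1) a))))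
      = s (1 / 3) (L (-1) (L 2 b)) + u + s (4 / 5) (L (-1) a)"
    proof (rule functional_eqI)
      fix \<phi> :: "'v \<Rightarrow> complex"
      assume \<phi>: "\<And>x y. \<phi> (x + y) = \<phi> x + \<phi> y" "\<And>x y. \<phi> (x - y) = \<phi> x - \<phi> y"
        "\<And>a x. \<phi> (s a x) = a * \<phi> x" "\<And>x. \<phi> (- x) = - \<phi> x"
      show "\<phi> (L 2 (s (1 / 3) (L (-1) b) - s (1 / 60) (L (-1) (L (-1) (L (-1) a)))))
        = \<phi> (s (1 / 3) (L (-1) (L 2 b)) + u + s (4 / 5) (L (-1) a))"
        by (simp add: L_linear normal_order ak a0 \<phi> algebra_simps flip: u_def)
    qed
    ultimately have e: "s (1 / 3) (L (-1) (L 2 b)) + s (2 / 5) (L (-1) a) = 0"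
      using scale_left_distrib[of "2 / 5" "2 / 5" "L (-1) a"] by simp
    have "L (-1) (L 2 b + s (6 / 5) a) = s 3 (s (1 / 3) (L (-1) (L 2 b)) + s (2 / 5) (L (-1) a))"
      by (simp add: L_linear scale_right_distrib)
    then have P0: "L (-1) (L 2 b + s (6 / 5) a) = 0" by (simp only: e scale_zero_right)
    have "L 2 b + s (6 / 5) a = 0"
    proof (rule L_minus_one_injective[where r = "-3" and k = "-3"])
      show "x = 0" if "L 0 x = s (of_int k) x" "k < -3" for k x using that by (rule low)
      show "L 0 (L 2 b + s (6 / 5) a) = s (of_int (-3)) (L 2 b + s (6 / 5) a)"
        using weight_L[OF b0, of 2] a0 by (simp add: L_linear scale_right_distrib scale_right_diff_distrib mult.commute)
    qed (use P0 in simp_all)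
    then have "L 2 b = - s (6 / 5) a" by (simp add: eq_neg_iff_add_eq_0)
    then show ?thesis using scale_minus_left[of "6 / 5" a] by simp
  qed
  text \<open>
    The coefficients below are the solution of the linear system expressing the last two claims.
  \<close>

  define Q where "Q = (26 - c) * (c - 25) * (5 * c - 152)"
  define A where "A = - (5 * c\<^sup>2 - 606 * c + 12160) / (30 * Q)"
  define B where "B = (18 * c - 456) / Q"
  define C where "C = 2 / (26 - c)"
  define D where "D = (c - 29) / (3 * (26 - c) * (28 - c))"
  define E where "E = (- 5 * c ^ 3 + 482 * c\<^sup>2 - 15052 * c + 153256) / (18 * Q * (28 - c))"
  define F where "F = (127 - 5 * c) / Q"
  \<comment> \<open>Modulo the image of L(-1), these six vectors span the weight 1 descendants of
    \<open>a\<close>, \<open>b\<close>, \<open>u\<close>, \<open>d\<close>. Vectors in the image of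
    L(-1) have vanishing zero mode and cannot contribute.\<close>
  define w where "w = s A (L (-4) a) + s B (L (-2) (L (-2) a)) + s C (L (-2) b) + s D (L (-3) u)
    + s E (L (-4) d) + s F (L (-2) (L (-2) d))"
  note gens = ak a0 b0 b2 bk u0 uk d0 dk u_def[symmetric] d_def[symmetric]
  have w1: "L 1 w = s (6 * B) (L (-1) (L (-2) a)) + s (6 * F) (L (-1) (L (-2) d)) + s (3 * C) (L (-1) b) +
      s (1 * C + 4 * D) (L (-2) u) + s (5 * A + (-3) * B) (L (-3) a) +
      s (1 * D + 5 * E + (-3) * F) (L (-3) d)" (is "?l = ?r")
  proof (rule functional_eqI)
    fix \<phi> :: "'v \<Rightarrow> complex"
      assume \<phi>: "\<And>x y. \<phi> (x + y) = \<phi> x + \<phi> y" "\<And>x y. \<phi> (x - y) = \<phi> x - \<phi> y"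
        "\<And>a x. \<phi> (s a x) = a * \<phi> x" "\<And>x. \<phi> (- x) = - \<phi> x"
    show "\<phi> ?l = \<phi> ?r"
      by (simp add: w_def L_linear normal_order gens \<phi>) (simp add: field_simps power2_eq_square)
  qed
  have w2: "L 2 w = s ((-4) * C + 1 / 2 * C * c) b + s (5 * D) (L (-1) u) +
      s (6 * A + (-16) * B + 1 * B * c + (-6 / 5) * C) (L (-2) a) +
      s (6 * E + (-16) * F + 1 * F * c) (L (-2) d)" (is "?l = ?r")
  proof (rule functional_eqI)
    fix \<phi> :: "'v \<Rightarrow> complex"
      assume \<phi>: "\<And>x y. \<phi> (x + y) = \<phi> x + \<phi> y" "\<And>x y. \<phi> (x - y) = \<phi> x - \<phi> y"
        "\<And>a x. \<phi> (s a x) = a * \<phi> x" "\<And>x. \<phi> (- x) = - \<phi> x"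
    show "\<phi> ?l = \<phi> ?r"
      by (simp add: w_def L_linear normal_order gens \<phi>) (simp add: field_simps power2_eq_square)
  qed
  have w3: "L 3 w = s (5 * C + (-12) * D + 2 * D * c) u + s (7 * A + 15 * B) (L (-1) a) +
      s (7 * E + 15 * F) (L (-1) d)" (is "?l = ?r")
  proof (rule functional_eqI)
    fix \<phi> :: "'v \<Rightarrow> complex"
      assume \<phi>: "\<And>x y. \<phi> (x + y) = \<phi> x + \<phi> y" "\<And>x y. \<phi> (x - y) = \<phi> x - \<phi> y"
        "\<And>a x. \<phi> (s a x) = a * \<phi> x" "\<And>x. \<phi> (- x) = - \<phi> x"
    show "\<phi> ?l = \<phi> ?r"
      by (simp add: w_def L_linear normal_order gens \<phi>) (simp add: field_simps power2_eq_square)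
  qed
  have w4: "L 4 w = s ((-24) * A + 5 * A * c + (-72) * B + 3 * B * c + (-36 / 5) * C) a +
      s (7 * D + (-24) * E + 5 * E * c + (-72) * F + 3 * F * c) d" (is "?l = ?r")
  proof (rule functional_eqI)
    fix \<phi> :: "'v \<Rightarrow> complex"
      assume \<phi>: "\<And>x y. \<phi> (x + y) = \<phi> x + \<phi> y" "\<And>x y. \<phi> (x - y) = \<phi> x - \<phi> y"
        "\<And>a x. \<phi> (s a x) = a * \<phi> x" "\<And>x. \<phi> (- x) = - \<phi> x"
    show "\<phi> ?l = \<phi> ?r"
      by (simp add: w_def L_linear normal_order gens \<phi>) (simp add: field_simps power2_eq_square)
  qed
  define y where "y = L 1 w - s (1 / 3) (L (-1) (L 2 w)) + s (1 / 12) (L (-1) (L (-1) (L 3 w))) - s (1 / 60) (L (-1) (L (-1) (L (-1) (L 4 w))))"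
  have y: "y = s ((-8 / 3) * D + 5 / 12 * C + 1 / 6 * D * c) (L (-1) (L (-1) u)) +
      s (59 / 60 * A + 49 / 20 * B + (-1 / 12) * A * c + (-1 / 20) * B * c + 3 / 25 * C) (L (-1) (L (-1) (L (-1) a))) +
      s (59 / 60 * E + 49 / 20 * F + (-7 / 60) * D + (-1 / 12) * E * c + (-1 / 20) * F * c) (L (-1) (L (-1) (L (-1) d))) +
      s (34 / 3 * B + (-2) * A + (-1 / 3) * B * c + 2 / 5 * C) (L (-1) (L (-2) a)) +
      s (34 / 3 * F + (-2) * E + (-1 / 3) * F * c) (L (-1) (L (-2) d)) +
      s (13 / 3 * C + (-1 / 6) * C * c) (L (-1) b) + s (1 * C + 4 * D) (L (-2) u) +
      s (5 * A + (-3) * B) (L (-3) a) + s (1 * D + 5 * E + (-3) * F) (L (-3) d)" (is "?l = ?r")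
  proof (rule functional_eqI)
    fix \<phi> :: "'v \<Rightarrow> complex"
      assume \<phi>: "\<And>x y. \<phi> (x + y) = \<phi> x + \<phi> y" "\<And>x y. \<phi> (x - y) = \<phi> x - \<phi> y"
        "\<And>a x. \<phi> (s a x) = a * \<phi> x" "\<And>x. \<phi> (- x) = - \<phi> x"
    show "\<phi> ?l = \<phi> ?r"
      by (simp add: y_def w1 w2 w3 w4 L_linear normal_order gens \<phi>) (simp add: field_simps power2_eq_square)
  qed
  have y1: "L 1 y = s ((-26 / 3) * C + 1 / 3 * C * c) b +
      s (23 / 5 * B + (-89 / 5) * A + (-2 / 5) * B * c + (-6 / 25) * C + 1 * A * c) (L (-1) (L (-1) a)) +
      s (23 / 5 * F + (-89 / 5) * E + (-2 / 5) * F * c + (-19 / 15) * D + 5 / 12 * C + 1 / 6 * D * c + 1 * E * c) (L (-1) (L (-1) d)) +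
      s (29 / 6 * C + 28 * D + (-1 / 6) * C * c + (-1) * D * c) (L (-1) u) +
      s (24 * A + (-104 / 3) * B + 2 / 3 * B * c + (-4 / 5) * C) (L (-2) a) +
      s (1 * C + 8 * D + 24 * E + (-104 / 3) * F + 2 / 3 * F * c) (L (-2) d)" (is "?l = ?r")
  proof (rule functional_eqI)
    fix \<phi> :: "'v \<Rightarrow> complex"
      assume \<phi>: "\<And>x y. \<phi> (x + y) = \<phi> x + \<phi> y" "\<And>x y. \<phi> (x - y) = \<phi> x - \<phi> y"
        "\<And>a x. \<phi> (s a x) = a * \<phi> x" "\<And>x. \<phi> (- x) = - \<phi> x"
    show "\<phi> ?l = \<phi> ?r"
      by (simp add: y L_linear normal_order gens \<phi>) (simp add: field_simps power2_eq_square)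
  qed
  have y2: "L 2 y = s ((-81 / 5) * A + (-833 / 5) * B + 136 / 15 * B * c + (-304 / 25) * C + 3 * A * c + (-1 / 6) * B * c ^ 2 + 2 / 5 * C * c) (L (-1) a) +
      s ((-27 / 5) * D + (-81 / 5) * E + (-833 / 5) * F + 136 / 15 * F * c + 3 * E * c + (-1 / 6) * F * c ^ 2 + 5 / 2 * C + 1 * D * c) (L (-1) d)" (is "?l = ?r")
  proof (rule functional_eqI)
    fix \<phi> :: "'v \<Rightarrow> complex"
      assume \<phi>: "\<And>x y. \<phi> (x + y) = \<phi> x + \<phi> y" "\<And>x y. \<phi> (x - y) = \<phi> x - \<phi> y"
        "\<And>a x. \<phi> (s a x) = a * \<phi> x" "\<And>x. \<phi> (- x) = - \<phi> x"
    show "\<phi> ?l = \<phi> ?r"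
      by (simp add: y L_linear normal_order gens \<phi>) (simp add: field_simps power2_eq_square)
  qed
  have y3: "L 3 y = s ((-324 / 5) * A + (-3332 / 5) * B + 12 * A * c + 544 / 15 * B * c + (-1216 / 25) * C + (-2 / 3) * B * c ^ 2 + 8 / 5 * C * c) a +
      s (10 * C + (-108 / 5) * D + (-324 / 5) * E + (-3332 / 5) * F + 4 * D * c + 12 * E * c + 544 / 15 * F * c + (-2 / 3) * F * c ^ 2) d" (is "?l = ?r")
  proof (rule functional_eqI)
    fix \<phi> :: "'v \<Rightarrow> complex"
      assume \<phi>: "\<And>x y. \<phi> (x + y) = \<phi> x + \<phi> y" "\<And>x y. \<phi> (x - y) = \<phi> x - \<phi> y"
        "\<And>a x. \<phi> (s a x) = a * \<phi> x" "\<And>x. \<phi> (- x) = - \<phi> x"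
    show "\<phi> ?l = \<phi> ?r"
      by (simp add: y L_linear normal_order gens \<phi>) (simp add: field_simps power2_eq_square)
  qed
  \<comment> \<open>A common denominator of the six coefficients; multiplying by it reduces every
    equation to a polynomial identity in c.\<close>
  define R where "R = Q * (28 - c)"
  have nz: "26 - c \<noteq> 0" "28 - c \<noteq> 0" "c - 25 \<noteq> 0" "5 * c - 152 \<noteq> 0"
    using c by (auto simp: field_simps)
  then have Q0: "Q \<noteq> 0" and R0: "R \<noteq> 0" by (simp_all add: Q_def R_def)
  have AR: "A * R = - (5 * c\<^sup>2 - 606 * c + 12160) * (28 - c) / 30"
    using Q0 by (simp add: A_def R_def)
  have BR: "B * R = (18 * c - 456) * (28 - c)"
    using Q0 by (simp add: B_def R_def)
  have CR: "C * R = 2 * (c - 25) * (5 * c - 152) * (28 - c)"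
    using nz by (simp add: C_def R_def Q_def)
  have DR: "D * R = (c - 29) * (c - 25) * (5 * c - 152) / 3"
  proof -
    have "x / (3 * y * z) * (y * v * r * z) = x * v * r / 3" if "y \<noteq> 0" "z \<noteq> 0" for x y z v r :: complex
      using that by (simp add: field_simps)
    from this[OF nz(1,2)] show ?thesis unfolding D_def R_def Q_def .
  qed
  have ER: "E * R = (- 5 * c ^ 3 + 482 * c\<^sup>2 - 15052 * c + 153256) / 18"
  proof -
    have "x / (18 * y * z) * (y * z) = x / 18" if "y \<noteq> 0" "z \<noteq> 0" for x y z :: complex
      using that by (simp add: field_simps)
    from this[OF Q0 nz(2)] show ?thesis unfolding E_def R_def .
  qed
  have FR: "F * R = (127 - 5 * c) * (28 - c)"
    using Q0 by (simp add: F_def R_def)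
  have lin: "pa * A + pb * B + pc * C + pd * D + pe * E + pf * F = k"
    if "pa * (A * R) + pb * (B * R) + pc * (C * R) + pd * (D * R) + pe * (E * R) + pf * (F * R) = k * R"
    for pa pb pc pd pe pf k
  proof -
    have "(pa * A + pb * B + pc * C + pd * D + pe * E + pf * F) * R = k * R"
      using that by (simp add: algebra_simps)
    then show ?thesis using R0 by simp
  qed
  note solve = AR BR CR DR ER FR
  \<comment> \<open>The system has eight equations for six unknowns. \<open>e1\<close> and
    \<open>e2\<close> are the coefficients of \<open>a\<close> and \<open>d\<close> in L(3) y;
    \<open>e3\<close> to \<open>e8\<close> are those of b, L(-1)^2 a, L(-1)^2 d, L(-1) u, L(-2) a,
    L(-2) d in 3 L(1) y + L(-1) L(2) y. The zero terms fit them to \<open>lin\<close>.\<close>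
  have e1: "(12 * c - 324 / 5) * A + (544 / 15 * c - 3332 / 5 - 2 / 3 * c\<^sup>2) * B + (8 / 5 * c - 1216 / 25) * C
      + 0 * D + 0 * E + 0 * F = - 2 / 5"
    by (rule lin, unfold solve, unfold R_def Q_def) (simp add: field_simps power2_eq_square power3_eq_cube)
  have e2: "0 * A + 0 * B + 10 * C + (4 * c - 108 / 5) * D + (12 * c - 324 / 5) * E + (544 / 15 * c - 3332 / 5 - 2 / 3 * c\<^sup>2) * F = 0"
    by (rule lin, unfold solve, unfold R_def Q_def) (simp add: field_simps power2_eq_square power3_eq_cube)
  have e3: "0 * A + 0 * B + (c - 26) * C + 0 * D + 0 * E + 0 * F = - 2"
    by (rule lin, unfold solve, unfold R_def Q_def) (simp add: field_simps power2_eq_square power3_eq_cube)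
  have e4: "(6 * c - 348 / 5) * A + (118 / 15 * c - 764 / 5 - 1 / 6 * c\<^sup>2) * B + (2 / 5 * c - 322 / 25) * C
      + 0 * D + 0 * E + 0 * F = 0"
    by (rule lin, unfold solve, unfold R_def Q_def) (simp add: field_simps power2_eq_square power3_eq_cube)
  have e5: "0 * A + 0 * B + 15 / 4 * C + (3 / 2 * c - 46 / 5) * D + (6 * c - 348 / 5) * E + (118 / 15 * c - 764 / 5 - 1 / 6 * c\<^sup>2) * F = 0"
    by (rule lin, unfold solve, unfold R_def Q_def) (simp add: field_simps power2_eq_square power3_eq_cube)
  have e6: "0 * A + 0 * B + (29 / 2 - 1 / 2 * c) * C + (84 - 3 * c) * D + 0 * E + 0 * F = 0"
    by (rule lin, unfold solve, unfold R_def Q_def) (simp add: field_simps power2_eq_square power3_eq_cube)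
  have e7: "72 * A + (2 * c - 104) * B + (- 12 / 5) * C + 0 * D + 0 * E + 0 * F = 0"
    by (rule lin, unfold solve, unfold R_def Q_def) (simp add: field_simps power2_eq_square power3_eq_cube)
  have e8: "0 * A + 0 * B + 3 * C + 24 * D + 72 * E + (2 * c - 104) * F = 0"
    by (rule lin, unfold solve, unfold R_def Q_def) (simp add: field_simps power2_eq_square power3_eq_cube)
  show ?thesis
  proof (rule that[of w y])
    show "L 0 w = w"
    proof (rule functional_eqI)
      fix \<phi> :: "'v \<Rightarrow> complex"
      assume \<phi>: "\<And>x y. \<phi> (x + y) = \<phi> x + \<phi> y" "\<And>x y. \<phi> (x - y) = \<phi> x - \<phi> y"
        "\<And>a x. \<phi> (s a x) = a * \<phi> x" "\<And>x. \<phi> (- x) = - \<phi> x"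
      show "\<phi> (L 0 w) = \<phi> w"
        by (simp add: w_def L_linear normal_order gens \<phi>)
    qed
    show "L 0 y = 0"
    proof (rule functional_eqI)
      fix \<phi> :: "'v \<Rightarrow> complex"
      assume \<phi>: "\<And>x y. \<phi> (x + y) = \<phi> x + \<phi> y" "\<And>x y. \<phi> (x - y) = \<phi> x - \<phi> y"
        "\<And>a x. \<phi> (s a x) = a * \<phi> x" "\<And>x. \<phi> (- x) = - \<phi> x"
      have "\<phi> 0 = 0" using \<phi>(3)[of 0 0] by simp
      then show "\<phi> (L 0 y) = \<phi> 0"
        by (simp add: y L_linear normal_order gens \<phi>)
    qed
    show "y = L 1 w - s (1 / 3) (L (-1) (L 2 w)) + s (1 / 12) (L (-1) (L (-1) (L 3 w))) - s (1 / 60) (L (-1) (L (-1) (L (-1) (L 4 w))))"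
      by (rule y_def)
    show "L 3 y = s (- 2 / 5) (L 4 g)"
    proof -
      have "L 3 y = s ((12 * c - 324 / 5) * A + (544 / 15 * c - 3332 / 5 - 2 / 3 * c\<^sup>2) * B + (8 / 5 * c - 1216 / 25) * C
          + 0 * D + 0 * E + 0 * F) a
        + s (0 * A + 0 * B + 10 * C + (4 * c - 108 / 5) * D + (12 * c - 324 / 5) * E + (544 / 15 * c - 3332 / 5 - 2 / 3 * c\<^sup>2) * F) d"
        unfolding y3 by (rule arg_cong2[where f = "(+)"]; rule arg_cong2[where f = s]) (simp_all add: algebra_simps)
      then show ?thesis by (simp only: e1 e2 scale_zero_left add_0_right a_def)
    qed
    show "s 3 (L 1 y) + L (-1) (L 2 y) = s (- 2) (L 2 g)"
    proof -
      have "s 3 (L 1 y) + L (-1) (L 2 y)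
        = s (0 * A + 0 * B + (c - 26) * C + 0 * D + 0 * E + 0 * F) b
        + s ((6 * c - 348 / 5) * A + (118 / 15 * c - 764 / 5 - 1 / 6 * c\<^sup>2) * B + (2 / 5 * c - 322 / 25) * C
          + 0 * D + 0 * E + 0 * F) (L (-1) (L (-1) a))
        + s (0 * A + 0 * B + 15 / 4 * C + (3 / 2 * c - 46 / 5) * D + (6 * c - 348 / 5) * E
          + (118 / 15 * c - 764 / 5 - 1 / 6 * c\<^sup>2) * F) (L (-1) (L (-1) d))
        + s (0 * A + 0 * B + (29 / 2 - 1 / 2 * c) * C + (84 - 3 * c) * D + 0 * E + 0 * F) (L (-1) u)
        + s (72 * A + (2 * c - 104) * B + (- 12 / 5) * C + 0 * D + 0 * E + 0 * F) (L (-2) a)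
        + s (0 * A + 0 * B + 3 * C + 24 * D + 72 * E + (2 * c - 104) * F) (L (-2) d)"
      proof (rule functional_eqI)
        fix \<phi> :: "'v \<Rightarrow> complex"
        assume \<phi>: "\<And>x y. \<phi> (x + y) = \<phi> x + \<phi> y" "\<And>x y. \<phi> (x - y) = \<phi> x - \<phi> y"
          "\<And>a x. \<phi> (s a x) = a * \<phi> x" "\<And>x. \<phi> (- x) = - \<phi> x"
        show "\<phi> (s 3 (L 1 y) + L (-1) (L 2 y)) = \<phi> (s (0 * A + 0 * B + (c - 26) * C + 0 * D + 0 * E + 0 * F) b
        + s ((6 * c - 348 / 5) * A + (118 / 15 * c - 764 / 5 - 1 / 6 * c\<^sup>2) * B + (2 / 5 * c - 322 / 25) * C
          + 0 * D + 0 * E + 0 * F) (L (-1) (L (-1) a))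
        + s (0 * A + 0 * B + 15 / 4 * C + (3 / 2 * c - 46 / 5) * D + (6 * c - 348 / 5) * E
          + (118 / 15 * c - 764 / 5 - 1 / 6 * c\<^sup>2) * F) (L (-1) (L (-1) d))
        + s (0 * A + 0 * B + (29 / 2 - 1 / 2 * c) * C + (84 - 3 * c) * D + 0 * E + 0 * F) (L (-1) u)
        + s (72 * A + (2 * c - 104) * B + (- 12 / 5) * C + 0 * D + 0 * E + 0 * F) (L (-2) a)
        + s (0 * A + 0 * B + 3 * C + 24 * D + 72 * E + (2 * c - 104) * F) (L (-2) d))"
          by (simp add: y1 y2 L_linear \<phi>) (simp add: field_simps power2_eq_square)
      qed
      then show ?thesis by (simp only: e3 e4 e5 e6 e7 e8 scale_zero_left add_0_right b_def)
    qed
  qed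
qed

end

section \<open>Derivations\<close>

context voa_weak_module begin

lemma skew_bound: obtains N where "\<And>j. j \<ge> N \<Longrightarrow> YW v (n + int j) w = 0"
proof -
  obtain K where K: "\<And>i. i \<ge> int K \<Longrightarrow> YW v i w = 0" using truncation_nat[of v w] by blast
  show ?thesis by (rule that[of "K + nat \<bar>n\<bar>"], rule K) linarith
qed

lemma Y_diff: "YW u n (x - y) = YW u n x - YW u n y"
  using Y_add[of u n "x - y" y] by simp

lemma skew_diff: "skew (x - y) n v = skew x n v - skew y n v"
proof -
  obtain N1 where N1: "\<And>j. j \<ge> N1 \<Longrightarrow> YW v (n + int j) x = 0" using skew_bound[of v n x] by blast
  obtain N2 where N2: "\<And>j. j \<ge> N2 \<Longrightarrow> YW v (n + int j) y = 0" using skew_bound[of v n y] by blast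
  show ?thesis
    using skew_sum[of "max N1 N2" v n x] skew_sum[of "max N1 N2" v n y] skew_sum[of "max N1 N2" v n "x - y"]
    by (simp add: N1 N2 Y_diff divpow_diff W.scale_right_diff_distrib sum_subtractf)
qed

lemma skew_zero: "skew 0 n v = 0" using skew_diff[of 0 0 n v] by simp

lemma skew_add_vec: "skew w n (u + v) = skew w n u + skew w n v"
proof -
  obtain N1 where N1: "\<And>j. j \<ge> N1 \<Longrightarrow> YW u (n + int j) w = 0" using skew_bound[of u n w] by blast
  obtain N2 where N2: "\<And>j. j \<ge> N2 \<Longrightarrow> YW v (n + int j) w = 0" using skew_bound[of v n w] by blast
  show ?thesis
    using skew_sum[of "max N1 N2" u n w] skew_sum[of "max N1 N2" v n w] skew_sum[of "max N1 N2" "u + v" n w]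
    by (simp add: N1 N2 vec_add divpow_add W.scale_right_distrib sum.distrib)
qed

lemma skew_scale_vec: "skew w n (sV a v) = sW a (skew w n v)"
proof -
  obtain N where N: "\<And>j. j \<ge> N \<Longrightarrow> YW v (n + int j) w = 0" using skew_bound[of v n w] by blast
  show ?thesis
    using skew_sum[of N v n w] skew_sum[of N "sV a v" n w]
    by (simp add: N vec_scale divpow_scale W.scale_sum_right mult.commute)
qed

lemma linear_skew: "Vector_Spaces.linear sV sW (skew w n)"
  by unfold_locales (auto simp: skew_add_vec skew_scale_vec)

lemma M0_divpow: "M 0 (divpow j x) = divpow j (M 0 x) + sW (of_nat j) (divpow j x)"
proof (induction j)
  case (Suc j)
  have "M 0 (divpow (Suc j) x) = sW (1 / of_nat (Suc j)) (M (-1) (M 0 (divpow j x)) + M (-1) (divpow j x))"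
    by (simp add: divpow_Suc' W.L_scale W.L_commute[of 0] del: of_nat_Suc)
  also have "M (-1) (M 0 (divpow j x)) + M (-1) (divpow j x) = M (-1) (divpow j (M 0 x)) + sW (of_nat (Suc j)) (M (-1) (divpow j x))"
    by (simp add: Suc.IH W.L_add W.L_scale W.scale_left_distrib)
  also have "sW (1 / of_nat (Suc j)) \<dots> = divpow (Suc j) (M 0 x) + sW (of_nat (Suc j)) (divpow (Suc j) x)"
    by (simp add: divpow_Suc' W.scale_right_distrib del: of_nat_Suc)
  finally show ?case .
qed simp

lemma skew_M0:
  assumes "M 0 w = w" shows "skew w 0 (L 0 v) = M 0 (skew w 0 v)"
proof -
  obtain N1 where N1: "\<And>j. j \<ge> N1 \<Longrightarrow> YW v (0 + int j) w = 0" using skew_bound[of v 0 w] by blast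
  obtain N2 where N2: "\<And>j. j \<ge> N2 \<Longrightarrow> YW (L 0 v) (0 + int j) w = 0" using skew_bound[of "L 0 v" 0 w] by blast
  have "M 0 (divpow j (YW v (int j) w)) = divpow j (YW (L 0 v) (int j) w)" for j
    by (simp add: M0_divpow M_0_mode assms divpow_add divpow_diff divpow_scale algebra_simps)
  then show ?thesis
    using skew_sum[of "max N1 N2" v 0 w] skew_sum[of "max N1 N2" "L 0 v" 0 w] N1 N2
    by (simp add: W.L_linear)
qed

lemma zero_mode_in_H1:
  assumes "M 0 w = w" shows "skew w 0 \<in> H1 sV Y \<omega> sW YW (M 0)"
  using assms by (auto simp: H1_def linear_skew skew_M0 skew_mode_derivation fun_eq_iff)

lemma H1_diff:
  assumes "F \<in> H1 sV Y \<omega> sW YW (M 0)" "G \<in> H1 sV Y \<omega> sW YW (M 0)"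
  shows "(\<lambda>v. F v - G v) \<in> H1 sV Y \<omega> sW YW (M 0)"
proof -
  interpret F: Vector_Spaces.linear sV sW F using assms by (simp add: H1_def)
  interpret G: Vector_Spaces.linear sV sW G using assms by (simp add: H1_def)
  have "F (L 0 v) = M 0 (F v)" "G (L 0 v) = M 0 (G v)" for v
    using assms by (auto simp: H1_def fun_eq_iff)
  moreover have "Vector_Spaces.linear sV sW (\<lambda>v. F v - G v)"
    by unfold_locales (simp_all add: F.add G.add F.scale G.scale W.scale_right_diff_distrib)
  ultimately show ?thesis
    using assms by (auto simp: H1_def fun_eq_iff Y_diff skew_diff W.L_diff)
qed

end

section \<open>Derivations into modules over the minimal model\<close>

locale virasoro_minimal_module = voa_weak_module sV Y vac \<omega> c sW YW
  for sV :: "complex \<Rightarrow> 'v::ab_group_add \<Rightarrow> 'v" and Y vac \<omega> c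
    and sW :: "complex \<Rightarrow> 'w::ab_group_add \<Rightarrow> 'w" and YW :: "'v \<Rightarrow> int \<Rightarrow> 'w \<Rightarrow> 'w" +
  fixes p q :: nat
  assumes pq: "coprime p q" "p \<ge> 2" "q \<ge> 2"
    and c: "c = 1 - 6 * (of_nat p - of_nat q)\<^sup>2 / (of_nat p * of_nat q)"
    and irreducible: "virasoro_irreducible sV (Lmode Y \<omega>)"
    and highest_weight: "virasoro_highest_weight sV (Lmode Y \<omega>) c 0 vac"
    and low: "\<And>k x. Lmode YW \<omega> 0 x = sW (of_int k) x \<Longrightarrow> k < -3 \<Longrightarrow> x = 0"
begin

sublocale V: virasoro_vacuum sV L c vac
  by unfold_locales (rule highest_weight)

lemma c_values: "c \<noteq> 25" "c \<noteq> 26" "c \<noteq> 28" "c \<noteq> 152 / 5"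
proof -
  have "c = complex_of_real (1 - 6 * (real p - real q)\<^sup>2 / (real p * real q))" by (simp add: c)
  then have "Re c = 1 - 6 * (real p - real q)\<^sup>2 / (real p * real q)" by simp
  then have "Re c \<le> 1" by simp
  moreover have "Re (152 / 5) = 152 / 5" by simp
  ultimately show "c \<noteq> 25" "c \<noteq> 26" "c \<noteq> 28" "c \<noteq> 152 / 5" by fastforce+
qed

text \<open>The two claims are proved together, since vanishing above the top mode removes the terms
  in which a mode of \<omega> acts last. The arguments of \<open>three_point\<close> are d = 0 - 1,
  from ket weight 0 and bra weight 1, and the field weight 1.\<close>

lemma primary_mode:
  assumes g: "M 0 g = g" "\<And>n. n > 0 \<Longrightarrow> M n g = 0" and "0 \<notin> set w"
  shows "(\<forall>n \<ge> int (sum_list w). YW (V.L_word w vac) n g = 0) \<and>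
    YW (V.L_word w vac) (int (sum_list w) - 1) g = sW ((-1) ^ sum_list w * three_point (-1) 1 w) g"
  using assms(3)
proof (induction w)
  case Nil
  then show ?case by (simp add: vac_mode)
next
  case (Cons k w)
  let ?v = "V.L_word w vac"
  have k: "k > 0" using Cons.prems by simp
  have IH: "\<And>n. n \<ge> int (sum_list w) \<Longrightarrow> YW ?v n g = 0"
    "YW ?v (int (sum_list w) - 1) g = sW ((-1) ^ sum_list w * three_point (-1) 1 w) g"
    using Cons by auto
  have mode: "YW (V.L_word (k # w) vac) n g = sW ((-1) ^ k * of_int n) (YW ?v (n - int k) g)"
    if n: "n \<ge> int (k + sum_list w) - 1" for n
  proof -
    have sg: "(-1 :: complex) powi (1 - int k) = - ((-1) ^ k)"
    proof -
      have "(-1 :: complex) powi (1 - int k) = (-1) powi 1 * (-1) powi (- int k)"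
        by (subst power_int_add[symmetric]) auto
      also have "(-1 :: complex) powi (- int k) = (-1) ^ k" by (simp add: power_int_minus_one_minus)
      finally show ?thesis by simp
    qed
    have om: "YW \<omega> (int i) g = M (int i - 1) g" for i by (simp add: Lmode_def)
    have "YW (V.L_word (k # w) vac) n g = YW (Y \<omega> (1 - int k) ?v) n g" by (simp add: Lmode_def)
    \<comment> \<open>Two terms suffice: \<open>g\<close> is primary, so \<omega>_i g is nonzero at
      most for i = 0 and i = 1, where it is L(-1) g and L(0) g.\<close>
    also have "\<dots> = (\<Sum>i<2. sW ((-1) ^ i * (of_int (1 - int k) gchoose i)) (YW \<omega> (1 - int k - int i) (YW ?v (n + int i) g)))
     - (\<Sum>i<2. sW ((-1) powi (1 - int k) * (-1) ^ i * (of_int (1 - int k) gchoose i)) (YW ?v (n + (1 - int k) - int i) (YW \<omega> (int i) g)))"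
      by (rule iterate) (use n k in \<open>auto simp: om intro!: IH g\<close>)
    also have "(\<Sum>i<2. sW ((-1) ^ i * (of_int (1 - int k) gchoose i)) (YW \<omega> (1 - int k - int i) (YW ?v (n + int i) g))) = 0"
      by (rule sum.neutral) (use n k in \<open>auto simp: IH Y_zero\<close>)
    also have "0 - (\<Sum>i<2. sW ((-1) powi (1 - int k) * (-1) ^ i * (of_int (1 - int k) gchoose i)) (YW ?v (n + (1 - int k) - int i) (YW \<omega> (int i) g)))
      = sW ((-1) ^ k) (YW ?v (n + 1 - int k) (M (-1) g)) - sW ((-1) ^ k * (1 - of_nat k)) (YW ?v (n - int k) g)"
      by (simp add: sg eval_nat_numeral lessThan_Suc om g algebra_simps)
    also have "YW ?v (n + 1 - int k) (M (-1) g) = sW (of_int (n + 1 - int k)) (YW ?v (n - int k) g)"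
      using M_m1_mode[of ?v "n + 1 - int k" g] n k by (simp add: IH W.L_zero algebra_simps)
    also have "sW ((-1) ^ k) (sW (of_int (n + 1 - int k)) (YW ?v (n - int k) g)) - sW ((-1) ^ k * (1 - of_nat k)) (YW ?v (n - int k) g)
      = sW ((-1) ^ k * of_int n) (YW ?v (n - int k) g)"
      unfolding W.scale_scale W.scale_left_diff_distrib[symmetric]
      by (rule arg_cong2[where f = sW]) (simp_all add: algebra_simps)
    finally show ?thesis .
  qed
  have "YW (V.L_word (k # w) vac) (int (sum_list (k # w)) - 1) g = sW ((-1) ^ sum_list (k # w) * three_point (-1) 1 (k # w)) g"
    by (subst mode) (simp_all add: IH(2) power_add algebra_simps)
  moreover have "YW (V.L_word (k # w) vac) n g = 0" if "n \<ge> int (sum_list (k # w))" for n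
    by (subst mode) (use that in \<open>simp_all add: IH(1)\<close>)
  ultimately show ?case by blast
qed

lemma primary_weight_one_zero:
  assumes g: "M 0 g = g" "\<And>n. n > 0 \<Longrightarrow> M n g = 0"
  shows "g = 0"
proof (rule ccontr)
  assume "g \<noteq> 0"
  have "generated c 0 n (three_point (-1) 1)" for n
  proof (rule V.generated_of_functional[OF irreducible])
    \<comment> \<open>Modes are linear in the vector of V, so a linear relation in L(c,0) becomes a
      relation between multiples of \<open>g\<close>.\<close>
    fix b assume "(\<Sum>w\<in>compositions n. sV (b w) (V.L_word w vac)) = 0"
    then have "0 = YW (\<Sum>w\<in>compositions n. sV (b w) (V.L_word w vac)) (int n - 1) g" by (simp add: vec_zero)
    also have "\<dots> = (\<Sum>w\<in>compositions n. sW (b w) (YW (V.L_word w vac) (int n - 1) g))"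
      by (simp add: vec_sum vec_scale)
    also have "\<dots> = (\<Sum>w\<in>compositions n. sW ((-1) ^ n * (b w * three_point (-1) 1 w)) g)"
      using primary_mode[OF g] by (intro sum.cong refl) (auto simp: compositions_def mult_ac)
    also have "\<dots> = sW ((-1) ^ n * (\<Sum>w\<in>compositions n. b w * three_point (-1) 1 w)) g"
      by (simp add: W.scale_sum_left[symmetric] sum_distrib_left)
    finally show "(\<Sum>w\<in>compositions n. b w * three_point (-1) 1 w) = 0" using \<open>g \<noteq> 0\<close> by simp
  qed
  moreover have "c = 13 - 6 * (of_nat p / of_nat q) - 6 / (of_nat p / of_nat q)"
    using pq by (simp add: c field_simps power2_eq_square)
  ultimately show False using not_all_generated_three_point[OF pq] by metis
qed

text \<open>Applied to vac_(-1) vac = vac, the derivation rule reads F(vac) = F(vac) +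
  F(vac).\<close>

lemma H1_vacuum:
  assumes "F \<in> H1 sV Y \<omega> sW YW (M 0)" shows "F vac = 0"
proof -
  have "skew (F vac) (-1) vac = - (\<Sum>j<1. sW ((-1) powi (-1) * (-1) ^ j) (divpow j (YW vac (-1 + int j) (F vac))))"
    by (rule skew_sum) (simp add: vac_mode)
  moreover have "F (Y vac (-1) vac) = YW vac (-1) (F vac) + skew (F vac) (-1) vac"
    using assms by (simp add: H1_def)
  ultimately show ?thesis by (simp add: vacuum_V vac_mode)
qed

text \<open>When F \<omega> = 0, the second term of the derivation rule drops out for the modes of
  \<omega>, so the kernel is a Virasoro submodule containing the vacuum.\<close>

lemma H1_eq_zero:
  assumes F: "F \<in> H1 sV Y \<omega> sW YW (M 0)" and "F \<omega> = 0"
  shows "F v = 0"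
proof -
  interpret F: Vector_Spaces.linear sV sW F using F by (simp add: H1_def)
  have der: "F (Y u n v) = YW u n (F v) + skew (F u) n v" for u n v using F by (simp add: H1_def)
  show ?thesis
  proof (rule V.generated[of "{v. F v = 0}", simplified])
    show "V.subspace {v. F v = 0}" by (rule F.subspace_kernel)
    show "F (L n v) = 0" if "F v = 0" for n v
      using der[of \<omega> "n + 1" v] that assms(2) by (simp add: Lmode_def Y_zero skew_zero)
  qed (rule H1_vacuum[OF F])
qed

lemma H1_conformal_vector:
  assumes F: "F \<in> H1 sV Y \<omega> sW YW (M 0)"
  obtains g where "M 0 g = g" "F \<omega> = M (-1) g" "M 3 g = sW (2 / 5) (M (-1) (M 4 g))"
    "M 1 g = sW (1 / 3) (M (-1) (M 2 g)) - sW (1 / 60) (M (-1) (M (-1) (M (-1) (M 4 g))))"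
proof -
  interpret F: Vector_Spaces.linear sV sW F using F by (simp add: H1_def)
  have der: "F (Y u n v) = YW u n (F v) + skew (F u) n v" for u n v using F by (simp add: H1_def)
  have F0: "F (L 0 v) = M 0 (F v)" for v using F by (auto simp: H1_def fun_eq_iff)
  define f where "f = F \<omega>"
  have f0: "M 0 f = sW 2 f" using F0[of \<omega>] by (simp add: L_omega F.scale f_def)
  have fk: "M k f = 0" if "k \<ge> 6" for k
    by (rule low[of _ "2 - k"]) (use W.weight_L[OF f0, of k] that in auto)
  have wt: "M 0 (M k f) = sW (2 - of_int k) (M k f)" for k by (rule W.weight_L[OF f0])
  have derL: "F (L n \<omega>) = M n f + skew f (n + 1) \<omega>" for n
    using der[of \<omega> "n + 1" \<omega>] by (simp add: Lmode_def f_def)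
  have sk: "skew f (n + 1) \<omega> = - (\<Sum>j<N. sW ((-1) powi (n + 1) * (-1) ^ j) (divpow j (M (n + int j) f)))"
    if "n + int N \<ge> 6" for n N
  proof -
    have om: "YW \<omega> (n + 1 + int j) f = M (n + int j) f" for j by (simp add: Lmode_def algebra_simps)
    have "skew f (n + 1) \<omega> = - (\<Sum>j<N. sW ((-1) powi (n + 1) * (-1) ^ j) (divpow j (YW \<omega> (n + 1 + int j) f)))"
      by (rule skew_sum, unfold om, rule fk) (use that in linarith)
    then show ?thesis by (simp only: om)
  qed
  have vac: "F vac = 0" by (rule H1_vacuum[OF F])
  note expand = eval_nat_numeral lessThan_Suc divpow_def
  \<comment> \<open>Since \<omega>_1 \<omega> = 2 \<omega> and L(0) f = 2 f, the derivation rule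
    leaves f_1 \<omega> = 0. The leading term of this sum is 2 f and all others lie in the image of
    L(-1), which yields \<open>g\<close>.\<close>
  have c0: "sW 2 f - M (-1) (M 1 f) + sW (1 / 2) (M (-1) (M (-1) (M 2 f)))
      - sW (1 / 6) (M (-1) (M (-1) (M (-1) (M 3 f)))) + sW (1 / 24) (M (-1) (M (-1) (M (-1) (M (-1) (M 4 f)))))
      - sW (1 / 120) (M (-1) (M (-1) (M (-1) (M (-1) (M (-1) (M 5 f)))))) = 0"
    using derL[of 0] sk[of 0 6] F0[of \<omega>] f0 by (simp add: expand f_def[symmetric]) (simp add: algebra_simps)
  \<comment> \<open>\<open>c2\<close> comes from \<omega>_3 \<omega> = (c / 2) vac, on which F
    vanishes, and \<open>c4\<close> from \<omega>_5 \<omega> = 0. Written in terms of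
    \<open>g\<close>, they give the two relations for L(1) g and L(3) g.\<close>
  have c2: "sW 2 (M 2 f) - M (-1) (M 3 f) + sW (1 / 2) (M (-1) (M (-1) (M 4 f)))
      - sW (1 / 6) (M (-1) (M (-1) (M (-1) (M 5 f)))) = 0"
    using derL[of 2] sk[of 2 4] W.scale_left_distrib[of 1 1 "M 2 f"]
    by (simp add: expand L_omega F.scale vac) (simp add: algebra_simps)
  have c4: "sW 2 (M 4 f) - M (-1) (M 5 f) = 0"
    using derL[of 4] sk[of 4 2] W.scale_left_distrib[of 1 1 "M 4 f"] by (simp add: expand L_omega F.zero) (simp add: algebra_simps)
  define g where "g = sW (1 / 2) (M 1 f - sW (1 / 2) (M (-1) (M 2 f)) + sW (1 / 6) (M (-1) (M (-1) (M 3 f)))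
     - sW (1 / 24) (M (-1) (M (-1) (M (-1) (M 4 f)))) + sW (1 / 120) (M (-1) (M (-1) (M (-1) (M (-1) (M 5 f))))))"
  have fg: "f = M (-1) g"
  proof (rule W.functional_eqI)
    fix \<phi> :: "'w \<Rightarrow> complex"
    assume \<phi>: "\<And>x y. \<phi> (x + y) = \<phi> x + \<phi> y" "\<And>x y. \<phi> (x - y) = \<phi> x - \<phi> y"
      "\<And>a x. \<phi> (sW a x) = a * \<phi> x" "\<And>x. \<phi> (- x) = - \<phi> x"
    have "\<phi> 0 = 0" using \<phi>(3)[of 0 0] by simp
    then show "\<phi> f = \<phi> (M (-1) g)"
      using arg_cong[OF c0, of \<phi>] by (simp add: g_def W.L_linear \<phi>) (simp add: field_simps, algebra)
  qed
  have g0: "M 0 g = g"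
  proof (rule W.functional_eqI)
    fix \<phi> :: "'w \<Rightarrow> complex"
    assume \<phi>: "\<And>x y. \<phi> (x + y) = \<phi> x + \<phi> y" "\<And>x y. \<phi> (x - y) = \<phi> x - \<phi> y"
      "\<And>a x. \<phi> (sW a x) = a * \<phi> x" "\<And>x. \<phi> (- x) = - \<phi> x"
    show "\<phi> (M 0 g) = \<phi> g"
      by (simp add: g_def W.L_linear W.normal_order wt \<phi>)
  qed
  have g5: "M 5 g = 0"
    by (rule low[of _ "-4"]) (use W.weight_L[of g 1 5] g0 in auto)
  have comm: "M k f = M (-1) (M k g) + sW (of_int (k + 1)) (M (k - 1) g)" if "k > 1" for k
    unfolding fg using W.L_commute[of k "-1" g] that by simp
  have f2: "M 2 f = M (-1) (M 2 g) + sW 3 (M 1 g)" and f3: "M 3 f = M (-1) (M 3 g) + sW 4 (M 2 g)"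
    and f4: "M 4 f = M (-1) (M 4 g) + sW 5 (M 3 g)" and f5: "M 5 f = sW 6 (M 4 g)"
    using comm[of 2] comm[of 3] comm[of 4] comm[of 5] by (simp_all add: g5 W.L_zero)
  have e3: "M 3 g = sW (2 / 5) (M (-1) (M 4 g))"
  proof (rule W.functional_eqI)
    fix \<phi> :: "'w \<Rightarrow> complex"
    assume \<phi>: "\<And>x y. \<phi> (x + y) = \<phi> x + \<phi> y" "\<And>x y. \<phi> (x - y) = \<phi> x - \<phi> y"
      "\<And>a x. \<phi> (sW a x) = a * \<phi> x" "\<And>x. \<phi> (- x) = - \<phi> x"
    have "\<phi> 0 = 0" using \<phi>(3)[of 0 0] by simp
    then show "\<phi> (M 3 g) = \<phi> (sW (2 / 5) (M (-1) (M 4 g)))"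
      using arg_cong[OF c4, of \<phi>] by (simp add: f4 f5 W.L_linear \<phi>) (simp add: field_simps)
  qed
  have e1: "M 1 g = sW (1 / 3) (M (-1) (M 2 g)) - sW (1 / 60) (M (-1) (M (-1) (M (-1) (M 4 g))))"
  proof (rule W.functional_eqI)
    fix \<phi> :: "'w \<Rightarrow> complex"
    assume \<phi>: "\<And>x y. \<phi> (x + y) = \<phi> x + \<phi> y" "\<And>x y. \<phi> (x - y) = \<phi> x - \<phi> y"
      "\<And>a x. \<phi> (sW a x) = a * \<phi> x" "\<And>x. \<phi> (- x) = - \<phi> x"
    have "\<phi> 0 = 0" using \<phi>(3)[of 0 0] by simp
    then show "\<phi> (M 1 g) = \<phi> (sW (1 / 3) (M (-1) (M 2 g)) - sW (1 / 60) (M (-1) (M (-1) (M (-1) (M 4 g)))))"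
      using arg_cong[OF c2, of \<phi>] by (simp add: f2 f3 f4 f5 e3 W.L_linear \<phi>) (simp add: field_simps)
  qed
  show ?thesis using that g0 fg e3 e1 by (simp add: f_def)
qed

lemma H1_is_zero_mode:
  assumes F: "F \<in> H1 sV Y \<omega> sW YW (M 0)"
  obtains w where "M 0 w = w" "F = skew w 0"
proof -
  obtain g where g: "M 0 g = g" "F \<omega> = M (-1) g" "M 3 g = sW (2 / 5) (M (-1) (M 4 g))"
    "M 1 g = sW (1 / 3) (M (-1) (M 2 g)) - sW (1 / 60) (M (-1) (M (-1) (M (-1) (M 4 g))))"
    using H1_conformal_vector[OF F] by metis
  obtain w y where w: "M 0 w = w" and y: "M 0 y = 0"
    and yw: "y = M 1 w - sW (1 / 3) (M (-1) (M 2 w)) + sW (1 / 12) (M (-1) (M (-1) (M 3 w)))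
      - sW (1 / 60) (M (-1) (M (-1) (M (-1) (M 4 w))))"
    and y3: "M 3 y = sW (- 2 / 5) (M 4 g)" and y12: "sW 3 (M 1 y) + M (-1) (M 2 y) = sW (- 2) (M 2 g)"
    by (rule W.weight_one_coboundary[of g]) (use low g c_values in auto)
  have wk: "M k w = 0" if "k \<ge> 5" for k
    by (rule low[of _ "1 - k"]) (use W.weight_L[of w 1 k] w that in auto)
  have skw: "skew w 0 \<omega> = sW (- 1 / 2) (M (-1) (M (-1) y))"
  proof (rule W.functional_eqI)
    fix \<phi> :: "'w \<Rightarrow> complex"
    assume \<phi>: "\<And>x y. \<phi> (x + y) = \<phi> x + \<phi> y" "\<And>x y. \<phi> (x - y) = \<phi> x - \<phi> y"
      "\<And>a x. \<phi> (sW a x) = a * \<phi> x" "\<And>x. \<phi> (- x) = - \<phi> x"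
    have om: "YW \<omega> n w = M (n - 1) w" for n by (simp add: Lmode_def)
    have "skew w 0 \<omega> = - (\<Sum>j<6. sW ((-1) powi 0 * (-1) ^ j) (divpow j (YW \<omega> (0 + int j) w)))"
      by (rule skew_sum) (simp add: om wk)
    then show "\<phi> (skew w 0 \<omega>) = \<phi> (sW (- 1 / 2) (M (-1) (M (-1) y)))"
      unfolding yw by (simp add: om eval_nat_numeral lessThan_Suc divpow_def w W.L_linear \<phi>) (simp add: field_simps)
  qed
  define G where "G v = F v - skew w 0 v" for v
  have G: "G \<in> H1 sV Y \<omega> sW YW (M 0)"
    unfolding G_def by (rule H1_diff[OF F zero_mode_in_H1[OF w]])
  obtain g' where g': "M 0 g' = g'" "G \<omega> = M (-1) g'" "M 3 g' = sW (2 / 5) (M (-1) (M 4 g'))"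
    "M 1 g' = sW (1 / 3) (M (-1) (M 2 g')) - sW (1 / 60) (M (-1) (M (-1) (M (-1) (M 4 g'))))"
    using H1_conformal_vector[OF G] by metis
  \<comment> \<open>Both sides have weight 1 and the same image under L(-1), which is injective
    there.\<close>
  have g'_eq: "g' = g + sW (1 / 2) (M (-1) y)"
  proof -
    let ?x = "g' - (g + sW (1 / 2) (M (-1) y))"
    have "?x = 0"
    proof (rule W.L_minus_one_injective[where r = "-3" and k = 1])
      show "x = 0" if "M 0 x = sW (of_int k) x" "k < -3" for k x using that by (rule low)
      show "M 0 ?x = sW (of_int 1) ?x"
        by (simp add: W.L_linear g g' W.normal_order y)
      have "M (-1) g' = M (-1) g - sW (- 1 / 2) (M (-1) (M (-1) y))"
        using g'(2) g(2) skw by (simp add: G_def)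
      then show "M (-1) ?x = 0"
        using W.scale_minus_left[of "1 / 2" "M (-1) (M (-1) y)"] by (simp add: W.L_linear)
    qed simp
    then show ?thesis by simp
  qed
  have y4: "M 4 y = 0"
    by (rule low[of _ "-4"]) (use W.weight_L[of y 0 4] y in auto)
  have g'4: "M 4 g' = 0"
  proof -
    have "M 4 g' = M 4 g + sW (1 / 2) (sW 5 (M 3 y))"
      by (simp add: g'_eq W.L_linear W.normal_order y4)
    also have "\<dots> = sW (1 + 1 / 2 * 5 * (- 2 / 5)) (M 4 g)"
      unfolding y3 W.scale_left_distrib by simp
    finally show ?thesis by simp
  qed
  have g'2: "M 2 g' = 0"
  proof -
    have "M 2 g' = M 2 g + sW (1 / 2) (sW 3 (M 1 y) + M (-1) (M 2 y))"
      by (simp add: g'_eq W.L_linear W.normal_order add.commute)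
    also have "\<dots> = sW (1 + 1 / 2 * (- 2)) (M 2 g)"
      unfolding y12 W.scale_left_distrib by simp
    finally show ?thesis by simp
  qed
  \<comment> \<open>The relations obtained for \<open>G\<close> express L(1) g' and L(3) g' through
    L(2) g' and L(4) g', which now vanish; from n = 5 on, the weight is below -3.\<close>
  have "M n g' = 0" if "n > 0" for n
  proof -
    have "n = 1 \<or> n = 2 \<or> n = 3 \<or> n = 4 \<or> n \<ge> 5" using that by presburger
    then consider "n = 1" | "n = 2" | "n = 3" | "n = 4" | "n \<ge> 5" by blast
    then show ?thesis
    proof cases
      case 5
      show ?thesis by (rule low[of _ "1 - n"]) (use W.weight_L[of g' 1 n] g'(1) 5 in auto)
    qed (use g' g'2 g'4 in \<open>simp_all add: W.L_zero\<close>)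
  qed
  then have "g' = 0" by (rule primary_weight_one_zero[OF g'(1)])
  then have "G v = 0" for v using H1_eq_zero[OF G] g'(2) by (simp add: W.L_zero)
  then have "F = skew w 0" by (simp add: G_def fun_eq_iff)
  then show ?thesis using that w by blast
qed

end

theorem theorem6p2:
  fixes p q :: nat and c :: complex
    and sV :: "complex \<Rightarrow> 'v::ab_group_add \<Rightarrow> 'v"
    and Y :: "'v \<Rightarrow> int \<Rightarrow> 'v \<Rightarrow> 'v"
    and vac \<omega> :: 'v
    and sW :: "complex \<Rightarrow> 'w::ab_group_add \<Rightarrow> 'w"
    and YW :: "'v \<Rightarrow> int \<Rightarrow> 'w \<Rightarrow> 'w"
    and dW :: "'w \<Rightarrow> 'w"
  assumes "coprime p q" and "p \<ge> 2" and "q \<ge> 2"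
    and "c = 1 - 6 * (of_nat p - of_nat q)\<^sup>2 / (of_nat p * of_nat q)"
    and "is_simple_virasoro_voa sV Y vac \<omega> c"
    and "voa_module sV Y vac \<omega> sW YW"
    and "grading_operator sW (Lmode YW \<omega> 0) dW"
    and L0_graded: "dW = Lmode YW \<omega> 0"
    and "lowest_weight_ge sW dW (-3)"
  shows "H1 sV Y \<omega> sW YW dW = Z1 \<omega> sW YW dW"
proof -
  interpret virasoro_minimal_module sV Y vac \<omega> c sW YW p q
  proof
    show "vertex_operator_algebra sV Y vac \<omega> c" "virasoro_irreducible sV (Lmode Y \<omega>)"
      "virasoro_highest_weight sV (Lmode Y \<omega>) c 0 vac"
      using assms(5) by (simp_all add: is_simple_virasoro_voa_def)
    show "weak_module sV Y vac sW YW" using assms(6) by (simp add: voa_module_def)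
    fix k :: int and x
    assume x: "Lmode YW \<omega> 0 x = sW (of_int k) x" and k: "k < -3"
    show "x = 0"
    proof (rule ccontr)
      assume "x \<noteq> 0"
      then have "eigenspace sW dW (of_int k) \<noteq> {0}"
        using x by (auto simp: eigenspace_def L0_graded)
      then have "-3 \<le> Re (of_int k)" by (rule assms(9)[unfolded lowest_weight_ge_def, rule_format])
      then show False using k by simp
    qed
  qed (fact assms)+
  show ?thesis
    unfolding L0_graded
  proof (intro equalityI subsetI)
    fix F assume "F \<in> H1 sV Y \<omega> sW YW (M 0)"
    then obtain w where "M 0 w = w" "F = skew w 0" by (rule H1_is_zero_mode)
    then show "F \<in> Z1 \<omega> sW YW (M 0)" by (auto simp: Z1_def eigenspace_def)
  next
    fix F assume "F \<in> Z1 \<omega> sW YW (M 0)"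
    then show "F \<in> H1 sV Y \<omega> sW YW (M 0)"
      by (auto simp: Z1_def eigenspace_def intro: zero_mode_in_H1)
  qed
qed

end
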